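(* Let $r\ge3$ and let $\check R(z)$ be the normalized $R$-matrix of the $2r$-dimensional first fundamental representation $\tilde L_1$ of $U_q(\mathrm A_{2r-1}^{(2)})$, regarded as an operator on $\tilde L_1\otimes\tilde L_1$, where $\tilde L_1\cong L_{\omega_1}$ as a $U_q(\mathrm C_r)$-module. In terms of projectors, $$\check{R}(z)=P_{2\omega_1}^q-q^{-2}\frac{1-q^{2}z}{1-q^{-2}z}P_{\omega_2}^q-q^{-2r-2}\frac{(1-q^{2}z)(1+q^{2r}z)}{(1-q^{-2}z)(1+q^{-2r}z)}P_{\omega_0}^q .$$ In terms of matrix units, $$\check{R}(z)=\big(\check{R}(z)\big)_{\mathfrak{sl}_{2r}}-\frac{(q-q^{-1})(1-z)}{(q-q^{-1}z)(q^{r}+q^{-r}z)}Q(z),$$ where $$\big(\check R(z)\big)_{\mathfrak{sl}_{2r}}=\sum_{i=1}^{2r} E_{ii}\otimes E_{ii}+\frac{z(q-q^{-1})}{q-q^{-1}z}\sum_{i<j}E_{ii}\otimes E_{jj}+\frac{q-q^{-1}}{q-q^{-1}z}\sum_{i>j}E_{ii}\otimes E_{jj}+\frac{1-z}{q-q^{-1}z}\sum_{i\ne j}E_{ij}\otimes E_{ji},$$ $$Q(z)=z\sum_{i+j<2r+1}\frac{\varepsilon_i^q\varepsilon_j^q}{q^{r}}E_{ij}\otimes E_{\bar i\,\bar j}-\sum_{i+j>2r+1}\frac{\varepsilon_i^q\varepsilon_j^q}{q^{-r}}E_{ij}\otimes E_{\bar i\,\bar j}+\frac{q^{r-1/2}-q^{-r+1/2}z}{q^{1/2}+q^{-1/2}}\sum_{i+j=2r+1}E_{ij}\otimes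 E_{\bar i\,\bar j},$$ with all indices running over $1,\dots,2r$, $\bar i=2r+1-i$, and $\varepsilon_i^q=(-q)^{r+1-i}$, $\varepsilon_{\bar i}^q=-\varepsilon_i^{q^{-1}}$ for $1\le i\le r$.
   Context: Fix $q\in\mathbb C^\times$, not a root of unity, and a square root $q^{1/2}$. Algebra. $U_q(\mathrm A_{2r-1}^{(2)})$ (level zero) is generated by $E_i,F_i,K_i^{\pm1}$, $i=0,\dots,r$, with $d_0=\dots=d_{r-1}=1$, $d_r=2$, $q_i=q^{d_i}$, symmetrized Cartan matrix $B$ with $B_{ii}=2d_i$, $B_{02}=-1$, $B_{i,i+1}=-1$ ($1\le i\le r-2$), $B_{r-1,r}=-2$ (symmetric, other entries $0$), Cartan matrix $C_{ij}=B_{ij}/d_i$. Relations: the $K_i$ are invertible and commute, $K_0K_1K_2^2\cdots K_{r-1}^2K_r=1$, $K_iE_jK_i^{-1}=q^{B_{ij}}E_j$, $K_iF_jK_i^{-1}=q^{-B_{ij}}F_j$, $[E_i,F_j]=\delta_{ij}\frac{K_i-K_i^{-1}}{q_i-q_i^{-1}}$, and the quantum Serre relations. Coproduct: $\Delta K_i=K_i\otimes K_i$, $\Delta E_i=E_i\otimes K_i^{1/2}+K_i^{-1/2}\otimes E_i$, $\Delta F_i=F_i\otimes K_i^{1/2}+K_i^{-1/2}\otimes F_i$, where $K_i^{\pm1/2}$ acts by $q_i^{\pm\lambda_i/2}$ on a vector on which $K_i$ acts by $q_i^{\lambda_i}$. The subalgebra generated by $E_i,F_i,K_i^{\pm1}$,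 $1\le i\le r$, is $U_q(\mathrm C_r)$; $L_\lambda$ is its irreducible (type 1) module of highest weight $\lambda$, $\omega_i$ are the fundamental weights, $\omega_0=0$. First fundamental module. $\tilde L_1(a)$, $a\in\mathbb C^\times$, has basis $v_1,\dots,v_{2r}$ with $v_1$ of weight $\omega_1$; the nonzero actions of $F_1,\dots,F_r$ are $F_iv_i=v_{i+1}$, $F_iv_{\overline{i+1}}=v_{\bar i}$ ($1\le i\le r$; for $i=r$ the two coincide), and $E_i$ is the transpose of $F_i$. $E_{ij}$ are the matrix units, $E_{ij}v_k=\delta_{jk}v_i$. Further, $K_0=q^{-1}E_{11}+q^{-1}E_{22}+\sum_{i=3}^{2r-2}E_{ii}+qE_{2r-1,2r-1}+qE_{2r,2r}$, $E_0(a)=a(E_{2r-1,1}+E_{2r,2})$, and $F_0(a)$ is the transpose of $a^{-2}E_0(a)$. (In terms of Drinfeld polynomials this is the first fundamental module, up to an overall rescaling of $a$ that does not affect $\check R$.) $R$-matrix. $\check R(z)$ is the rational $\mathrm{End}(\tilde L_1\otimes\tilde L_1)$-valued function of $z$ (the flip composed with the universal $R$-matrix evaluated on $\tilde L_1(z)\otimes\tilde L_1(1)$, normalized) such that for generic $a/b$ the map $\check R(a/b):\tilde L_1(a)\otimes\tilde L_1(b)\to\tilde L_1(b)\otimes\tilde L_1(a)$ is the unique module homomorphism with $v_1\otimes v_1\mapsto v_1\otimes v_1$. Projectors. As $U_q(\mathrm C_r)$-modules, $L_{\omega_1}\otimes L_{\omega_1}\cong L_{2\omega_1}\oplus L_{\omega_2}\oplus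 L_{\omega_0}$, and $P^q_\lambda$ is the projector onto $L_\lambda$ along the other summands. *)

theory Defs
  imports
    "HOL-Computational_Algebra.Computational_Algebra"
    "HOL-Computational_Algebra.Field_as_Ring"
    "Jordan_Normal_Form.VS_Connect"
begin

text \<open>Matrix units are indexed from 1, whereas
  \<^term>\<open>A $$ (k, l)\<close> counts from 0: the basis vector \<open>v\<^sub>i\<close> of \<open>\<complex>\<^sup>n\<close> is
  \<^term>\<open>unit_vec n (i - 1)\<close>.\<close>

definition mat_unit :: "nat \<Rightarrow> nat \<Rightarrow> nat \<Rightarrow> 'a::{zero,one} mat" where
  "mat_unit n i j = mat n n (\<lambda>(k, l). if k + 1 = i \<and> l + 1 = j then 1 else 0)"

definition sum_mat :: "nat \<Rightarrow> ('i \<Rightarrow> 'a::comm_monoid_add mat) \<Rightarrow> 'i set \<Rightarrow> 'a mat" where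
  "sum_mat n f I = mat n n (\<lambda>(k, l). \<Sum>i\<in>I. f i $$ (k, l))"

text \<open>Kronecker product: in \<open>\<complex>\<^sup>m \<otimes> \<complex>\<^sup>n\<close> the vector \<open>v\<^sub>i \<otimes> v\<^sub>j\<close> is the basis
  vector number \<open>(i - 1) n + (j - 1)\<close> (counted from 0).\<close>

definition kron :: "'a::times mat \<Rightarrow> 'a mat \<Rightarrow> 'a mat"  (infixr \<open>\<otimes>\<^sub>k\<close> 75) where
  "A \<otimes>\<^sub>k B = mat (dim_row A * dim_row B) (dim_col A * dim_col B)
     (\<lambda>(k, l). A $$ (k div dim_row B, l div dim_col B) * B $$ (k mod dim_row B, l mod dim_col B))"

text \<open>Elements of \<open>\<complex>(z)\<close>.  \<open>rat_eval f z\<^sub>0\<close> is the value of \<open>f\<close> in lowest terms; it is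
  only meaningful away from the (finitely many) poles of \<open>f\<close>.\<close>

type_synonym ratfun = "complex poly fract"

abbreviation rat_const :: "complex \<Rightarrow> ratfun" where
  "rat_const c \<equiv> to_fract [:c:]"

abbreviation rat_var :: ratfun where
  "rat_var \<equiv> to_fract [:0, 1:]"

definition rat_eval :: "ratfun \<Rightarrow> complex \<Rightarrow> complex" where
  "rat_eval f z = poly (fst (quot_of_fract f)) z / poly (snd (quot_of_fract f)) z"

definition mat_eval :: "ratfun mat \<Rightarrow> complex \<Rightarrow> complex mat" where
  "mat_eval R z = map_mat (\<lambda>f. rat_eval f z) R"

definition mat_const :: "complex mat \<Rightarrow> ratfun mat" where
  "mat_const P = map_mat rat_const P"

definition dsym :: "nat \<Rightarrow> nat \<Rightarrow> int" where
  "dsym r i = (if i = r then 2 else 1)"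

definition Bmat :: "nat \<Rightarrow> nat \<Rightarrow> nat \<Rightarrow> int" where
  "Bmat r i j =
    (if i = j then 2 * dsym r i
     else if {i, j} = {0, 2} then -1
     else if (\<exists>k. 1 \<le> k \<and> k + 2 \<le> r \<and> {i, j} = {k, k + 1}) then -1
     else if {i, j} = {r - 1, r} then -2
     else 0)"

definition Cmat :: "nat \<Rightarrow> nat \<Rightarrow> nat \<Rightarrow> int" where
  "Cmat r i j = Bmat r i j div dsym r i"  \<comment> \<open>the division is exact\<close>

definition qi :: "nat \<Rightarrow> complex \<Rightarrow> nat \<Rightarrow> complex" where
  "qi r q i = q powi dsym r i"

text \<open>Finite-dimensional level zero modules of type 1 over \<open>U\<^sub>q(A\<^bsub>2r-1\<^esub>\<^sup>(\<^sup>2\<^sup>))\<close>, in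
  coordinates with respect to a basis of weight vectors: \<open>K\<^sub>i\<close> acts on the \<open>k\<close>-th basis vector (counted from 0) by \<open>q\<^sub>i\<close> to the power
  \<open>mwt M i k\<close>. This exponent also determines \<open>K\<^sub>i\<^sup>1\<^sup>/\<^sup>2\<close>, once a square root \<open>qh\<close> of \<open>q\<close> has
  been chosen.\<close>

record umod =
  mdim :: nat
  mE :: "nat \<Rightarrow> complex mat"
  mF :: "nat \<Rightarrow> complex mat"
  mwt :: "nat \<Rightarrow> nat \<Rightarrow> int"

definition diag_op :: "nat \<Rightarrow> (nat \<Rightarrow> complex) \<Rightarrow> complex mat" where
  "diag_op n f = mat n n (\<lambda>(k, l). if k = l then f k else 0)"

definition mK :: "nat \<Rightarrow> complex \<Rightarrow> umod \<Rightarrow> nat \<Rightarrow> complex mat" where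
  "mK r q M i = diag_op (mdim M) (\<lambda>k. qi r q i powi mwt M i k)"

definition mKinv :: "nat \<Rightarrow> complex \<Rightarrow> umod \<Rightarrow> nat \<Rightarrow> complex mat" where
  "mKinv r q M i = diag_op (mdim M) (\<lambda>k. qi r q i powi (- mwt M i k))"

definition mKhalf :: "nat \<Rightarrow> complex \<Rightarrow> umod \<Rightarrow> nat \<Rightarrow> complex mat" where
  "mKhalf r qh M i = diag_op (mdim M) (\<lambda>k. qi r qh i powi mwt M i k)"

definition mKhalfinv :: "nat \<Rightarrow> complex \<Rightarrow> umod \<Rightarrow> nat \<Rightarrow> complex mat" where
  "mKhalfinv r qh M i = diag_op (mdim M) (\<lambda>k. qi r qh i powi (- mwt M i k))"

definition qint :: "complex \<Rightarrow> nat \<Rightarrow> complex" where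
  "qint p m = (p ^ m - inverse p ^ m) / (p - inverse p)"

definition qfact :: "complex \<Rightarrow> nat \<Rightarrow> complex" where
  "qfact p m = (\<Prod>k=1..m. qint p k)"

definition qbinom :: "complex \<Rightarrow> nat \<Rightarrow> nat \<Rightarrow> complex" where
  "qbinom p m k = qfact p m / (qfact p k * qfact p (m - k))"

definition serre :: "nat \<Rightarrow> complex \<Rightarrow> nat \<Rightarrow> nat \<Rightarrow> complex mat \<Rightarrow> complex mat \<Rightarrow> nat \<Rightarrow> complex mat"
  where
  "serre r q i j X Y n = sum_mat n
     (\<lambda>k. ((-1) ^ k * qbinom (qi r q i) (nat (1 - Cmat r i j)) k) \<cdot>\<^sub>m
          (X ^\<^sub>m (nat (1 - Cmat r i j) - k) * Y * X ^\<^sub>m k))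
     {0..nat (1 - Cmat r i j)}"

text \<open>The defining relations. The \<open>K\<^sub>i\<close> are invertible and commute by construction; the level
  zero relation \<open>K\<^sub>0 K\<^sub>1 K\<^sub>2\<^sup>2 \<cdots> K\<^bsub>r-1\<^esub>\<^sup>2 K\<^sub>r = 1\<close> is written on the basis of weight vectors.\<close>

definition umodule :: "nat \<Rightarrow> complex \<Rightarrow> umod \<Rightarrow> bool" where
  "umodule r q M \<longleftrightarrow>
    (\<forall>i\<in>{0..r}. mE M i \<in> carrier_mat (mdim M) (mdim M) \<and> mF M i \<in> carrier_mat (mdim M) (mdim M)) \<and>
    (\<forall>k<mdim M. qi r q 0 powi mwt M 0 k * qi r q 1 powi mwt M 1 k *
        (\<Prod>i=2..r-1. (qi r q i powi mwt M i k)\<^sup>2) * qi r q r powi mwt M r k = 1) \<and>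
    (\<forall>i\<in>{0..r}. \<forall>j\<in>{0..r}.
        mK r q M i * mE M j * mKinv r q M i = (q powi Bmat r i j) \<cdot>\<^sub>m mE M j \<and>
        mK r q M i * mF M j * mKinv r q M i = (q powi (- Bmat r i j)) \<cdot>\<^sub>m mF M j \<and>
        mE M i * mF M j - mF M j * mE M i =
          (if i = j then (1 / (qi r q i - inverse (qi r q i))) \<cdot>\<^sub>m (mK r q M i - mKinv r q M i)
           else 0\<^sub>m (mdim M) (mdim M)) \<and>
        (i \<noteq> j \<longrightarrow> serre r q i j (mE M i) (mE M j) (mdim M) = 0\<^sub>m (mdim M) (mdim M) \<and>
                 serre r q i j (mF M i) (mF M j) (mdim M) = 0\<^sub>m (mdim M) (mdim M)))"

definition utensor :: "nat \<Rightarrow> complex \<Rightarrow> umod \<Rightarrow> umod \<Rightarrow> umod" where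
  "utensor r qh M N = \<lparr>
     mdim = mdim M * mdim N,
     mE = (\<lambda>i. mE M i \<otimes>\<^sub>k mKhalf r qh N i + mKhalfinv r qh M i \<otimes>\<^sub>k mE N i),
     mF = (\<lambda>i. mF M i \<otimes>\<^sub>k mKhalf r qh N i + mKhalfinv r qh M i \<otimes>\<^sub>k mF N i),
     mwt = (\<lambda>i k. mwt M i (k div mdim N) + mwt N i (k mod mdim N)) \<rparr>"

definition umodule_hom :: "nat \<Rightarrow> complex \<Rightarrow> umod \<Rightarrow> umod \<Rightarrow> complex mat \<Rightarrow> bool" where
  "umodule_hom r q M N T \<longleftrightarrow>
    umodule r q M \<and> umodule r q N \<and> T \<in> carrier_mat (mdim N) (mdim M) \<and>
    (\<forall>i\<in>{0..r}. T * mE M i = mE N i * T \<and> T * mF M i = mF N i * T \<and>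
       T * mK r q M i = mK r q N i * T \<and> T * mKinv r q M i = mKinv r q N i * T)"

definition bar :: "nat \<Rightarrow> nat \<Rightarrow> nat" where
  "bar r i = 2 * r + 1 - i"

definition L1F :: "nat \<Rightarrow> nat \<Rightarrow> complex mat" where
  "L1F r i =
    (if i = r then mat_unit (2 * r) (r + 1) r
     else mat_unit (2 * r) (i + 1) i + mat_unit (2 * r) (bar r i) (bar r (i + 1)))"

definition L1E0 :: "nat \<Rightarrow> complex \<Rightarrow> complex mat" where
  "L1E0 r a = a \<cdot>\<^sub>m (mat_unit (2 * r) (2 * r - 1) 1 + mat_unit (2 * r) (2 * r) 2)"

text \<open>\<open>L1wt r i k\<close> is the weight of \<open>v\<^sub>k\<close> (\<open>1 \<le> k \<le> 2r\<close>). For \<open>1 \<le> i \<le> r\<close> it expresses that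
  \<open>v\<^sub>1\<close> has weight \<open>\<omega>\<^sub>1\<close>, hence \<open>v\<^sub>k\<close> has weight \<open>\<omega>\<^sub>k - \<omega>\<^bsub>k-1\<^esub>\<close> and \<open>v\<close> with index \<open>bar k\<close> has the
  opposite weight, for \<open>1 \<le> k \<le> r\<close>.\<close>

definition L1wt :: "nat \<Rightarrow> nat \<Rightarrow> nat \<Rightarrow> int" where
  "L1wt r i k =
    (if i = 0 then (if k = 1 \<or> k = 2 then -1 else if k = 2 * r - 1 \<or> k = 2 * r then 1 else 0)
     else if k \<le> r then of_bool (i = k) - of_bool (i + 1 = k)
     else of_bool (i + 1 = bar r k) - of_bool (i = bar r k))"

definition L1 :: "nat \<Rightarrow> complex \<Rightarrow> umod" where
  "L1 r a = \<lparr>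
     mdim = 2 * r,
     mE = (\<lambda>i. if i = 0 then L1E0 r a else transpose_mat (L1F r i)),
     mF = (\<lambda>i. if i = 0 then transpose_mat (inverse (a\<^sup>2) \<cdot>\<^sub>m L1E0 r a) else L1F r i),
     mwt = (\<lambda>i k. L1wt r i (k + 1)) \<rparr>"

text \<open>``Generic \<open>a/b\<close>'' means all but finitely many values of \<open>a/b\<close>; the exceptional set may
  contain the poles of \<open>R\<close>. The vector \<open>v\<^sub>1 \<otimes> v\<^sub>1\<close> is \<^term>\<open>unit_vec ((2 * r)\<^sup>2) 0\<close>.\<close>

definition normalized_R_matrix :: "nat \<Rightarrow> complex \<Rightarrow> complex \<Rightarrow> ratfun mat \<Rightarrow> bool" where
  "normalized_R_matrix r q qh R \<longleftrightarrow>
    R \<in> carrier_mat ((2 * r)\<^sup>2) ((2 * r)\<^sup>2) \<and>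
    (\<exists>S. finite S \<and>
      (\<forall>a b. a \<noteq> 0 \<and> b \<noteq> 0 \<and> a / b \<notin> S \<longrightarrow>
        (let is_normalized_hom = (\<lambda>T.
               umodule_hom r q (utensor r qh (L1 r a) (L1 r b)) (utensor r qh (L1 r b) (L1 r a)) T \<and>
               T *\<^sub>v unit_vec ((2 * r)\<^sup>2) 0 = unit_vec ((2 * r)\<^sup>2) 0)
         in is_normalized_hom (mat_eval R (a / b)) \<and>
            (\<forall>T. is_normalized_hom T \<longrightarrow> T = mat_eval R (a / b)))))"

definition C_submodule :: "nat \<Rightarrow> complex \<Rightarrow> umod \<Rightarrow> complex vec set \<Rightarrow> bool" where
  "C_submodule r q M W \<longleftrightarrow>
    subspace class_ring W (module_vec TYPE(complex) (mdim M)) \<and>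
    (\<forall>i\<in>{1..r}. \<forall>w\<in>W. mE M i *\<^sub>v w \<in> W \<and> mF M i *\<^sub>v w \<in> W \<and>
       mK r q M i *\<^sub>v w \<in> W \<and> mKinv r q M i *\<^sub>v w \<in> W)"

text \<open>Weights of \<open>C\<^sub>r\<close> are given by their coordinates \<open>\<lambda>\<^sub>1, \<dots>, \<lambda>\<^sub>r\<close> in the basis of fundamental
  weights.\<close>

definition fund_weight :: "nat \<Rightarrow> nat \<Rightarrow> int" where
  "fund_weight i = (\<lambda>j. if i \<noteq> 0 \<and> j = i then 1 else 0)"

text \<open>\<open>W\<close> is a submodule isomorphic to \<open>L\<^sub>\<lambda>\<close>, i.e.\ an irreducible submodule with highest
  weight \<open>\<lambda>\<close>.\<close>

definition is_L :: "nat \<Rightarrow> complex \<Rightarrow> umod \<Rightarrow> (nat \<Rightarrow> int) \<Rightarrow> complex vec set \<Rightarrow> bool" where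
  "is_L r q M lam W \<longleftrightarrow>
    C_submodule r q M W \<and> W \<noteq> {0\<^sub>v (mdim M)} \<and>
    (\<forall>U. C_submodule r q M U \<and> U \<subseteq> W \<longrightarrow> U = {0\<^sub>v (mdim M)} \<or> U = W) \<and>
    (\<exists>w\<in>W. w \<noteq> 0\<^sub>v (mdim M) \<and>
      (\<forall>i\<in>{1..r}. mE M i *\<^sub>v w = 0\<^sub>v (mdim M) \<and>
                   mK r q M i *\<^sub>v w = (qi r q i powi lam i) \<cdot>\<^sub>v w))"

text \<open>As a \<open>U\<^sub>q(C\<^sub>r)\<close>-module, \<^term>\<open>L1 r a\<close> does not depend on \<open>a\<close>, so \<open>a = 1\<close> is used for
  the restriction of the tensor square.\<close>

definition projectors ::
  "nat \<Rightarrow> complex \<Rightarrow> complex \<Rightarrow> complex mat \<Rightarrow> complex mat \<Rightarrow> complex mat \<Rightarrow> bool" where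
  "projectors r q qh P2w1 Pw2 Pw0 \<longleftrightarrow>
    (let M = utensor r qh (L1 r 1) (L1 r 1); n = mdim M in
      P2w1 \<in> carrier_mat n n \<and> Pw2 \<in> carrier_mat n n \<and> Pw0 \<in> carrier_mat n n \<and>
      (\<exists>W2w1 Ww2 Ww0.
        is_L r q M (\<lambda>j. 2 * fund_weight 1 j) W2w1 \<and>
        is_L r q M (fund_weight 2) Ww2 \<and>
        is_L r q M (fund_weight 0) Ww0 \<and>
        (\<forall>v\<in>carrier_vec n. \<exists>!(x, y, w). x \<in> W2w1 \<and> y \<in> Ww2 \<and> w \<in> Ww0 \<and> v = x + y + w) \<and>
        (\<forall>x\<in>W2w1. \<forall>y\<in>Ww2. \<forall>w\<in>Ww0.
          P2w1 *\<^sub>v (x + y + w) = x \<and> Pw2 *\<^sub>v (x + y + w) = y \<and> Pw0 *\<^sub>v (x + y + w) = w)))"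

definition eps :: "nat \<Rightarrow> complex \<Rightarrow> nat \<Rightarrow> complex" where
  "eps r q i = (if i \<le> r then (- q) ^ (r + 1 - i) else - ((- inverse q) ^ (r + 1 - bar r i)))"

definition mat_unit2 :: "nat \<Rightarrow> nat \<Rightarrow> nat \<Rightarrow> nat \<Rightarrow> nat \<Rightarrow> ratfun mat" where
  "mat_unit2 r i j k l = mat_unit (2 * r) i j \<otimes>\<^sub>k mat_unit (2 * r) k l"

definition idx_pairs :: "nat \<Rightarrow> (nat \<Rightarrow> nat \<Rightarrow> bool) \<Rightarrow> (nat \<times> nat) set" where
  "idx_pairs r C = {(i, j). i \<in> {1..2 * r} \<and> j \<in> {1..2 * r} \<and> C i j}"

definition R_sl :: "nat \<Rightarrow> complex \<Rightarrow> ratfun mat" where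
  "R_sl r q =
    (let N = (2 * r)\<^sup>2; z = rat_var; Q = rat_const q; D = Q - inverse Q * z in
      sum_mat N (\<lambda>i. mat_unit2 r i i i i) {1..2 * r}
      + (z * (Q - inverse Q) / D) \<cdot>\<^sub>m
          sum_mat N (\<lambda>(i, j). mat_unit2 r i i j j) (idx_pairs r (\<lambda>i j. i < j))
      + ((Q - inverse Q) / D) \<cdot>\<^sub>m
          sum_mat N (\<lambda>(i, j). mat_unit2 r i i j j) (idx_pairs r (\<lambda>i j. i > j))
      + ((1 - z) / D) \<cdot>\<^sub>m
          sum_mat N (\<lambda>(i, j). mat_unit2 r i j j i) (idx_pairs r (\<lambda>i j. i \<noteq> j)))"

definition Q_mat :: "nat \<Rightarrow> complex \<Rightarrow> complex \<Rightarrow> ratfun mat" where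
  "Q_mat r q qh =
    (let N = (2 * r)\<^sup>2; z = rat_var; S = rat_const qh in
      z \<cdot>\<^sub>m sum_mat N
          (\<lambda>(i, j). rat_const (eps r q i * eps r q j / q ^ r) \<cdot>\<^sub>m mat_unit2 r i j (bar r i) (bar r j))
          (idx_pairs r (\<lambda>i j. i + j < 2 * r + 1))
      - sum_mat N
          (\<lambda>(i, j). rat_const (eps r q i * eps r q j / inverse q ^ r) \<cdot>\<^sub>m
                    mat_unit2 r i j (bar r i) (bar r j))
          (idx_pairs r (\<lambda>i j. i + j > 2 * r + 1))
      + ((S ^ (2 * r - 1) - inverse S ^ (2 * r - 1) * z) / (S + inverse S)) \<cdot>\<^sub>m
          sum_mat N (\<lambda>(i, j). mat_unit2 r i j (bar r i) (bar r j))
            (idx_pairs r (\<lambda>i j. i + j = 2 * r + 1)))"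

end

(* For fixed B and X the operator 1 + B U + X V defined by the matrix-unit formula commutes with the
   generators of U_q(C_r), because U and V do; the relation for F_0 holds precisely when B and X
   depend on z as in the formula. All these relations are checked on basis vectors, and those for
   the E_i follow by transposition since the operator is symmetric. Uniqueness of the normalized
   homomorphism then identifies R(t) with this operator for all but finitely many t, hence as a
   rational function.

   By Schur's lemma R(t) acts on each of the three irreducible summands by a scalar, which is read
   off from a highest weight vector: v_1 (x) v_1 in weight 2 omega_1, v_1 (x) v_2 and v_2 (x) v_1
   spanning weight omega_2 vectors, and sum_k eps_k v_k (x) v_(bar k) in weight 0. *)

theory Submission
  imports Defs
begin

text \<open>Why exactly two unknowns: the commutant of U_q(C_r) on the tensor square is
  three-dimensional, one dimension per summand. It is spanned by 1, U and the rank one operator V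
  with entries eps_c eps_k, whose image is the invariant line; U and V kill v_1 (x) v_1, so the
  normalization fixes the coefficient of 1. F_0 then contributes two linear equations, z (1 - B/q) =
  1 - q B and z (X + (q - 1/q) B) = - q^(2r) X, and their solution is the dependence of B and X on
  z.

  F_0 sends v_(bar 2) to v_1 and v_(bar 1) to v_2, the same pattern as F_i for 0 < i < r, so one
  calculation with a parameter \<zeta> (1 for F_i, z for F_0) serves both. F_r moves a single vector
  and is treated apart.

  All operator identities are proved at complex numbers t. They pass to C(z) entry by entry, because
  a rational function is determined by its values off a finite set. That the tensor products satisfy
  the defining relations is part of \<open>umodule_hom\<close>, and so is supplied by
  \<open>normalized_R_matrix\<close>.\<close>

section \<open>Intertwining identities in coordinates\<close>

text \<open>Vectors of the tensor square are represented by their coordinates: \<open>f c d\<close> is the coefficient of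
  \<open>v\<^sub>c \<otimes> v\<^sub>d\<close>. \<open>R_op\<close> models the R-matrix; \<open>L_op\<close> models the coproduct of a generator sending
  \<open>v\<close> with index \<open>p c\<close> to \<open>v\<^sub>c\<close> for \<open>c \<in> S\<close>, where \<open>K\<^sup>1\<^sup>/\<^sup>2\<close> has eigenvalues \<open>\<kappa>\<close> and \<open>\<alpha>\<close>, \<open>\<beta>\<close> are the
  spectral parameters of the two factors.\<close>

definition R_op :: "nat \<Rightarrow> (nat \<Rightarrow> nat \<Rightarrow> complex) \<Rightarrow> complex \<Rightarrow> (nat \<Rightarrow> nat \<Rightarrow> complex) \<Rightarrow>
    (nat \<Rightarrow> nat \<Rightarrow> complex) \<Rightarrow> nat \<Rightarrow> nat \<Rightarrow> complex" where
  "R_op r A B C f c d = A c d * f c d + (if c \<noteq> d then B * f d c else 0) +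
     (if d = bar r c then \<Sum>k\<in>{1..2*r}. C c k * f k (bar r k) else 0)"

definition L_op :: "nat set \<Rightarrow> (nat \<Rightarrow> nat) \<Rightarrow> (nat \<Rightarrow> complex) \<Rightarrow> complex \<Rightarrow> complex \<Rightarrow>
    (nat \<Rightarrow> nat \<Rightarrow> complex) \<Rightarrow> nat \<Rightarrow> nat \<Rightarrow> complex" where
  "L_op S p \<kappa> \<alpha> \<beta> f c d = (if c \<in> S then \<alpha> * \<kappa> d * f (p c) d else 0) +
     (if d \<in> S then \<beta> * inverse (\<kappa> c) * f c (p d) else 0)"

lemma bar_bar [simp]: "k \<in> {1..2*r} \<Longrightarrow> bar r (bar r k) = k"
  by (auto simp: bar_def)

lemma bar_in [simp]: "k \<in> {1..2*r} \<Longrightarrow> bar r k \<in> {1..2*r}"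
  by (auto simp: bar_def)

lemma bar_neq [simp]: "bar r k \<noteq> k" "k \<noteq> bar r k"
  by (auto simp: bar_def, presburger+)

lemma bar_eq_iff: "k \<in> {1..2*r} \<Longrightarrow> l \<in> {1..2*r} \<Longrightarrow> bar r k = l \<longleftrightarrow> k = bar r l"
  by (auto simp: bar_def)

lemma bar_inj: "k \<in> {1..2*r} \<Longrightarrow> l \<in> {1..2*r} \<Longrightarrow> bar r k = bar r l \<longleftrightarrow> k = l"
  by (auto simp: bar_def)

text \<open>What commuting with the generator \<open>v\<close> (index \<open>bar y\<close>) \<open>\<mapsto> v\<^sub>x\<close>, \<open>v\<close> (index \<open>bar x\<close>) \<open>\<mapsto> v\<^sub>y\<close> demands of the
  coefficients, read off at the basis vectors with first or second index \<open>x\<close>; the case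
  \<open>y\<close> is the same with \<open>x\<close> and \<open>y\<close> exchanged. Here \<open>(x, y) = (i + 1, bar i)\<close>, \<open>\<zeta> = 1\<close> for \<open>F\<^sub>i\<close>
  with \<open>i < r\<close>, and \<open>(x, y) = (1, 2)\<close>, \<open>\<zeta> = z\<close> for \<open>F\<^sub>0\<close>.\<close>

definition crossing :: "nat \<Rightarrow> (nat \<Rightarrow> nat \<Rightarrow> complex) \<Rightarrow> complex \<Rightarrow> (nat \<Rightarrow> nat \<Rightarrow> complex) \<Rightarrow>
    complex \<Rightarrow> complex \<Rightarrow> nat \<Rightarrow> nat \<Rightarrow> bool" where
  "crossing r A B C q \<zeta> x y \<longleftrightarrow>
    (\<forall>d\<in>{1..2*r} - {x, y, bar r x, bar r y}. A x d = \<zeta> * A (bar r y) d \<and> \<zeta> * A d x = A d (bar r y) \<and>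
        \<zeta> * C (bar r y) d = - q * C x d \<and> q * C d x = - \<zeta> * C d (bar r y)) \<and>
    A x x = 1 \<and> A (bar r y) (bar r y) = 1 \<and>
    \<zeta> * A (bar r y) x + q * B = 1 \<and> q * A x (bar r y) + \<zeta> * B = \<zeta> * q \<and>
    A x y = \<zeta> * A (bar r y) y + \<zeta> * C (bar r y) (bar r y) + q * C x (bar r y) \<and>
    \<zeta> * q * B = \<zeta> * B + \<zeta> * C (bar r y) y + q * C x y \<and>
    \<zeta> * q * A x y = q * A x (bar r x) + \<zeta> * C (bar r y) x + q * C x x \<and>
    B = q * B + \<zeta> * C (bar r y) (bar r x) + q * C x (bar r x) \<and>
    q * A x (bar r x) + q * C x x + \<zeta> * C x (bar r y) = \<zeta> * q * A (bar r y) (bar r x) \<and>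
    \<zeta> * B + q * C x y + \<zeta> * C x (bar r x) = \<zeta> * q * B \<and>
    \<zeta> * A (bar r x) x + q * C (bar r x) y + \<zeta> * C (bar r x) (bar r x) = A (bar r x) (bar r y) \<and>
    q * B + q * C (bar r x) x + \<zeta> * C (bar r x) (bar r y) = B"

lemma sum_four:
  fixes h :: "nat \<Rightarrow> complex"
  assumes "distinct [x, y, u, v]" "{x, y, u, v} \<subseteq> I" "finite I"
  shows "sum h I = h x + h y + h u + h v + sum h (I - {x, y, u, v})"
proof -
  have "sum h I = sum h {x, y, u, v} + sum h (I - {x, y, u, v})"
    using sum.subset_diff[OF assms(2,3), of h] by (simp add: add.commute)
  also have "sum h {x, y, u, v} = h x + h y + h u + h v"
    using assms(1) by simp
  finally show ?thesis .
qed

text \<open>The generator sends index \<open>v\<close> to \<open>x\<close> and \<open>u\<close> to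
  \<open>y\<close>. The sources \<open>u\<close>, \<open>v\<close> are the bars of the targets
  \<open>x\<close>, \<open>y\<close>, which is why the bar-pair part of the R-matrix interacts with
  it. \<open>s\<close> is the square root of q.\<close>

context
  fixes r :: nat and A C :: "nat \<Rightarrow> nat \<Rightarrow> complex" and B q s \<zeta> :: complex
    and x y u v :: nat and p :: "nat \<Rightarrow> nat" and \<kappa> :: "nat \<Rightarrow> complex"
  assumes x: "x \<in> {1..2*r}" and y: "y \<in> {1..2*r}" and uv: "u = bar r x" "v = bar r y"
    and xy: "x \<noteq> y" "x \<noteq> v"
    and s: "s \<noteq> 0" "s\<^sup>2 = q"
    and cr: "crossing r A B C q \<zeta> x y"
    and p: "p x = v" "p y = u"
    and \<kappa>: "\<kappa> x = inverse s" "\<kappa> y = inverse s" "\<kappa> u = s" "\<kappa> v = s"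
      "\<And>d. d \<notin> {x, y, u, v} \<Longrightarrow> \<kappa> d = 1"
begin

private lemma uv_in: "u \<in> {1..2*r}" "v \<in> {1..2*r}"
  using bar_in[OF x] bar_in[OF y] by (simp_all only: uv)

private lemma bars: "bar r x = u" "bar r y = v" "bar r u = x" "bar r v = y"
  using bar_bar[OF x] bar_bar[OF y] by (simp_all only: uv)

private lemma dist: "u \<noteq> v" "u \<noteq> x" "u \<noteq> y" "v \<noteq> x" "v \<noteq> y" "x \<noteq> u" "y \<noteq> u" "v \<noteq> u" "y \<noteq> v" "y \<noteq> x"
proof -
  show "u \<noteq> v" "v \<noteq> u" using bar_inj[OF x y] xy by (auto simp: uv)
  show "u \<noteq> y" "y \<noteq> u" using bar_eq_iff[OF x y] xy by (auto simp: uv)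
  show "u \<noteq> x" "x \<noteq> u" "v \<noteq> y" "y \<noteq> v" by (simp_all add: uv)
  show "v \<noteq> x" "y \<noteq> x" using xy by auto
qed

private lemma R_op_at:
  assumes "c \<in> {1..2*r}" "d \<in> {1..2*r}"
  shows "R_op r A B C f c d = A c d * f c d + (if c \<noteq> d then B * f d c else 0) + (if d = bar r c then
     C c x * f x u + C c y * f y v + C c u * f u x + C c v * f v y
     + (\<Sum>k\<in>{1..2*r} - {x, y, u, v}. C c k * f k (bar r k)) else 0)"
proof -
  have "(\<Sum>k\<in>{1..2*r}. C c k * f k (bar r k)) = C c x * f x u + C c y * f y v + C c u * f u x + C c v * f v y
     + (\<Sum>k\<in>{1..2*r} - {x, y, u, v}. C c k * f k (bar r k))"
    using sum_four[of x y u v "{1..2*r}" "\<lambda>k. C c k * f k (bar r k)"] x y uv_in dist xy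
    by (simp add: bars)
  then show ?thesis by (simp add: R_op_def)
qed

text \<open>After the generator, a bar pair (k, bar k) has a nonzero coefficient only if k or bar k
  is one of the targets \<open>x\<close>, \<open>y\<close>. The long sum thus shrinks to four terms,
  which involve only the coordinates (v, u) and (u, v).\<close>

private lemma R_op_L_op_at:
  assumes "c \<in> {1..2*r}" "d \<in> {1..2*r}"
  shows "R_op r A B C (L_op {x, y} p \<kappa> 1 \<zeta> f) c d =
     A c d * L_op {x, y} p \<kappa> 1 \<zeta> f c d + (if c \<noteq> d then B * L_op {x, y} p \<kappa> 1 \<zeta> f d c else 0) + (if d = bar r c then
     (s * C c x + \<zeta> * inverse s * C c v) * f v u + (s * C c y + \<zeta> * inverse s * C c u) * f u v else 0)"
proof -
  have "(\<Sum>k\<in>{1..2*r} - {x, y, u, v}. C c k * L_op {x, y} p \<kappa> 1 \<zeta> f k (bar r k)) = 0"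
  proof (rule sum.neutral, rule)
    fix k assume k: "k \<in> {1..2*r} - {x, y, u, v}"
    then have "bar r k \<notin> {x, y}"
      using x y bars by (auto simp: bar_def)
    then show "C c k * L_op {x, y} p \<kappa> 1 \<zeta> f k (bar r k) = 0"
      using k by (simp add: L_op_def)
  qed
  then show ?thesis
    unfolding R_op_at[OF assms]
    by (simp add: L_op_def dist xy p \<kappa> algebra_simps)
qed

text \<open>At position (x, y) the generator applied after the R-matrix reads the two bar pairs (v,
  y) and (x, u). Each contributes a long sum, and this proportionality makes the two cancel.\<close>

private lemma sum_rest_row:
  "(\<Sum>k\<in>{1..2*r} - {x, y, u, v}. \<zeta> * C v k * f k (bar r k)) = - q * (\<Sum>k\<in>{1..2*r} - {x, y, u, v}. C x k * f k (bar r k))"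
proof -
  have "(\<Sum>k\<in>{1..2*r} - {x, y, u, v}. \<zeta> * C v k * f k (bar r k)) = (\<Sum>k\<in>{1..2*r} - {x, y, u, v}. - q * (C x k * f k (bar r k)))"
    using cr by (intro sum.cong) (auto simp: crossing_def bars)
  then show ?thesis by (simp add: sum_distrib_left)
qed

lemma R_op_L_op_row:
  assumes d: "d \<in> {1..2*r}"
  shows "R_op r A B C (L_op {x, y} p \<kappa> 1 \<zeta> f) x d = L_op {x, y} p \<kappa> \<zeta> 1 (R_op r A B C f) x d"
proof -
  note facts = dist xy p \<kappa> bars
  \<comment> \<open>The Groebner basis method proves ring identities, so 1/s becomes a variable
    \<open>i\<close> subject to i s = 1.\<close>
  define i where "i = inverse s"
  have i: "i * s = 1" "inverse s = i" "inverse i = s" using s by (auto simp: i_def)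
  have sq: "s * s = q" using s(2) by (simp add: power2_eq_square)
  note rat = R_op_at[OF uv_in(2) d] R_op_at[OF uv_in(2) x] R_op_at[OF uv_in(2) y] R_op_at[OF uv_in(2) uv_in(1)] R_op_at[OF uv_in(2) uv_in(2)] R_op_at[OF x uv_in(1)] R_op_at[OF x uv_in(2)]
  note eqs = cr[unfolded crossing_def bars]
  consider "d = x" | "d = y" | "d = u" | "d = v" | "d \<notin> {x, y, u, v}" by auto
  then show ?thesis
  proof cases
    case 1
    have a: "A x x = 1" "\<zeta> * A v x + q * B = 1" "q * A x v + \<zeta> * B = \<zeta> * q" using eqs by auto
    show ?thesis unfolding 1 R_op_L_op_at[OF x x]
      apply (simp add: L_op_def rat facts i del: One_nat_def)
      using a i(1) sq apply Groebner_Basis.algebra done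
  next
    case 2
    have a: "A x y = \<zeta> * A v y + \<zeta> * C v v + q * C x v"
      "\<zeta> * q * B = \<zeta> * B + \<zeta> * C v y + q * C x y"
      "\<zeta> * q * A x y = q * A x u + \<zeta> * C v x + q * C x x"
      "B = q * B + \<zeta> * C v u + q * C x u" using eqs by auto
    define Sv where "Sv = (\<Sum>k\<in>{1..2*r} - {x, y, u, v}. C v k * f k (bar r k))"
    define Sx where "Sx = (\<Sum>k\<in>{1..2*r} - {x, y, u, v}. C x k * f k (bar r k))"
    have S: "\<zeta> * Sv = - q * Sx"
      using sum_rest_row[of f] by (simp add: Sv_def Sx_def sum_distrib_left mult.assoc)
    show ?thesis unfolding 2 R_op_L_op_at[OF x y]
      apply (simp add: L_op_def rat facts i del: One_nat_def flip: Sv_def Sx_def)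
      using a S i(1) sq apply Groebner_Basis.algebra done
  next
    case 3
    have a: "q * A x u + q * C x x + \<zeta> * C x v = \<zeta> * q * A v u"
      "\<zeta> * B + q * C x y + \<zeta> * C x u = \<zeta> * q * B" using eqs by auto
    show ?thesis unfolding 3 R_op_L_op_at[OF x uv_in(1)]
      apply (simp add: L_op_def rat facts i del: One_nat_def)
      using a i(1) sq apply Groebner_Basis.algebra done
  next
    case 4
    have a: "A x x = 1" "\<zeta> * A v x + q * B = 1" "q * A x v + \<zeta> * B = \<zeta> * q" "A v v = 1" using eqs by auto
    show ?thesis unfolding 4 R_op_L_op_at[OF x uv_in(2)]
      apply (simp add: L_op_def rat facts i del: One_nat_def)
      using a i(1) sq apply Groebner_Basis.algebra done
  next
    case 5
    have "A x d = \<zeta> * A v d" using eqs d 5 by simp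
    then show ?thesis using 5 bars x y d uv_in unfolding R_op_L_op_at[OF x d]
      by (simp add: L_op_def rat facts algebra_simps del: One_nat_def)
  qed
qed

lemma R_op_L_op_column:
  assumes c: "c \<in> {1..2*r}" "c \<notin> {x, y}"
  shows "R_op r A B C (L_op {x, y} p \<kappa> 1 \<zeta> f) c x = L_op {x, y} p \<kappa> \<zeta> 1 (R_op r A B C f) c x"
proof -
  note facts = dist xy p \<kappa> bars
  define i where "i = inverse s"
  have i: "i * s = 1" "inverse s = i" "inverse i = s" using s by (auto simp: i_def)
  have sq: "s * s = q" using s(2) by (simp add: power2_eq_square)
  note rat = R_op_at[OF c(1) uv_in(2)] R_op_at[OF uv_in(1) uv_in(2)] R_op_at[OF uv_in(2) uv_in(2)]
  note eqs = cr[unfolded crossing_def bars]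
  consider "c = u" | "c = v" | "c \<notin> {x, y, u, v}" using c by auto
  then show ?thesis
  proof cases
    case 1
    have a: "\<zeta> * A u x + q * C u y + \<zeta> * C u u = A u v"
      "q * B + q * C u x + \<zeta> * C u v = B" using eqs by auto
    \<comment> \<open>The \<open>crossing\<close> relations contain only integer powers of q;
      multiplied by 1/s they become the coefficients occurring in the goal.\<close>
    have qi: "s = i * q" using i(1) sq by Groebner_Basis.algebra
    have "i * A u v = i * \<zeta> * A u x + s * C u y + i * \<zeta> * C u u"
      unfolding qi a(1)[symmetric] by (simp add: algebra_simps)
    moreover have "i * B = s * B + s * C u x + i * \<zeta> * C u v"
      unfolding qi by (subst a(2)[symmetric]) (simp add: algebra_simps)
    ultimately show ?thesis unfolding 1 R_op_L_op_at[OF uv_in(1) x]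
      apply (simp add: L_op_def rat facts i)
      apply Groebner_Basis.algebra done
  next
    case 2
    have a: "\<zeta> * A v x + q * B = 1" "A v v = 1" using eqs by auto
    show ?thesis unfolding 2 R_op_L_op_at[OF uv_in(2) x]
      apply (simp add: L_op_def rat facts i)
      using a i(1) sq apply Groebner_Basis.algebra done
  next
    case 3
    have "\<zeta> * A c x = A c v" using eqs c 3 by simp
    moreover have "x \<noteq> bar r c" "v \<noteq> bar r c"
      using 3 bar_bar[OF c(1)] bars by auto
    ultimately show ?thesis using 3 c unfolding R_op_L_op_at[OF c(1) x]
      by (simp add: L_op_def rat facts algebra_simps)
  qed
qed

text \<open>The right side is zero here. On the left only the bar-pair part can contribute, when d =
  bar c, with coefficients s C c x + \<zeta> C c v / s and s C c y + \<zeta> C c u / s. Each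
  vanishes by one of the two \<open>crossing\<close> hypotheses.\<close>

lemma R_op_L_op_off:
  assumes c: "c \<in> {1..2*r}" "d \<in> {1..2*r}" "c \<notin> {x, y}" "d \<notin> {x, y}" and cr': "crossing r A B C q \<zeta> y x"
  shows "R_op r A B C (L_op {x, y} p \<kappa> 1 \<zeta> f) c d = L_op {x, y} p \<kappa> \<zeta> 1 (R_op r A B C f) c d"
proof (cases "d = bar r c")
  case True
  then have "c \<notin> {x, y, u, v}" using c bars by auto
  then have "c \<in> {1..2*r} - {x, y, u, v}" "c \<in> {1..2*r} - {y, x, v, u}" using c by auto
  note this(1)[THEN bspec[OF conjunct1[OF cr[unfolded crossing_def bars]]]] this(2)[THEN bspec[OF conjunct1[OF cr'[unfolded crossing_def bars]]]]
  then have "q * C c x = - \<zeta> * C c v" "q * C c y = - \<zeta> * C c u"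
    by blast+
  moreover have "inverse s * s = 1" "s * s = q" using s by (simp_all add: power2_eq_square)
  ultimately have "s * C c x + \<zeta> * inverse s * C c v = 0" "s * C c y + \<zeta> * inverse s * C c u = 0"
    by Groebner_Basis.algebra+
  then show ?thesis using c by (simp add: R_op_L_op_at[OF c(1,2)] L_op_def)
next
  case False
  then show ?thesis using c by (simp add: R_op_L_op_at[OF c(1,2)] L_op_def)
qed

end

text \<open>The generator is unchanged when (x, v) and (y, u) are exchanged, so the positions with
  an index \<open>y\<close> are the cases for \<open>x\<close> with the roles swapped.\<close>

lemma R_op_L_op_pair:
  assumes x: "x \<in> {1..2*r}" and y: "y \<in> {1..2*r}" and xy: "x \<noteq> y" "x \<noteq> bar r y"
    and s: "s \<noteq> 0" "s\<^sup>2 = q"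
    and cr: "crossing r A B C q \<zeta> x y" "crossing r A B C q \<zeta> y x"
    and p: "p x = bar r y" "p y = bar r x"
    and \<kappa>: "\<And>d. d \<in> {x, y} \<Longrightarrow> \<kappa> d = inverse s" "\<And>d. d \<in> {bar r x, bar r y} \<Longrightarrow> \<kappa> d = s"
      "\<And>d. d \<notin> {x, y, bar r x, bar r y} \<Longrightarrow> \<kappa> d = 1"
    and cd: "c \<in> {1..2*r}" "d \<in> {1..2*r}"
  shows "R_op r A B C (L_op {x, y} p \<kappa> 1 \<zeta> f) c d = L_op {x, y} p \<kappa> \<zeta> 1 (R_op r A B C f) c d"
proof -
  have yx: "y \<noteq> x" "y \<noteq> bar r x" using xy bar_eq_iff[OF y x] by auto
  have \<kappa>': "\<And>d. d \<notin> {y, x, bar r y, bar r x} \<Longrightarrow> \<kappa> d = 1" using \<kappa>(3) by auto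
  have k: "\<kappa> x = inverse s" "\<kappa> y = inverse s" "\<kappa> (bar r x) = s" "\<kappa> (bar r y) = s" using \<kappa> by auto
  note X = x y refl refl xy s cr(1) p k \<kappa>(3)
  note Y = y x refl refl yx s cr(2) p(2,1) k(2,1,4,3) \<kappa>'
  have sw: "{y, x} = {x, y}" by auto
  consider "c = x" | "c = y" | "c \<notin> {x, y}" "d = x" | "c \<notin> {x, y}" "d = y" | "c \<notin> {x, y}" "d \<notin> {x, y}"
    by auto
  then show ?thesis
  proof cases
    case 1
    show ?thesis unfolding 1 by (rule R_op_L_op_row[OF X cd(2)])
  next
    case 2
    show ?thesis unfolding 2 by (rule R_op_L_op_row[OF Y cd(2), unfolded sw])
  next
    case 3
    show ?thesis unfolding 3 by (rule R_op_L_op_column[OF X cd(1) 3(1)])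
  next
    case 4
    show ?thesis unfolding 4 by (rule R_op_L_op_column[OF Y cd(1) 4(1)[folded sw], unfolded sw])
  next
    case 5
    show ?thesis by (rule R_op_L_op_off[OF X cd 5 cr(2)])
  qed
qed

text \<open>The analogue of \<open>crossing\<close> for \<open>F\<^sub>r\<close>, which moves only one basis vector.\<close>

definition crossing_end :: "nat \<Rightarrow> (nat \<Rightarrow> nat \<Rightarrow> complex) \<Rightarrow> complex \<Rightarrow> (nat \<Rightarrow> nat \<Rightarrow> complex) \<Rightarrow>
    complex \<Rightarrow> nat \<Rightarrow> bool" where
  "crossing_end r A B C q x \<longleftrightarrow>
    (\<forall>d\<in>{1..2*r} - {x, bar r x}. A x d = A (bar r x) d \<and> A d x = A d (bar r x) \<and>
        C (bar r x) d = - q\<^sup>2 * C x d \<and> q\<^sup>2 * C d x = - C d (bar r x)) \<and>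
    A x x = 1 \<and> A (bar r x) (bar r x) = 1 \<and>
    A (bar r x) x + q\<^sup>2 * B + C (bar r x) (bar r x) + q\<^sup>2 * C x (bar r x) = 1 \<and>
    B + q\<^sup>2 * A x (bar r x) + C (bar r x) x + q\<^sup>2 * C x x = q\<^sup>2 \<and>
    q\<^sup>2 * A x (bar r x) + B + q\<^sup>2 * C x x + C x (bar r x) = q\<^sup>2 \<and>
    A (bar r x) x + q\<^sup>2 * B + q\<^sup>2 * C (bar r x) x + C (bar r x) (bar r x) = 1"

lemma R_op_L_op_end:
  assumes x: "x \<in> {1..2*r}"
    and q: "q \<noteq> 0"
    and cr: "crossing_end r A B C q x"
    and p: "p x = bar r x"
    and \<kappa>: "\<kappa> x = inverse q" "\<kappa> (bar r x) = q" "\<And>d. d \<notin> {x, bar r x} \<Longrightarrow> \<kappa> d = 1"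
    and cd: "c \<in> {1..2*r}" "d \<in> {1..2*r}"
  shows "R_op r A B C (L_op {x} p \<kappa> 1 1 f) c d = L_op {x} p \<kappa> 1 1 (R_op r A B C f) c d"
proof -
  define u where "u = bar r x"
  have u: "u \<in> {1..2*r}" and bars: "bar r x = u" "bar r u = x" and dist: "x \<noteq> u" "u \<noteq> x"
    using bar_in[OF x] bar_bar[OF x] by (simp_all add: u_def)
  note p = p[folded u_def] and \<kappa> = \<kappa>[folded u_def]
  define i where "i = inverse q"
  have i: "i * q = 1" "inverse q = i" "inverse i = q" using q by (auto simp: i_def)
  note facts = dist p \<kappa> bars i(2,3)
  note eqs = cr[unfolded crossing_end_def bars]
  define rest where "rest c = (\<Sum>k\<in>{1..2*r} - {x, u}. C c k * f k (bar r k))" for c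
  have split: "(\<Sum>k\<in>{1..2*r}. g k) = g x + g u + (\<Sum>k\<in>{1..2*r} - {x, u}. g k)" for g :: "nat \<Rightarrow> complex"
    using sum.subset_diff[of "{x, u}" "{1..2*r}" g] x u dist by auto
  have R_at: "R_op r A B C f a b = A a b * f a b + (if a \<noteq> b then B * f b a else 0)
     + (if b = bar r a then C a x * f x u + C a u * f u x + rest a else 0)" for a b
    unfolding R_op_def split rest_def bars by simp
  have RL_at: "R_op r A B C (L_op {x} p \<kappa> 1 1 f) a b = A a b * L_op {x} p \<kappa> 1 1 f a b
     + (if a \<noteq> b then B * L_op {x} p \<kappa> 1 1 f b a else 0)
     + (if b = bar r a then (q * C a x + i * C a u) * f u u else 0)" for a b
  proof -
    have "(\<Sum>k\<in>{1..2*r} - {x, u}. C a k * L_op {x} p \<kappa> 1 1 f k (bar r k)) = 0"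
    proof (rule sum.neutral, rule)
      fix k assume k: "k \<in> {1..2*r} - {x, u}"
      then have "bar r k \<noteq> x"
        using x bars by (auto simp: bar_def)
      then show "C a k * L_op {x} p \<kappa> 1 1 f k (bar r k) = 0"
        using k by (simp add: L_op_def)
    qed
    then show ?thesis
      unfolding R_op_def[of r A B C "L_op {x} p \<kappa> 1 1 f"] split bars
      by (simp add: L_op_def facts algebra_simps)
  qed
  \<comment> \<open>At position (x, x) the generator reads both bar pairs (u, x) and (x, u); their
    long sums enter with factors 1/q and q and cancel.\<close>
  have rest: "rest u = - (q * q) * rest x"
  proof -
    have "rest u = (\<Sum>k\<in>{1..2*r} - {x, u}. - (q * q) * (C x k * f k (bar r k)))"
      unfolding rest_def using eqs by (intro sum.cong) (auto simp: power2_eq_square)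
    then show ?thesis by (simp add: sum_distrib_left rest_def)
  qed
  consider "c = x" "d = x" | "c = x" "d = u" | "c = u" "d = x" | "c = x" "d \<notin> {x, u}" | "c \<notin> {x, u}" "d = x"
    | "c \<noteq> x" "d \<noteq> x" by auto
  then show ?thesis
  proof cases
    case 1
    have a: "A x x = 1" "A u x + q\<^sup>2 * B + C u u + q\<^sup>2 * C x u = 1"
      "B + q\<^sup>2 * A x u + C u x + q\<^sup>2 * C x x = q\<^sup>2" using eqs by auto
    show ?thesis unfolding 1
      apply (simp add: L_op_def RL_at R_at facts)
      using a i(1) rest unfolding power2_eq_square apply Groebner_Basis.algebra done
  next
    case 2
    have a: "A u u = 1" "q\<^sup>2 * A x u + B + q\<^sup>2 * C x x + C x u = q\<^sup>2" using eqs by auto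
    show ?thesis unfolding 2
      apply (simp add: L_op_def RL_at R_at facts)
      using a i(1) rest unfolding power2_eq_square apply Groebner_Basis.algebra done
  next
    case 3
    have a: "A u u = 1" "A u x + q\<^sup>2 * B + q\<^sup>2 * C u x + C u u = 1" using eqs by auto
    show ?thesis unfolding 3
      apply (simp add: L_op_def RL_at R_at facts)
      using a i(1) rest unfolding power2_eq_square apply Groebner_Basis.algebra done
  next
    case 4
    then have "A x d = A u d" using eqs cd by auto
    with 4 show ?thesis by (simp add: L_op_def RL_at R_at facts algebra_simps)
  next
    case 5
    then have "A c x = A c u" "x \<noteq> bar r c" "u \<noteq> bar r c" using eqs cd x bars by (auto simp: bar_def)
    with 5 show ?thesis by (simp add: L_op_def RL_at R_at facts algebra_simps)
  next
    case 6
    have "q * C c x + i * C c u = 0" if "d = bar r c"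
    proof -
      have "c \<notin> {x, u}" using 6 that bars by auto
      then have "q\<^sup>2 * C c x = - C c u" using eqs cd by auto
      then show ?thesis using i(1) unfolding power2_eq_square by Groebner_Basis.algebra
    qed
    with 6 show ?thesis by (simp add: L_op_def RL_at)
  qed
qed

section \<open>Evaluation of rational functions\<close>

text \<open>Agreement off a finite set absorbs poles, cancelled factors and the convention x / 0 =
  0. The relation is therefore preserved by all field operations without side conditions on
  denominators.\<close>

definition represents :: "ratfun \<Rightarrow> (complex \<Rightarrow> complex) \<Rightarrow> bool" where
  "represents f \<phi> \<longleftrightarrow> finite {t. rat_eval f t \<noteq> \<phi> t}"

text \<open>\<open>rat_eval\<close> uses lowest terms c / d. If d vanished at t, the
  cross-multiplied identity a d = c b would force c to vanish at t too, against coprimality.\<close>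

lemma rat_eval_Fract:
  assumes f: "f = Fract a b" and b: "poly b t \<noteq> 0"
  shows "rat_eval f t = poly a t / poly b t"
proof -
  have b0: "b \<noteq> 0" using b by auto
  obtain c d where cd: "quot_of_fract f = (c, d)" by fastforce
  have d0: "d \<noteq> 0" using cd by (metis snd_quot_of_fract_nonzero snd_conv)
  have "f = Fract c d" using Fract_quot_of_fract[of f] by (simp add: cd)
  then have eq: "a * d = c * b" using f b0 d0 by (simp add: eq_fract)
  have cop: "coprime c d" using coprime_quot_of_fract[of f] by (simp add: cd)
  have "poly d t \<noteq> 0"
  proof
    assume d: "poly d t = 0"
    have "poly c t * poly b t = poly a t * poly d t" using eq by (metis poly_mult)
    then have "poly c t = 0" using b d by simp
    then have "[:- t, 1:] dvd c" "[:- t, 1:] dvd d" using d by (simp_all add: poly_eq_0_iff_dvd)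
    then have "is_unit [:- t, 1:]" using cop coprime_common_divisor by blast
    then show False by (simp add: is_unit_pCons_iff)
  qed
  moreover have "poly a t * poly d t = poly c t * poly b t" using eq by (metis poly_mult)
  ultimately show ?thesis using b unfolding rat_eval_def cd by (simp add: frac_eq_eq)
qed

lemma rat_eval_const [simp]: "rat_eval (rat_const c) t = c"
  by (subst rat_eval_Fract[where a = "[:c:]" and b = 1]) (simp_all add: to_fract_def)

lemma represents_const [intro]: "represents (rat_const c) (\<lambda>_. c)"
  by (simp add: represents_def)

lemma represents_var [intro]: "represents rat_var (\<lambda>t. t)"
proof -
  have "rat_eval rat_var t = t" for t
    by (subst rat_eval_Fract[where a = "[:0, 1:]" and b = 1]) (simp_all add: to_fract_def)
  then show ?thesis by (simp add: represents_def)
qed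

lemma fract_cases:
  fixes f :: ratfun
  obtains a b where "f = Fract a b" "b \<noteq> 0"
  by (cases f) auto

lemma finite_rat_eval_add: "finite {t. rat_eval (f + g) t \<noteq> rat_eval f t + rat_eval g t}"
proof -
  obtain a b where f: "f = Fract a b" and b: "b \<noteq> 0" by (rule fract_cases)
  obtain c d where g: "g = Fract c d" and d: "d \<noteq> 0" by (rule fract_cases)
  have fg: "f + g = Fract (a * d + c * b) (b * d)" using f g b d by simp
  have "{t. rat_eval (f + g) t \<noteq> rat_eval f t + rat_eval g t} \<subseteq> {t. poly (b * d) t = 0}"
  proof (safe, rule ccontr)
    fix t assume ne: "rat_eval (f + g) t \<noteq> rat_eval f t + rat_eval g t" and "poly (b * d) t \<noteq> 0"
    then have nz: "poly b t \<noteq> 0" "poly d t \<noteq> 0" "poly (b * d) t \<noteq> 0"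
      by auto
    show False
      using ne rat_eval_Fract[OF fg nz(3)] rat_eval_Fract[OF f nz(1)] rat_eval_Fract[OF g nz(2)] nz
      by (simp add: add_frac_eq)
  qed
  moreover have "finite {t. poly (b * d) t = 0}" using b d by (intro poly_roots_finite) simp
  ultimately show ?thesis by (rule finite_subset)
qed

lemma finite_rat_eval_mult: "finite {t. rat_eval (f * g) t \<noteq> rat_eval f t * rat_eval g t}"
proof -
  obtain a b where f: "f = Fract a b" and b: "b \<noteq> 0" by (rule fract_cases)
  obtain c d where g: "g = Fract c d" and d: "d \<noteq> 0" by (rule fract_cases)
  have fg: "f * g = Fract (a * c) (b * d)" using f g b d by simp
  have "{t. rat_eval (f * g) t \<noteq> rat_eval f t * rat_eval g t} \<subseteq> {t. poly (b * d) t = 0}"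
  proof (safe, rule ccontr)
    fix t assume ne: "rat_eval (f * g) t \<noteq> rat_eval f t * rat_eval g t" and "poly (b * d) t \<noteq> 0"
    then have nz: "poly b t \<noteq> 0" "poly d t \<noteq> 0" "poly (b * d) t \<noteq> 0"
      by auto
    show False
      using ne rat_eval_Fract[OF fg nz(3)] rat_eval_Fract[OF f nz(1)] rat_eval_Fract[OF g nz(2)]
      by simp
  qed
  moreover have "finite {t. poly (b * d) t = 0}" using b d by (intro poly_roots_finite) simp
  ultimately show ?thesis by (rule finite_subset)
qed

lemma finite_rat_eval_inverse: "finite {t. rat_eval (inverse f) t \<noteq> inverse (rat_eval f t)}"
proof (cases "f = 0")
  case True
  have "rat_eval 0 t = 0" for t using rat_eval_const[of 0 t] by simp
  then show ?thesis using True by simp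
next
  case False
  obtain a b where f: "f = Fract a b" and b: "b \<noteq> 0" by (rule fract_cases)
  have a: "a \<noteq> 0" using False f by (auto simp: fract_collapse)
  have i: "inverse f = Fract b a" using f by simp
  have "{t. rat_eval (inverse f) t \<noteq> inverse (rat_eval f t)} \<subseteq> {t. poly (a * b) t = 0}"
  proof (safe, rule ccontr)
    fix t assume ne: "rat_eval (inverse f) t \<noteq> inverse (rat_eval f t)" and "poly (a * b) t \<noteq> 0"
    then have nz: "poly a t \<noteq> 0" "poly b t \<noteq> 0"
      by auto
    show False
      using ne rat_eval_Fract[OF i nz(1)] rat_eval_Fract[OF f nz(2)]
      by simp
  qed
  moreover have "finite {t. poly (a * b) t = 0}" using a b by (intro poly_roots_finite) simp
  ultimately show ?thesis by (rule finite_subset)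
qed

lemma represents_add [intro]:
  assumes "represents f \<phi>" "represents g \<psi>" shows "represents (f + g) (\<lambda>t. \<phi> t + \<psi> t)"
proof -
  have "{t. rat_eval (f + g) t \<noteq> \<phi> t + \<psi> t} \<subseteq> {t. rat_eval (f + g) t \<noteq> rat_eval f t + rat_eval g t}
      \<union> {t. rat_eval f t \<noteq> \<phi> t} \<union> {t. rat_eval g t \<noteq> \<psi> t}" by auto
  then show ?thesis using assms finite_rat_eval_add[of f g] unfolding represents_def
    by (elim finite_subset) simp
qed

lemma represents_mult [intro]:
  assumes "represents f \<phi>" "represents g \<psi>" shows "represents (f * g) (\<lambda>t. \<phi> t * \<psi> t)"
proof -
  have "{t. rat_eval (f * g) t \<noteq> \<phi> t * \<psi> t} \<subseteq> {t. rat_eval (f * g) t \<noteq> rat_eval f t * rat_eval g t}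
      \<union> {t. rat_eval f t \<noteq> \<phi> t} \<union> {t. rat_eval g t \<noteq> \<psi> t}" by auto
  then show ?thesis using assms finite_rat_eval_mult[of f g] unfolding represents_def
    by (elim finite_subset) simp
qed

lemma represents_inverse [intro]:
  assumes "represents f \<phi>" shows "represents (inverse f) (\<lambda>t. inverse (\<phi> t))"
proof -
  have "{t. rat_eval (inverse f) t \<noteq> inverse (\<phi> t)} \<subseteq> {t. rat_eval (inverse f) t \<noteq> inverse (rat_eval f t)}
      \<union> {t. rat_eval f t \<noteq> \<phi> t}" by auto
  then show ?thesis using assms finite_rat_eval_inverse[of f] unfolding represents_def
    by (elim finite_subset) simp
qed

lemma represents_0 [intro]: "represents 0 (\<lambda>_. 0)"
  using represents_const[of 0] by simp

lemma represents_1 [intro]: "represents 1 (\<lambda>_. 1)"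
  using represents_const[of 1] by (simp flip: one_pCons)

lemma represents_minus [intro]:
  assumes "represents f \<phi>" shows "represents (- f) (\<lambda>t. - \<phi> t)"
proof -
  have "[:- 1:] = - (1 :: complex poly)" by (simp add: one_pCons)
  then have "rat_const (- 1) = - 1" by simp
  then show ?thesis using represents_mult[OF represents_const[of "- 1"] assms] by simp
qed

lemma represents_diff [intro]:
  assumes "represents f \<phi>" "represents g \<psi>" shows "represents (f - g) (\<lambda>t. \<phi> t - \<psi> t)"
  using represents_add[OF assms(1) represents_minus[OF assms(2)]] by simp

lemma represents_divide [intro]:
  assumes "represents f \<phi>" "represents g \<psi>" shows "represents (f / g) (\<lambda>t. \<phi> t / \<psi> t)"
  using represents_mult[OF assms(1) represents_inverse[OF assms(2)]] by (simp add: divide_inverse)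

lemma represents_power [intro]:
  assumes "represents f \<phi>" shows "represents (f ^ n) (\<lambda>t. \<phi> t ^ n)"
  by (induction n) (use assms in auto)

lemma represents_cong:
  assumes "represents f \<phi>" "finite S" "\<And>t. t \<notin> S \<Longrightarrow> \<phi> t = \<psi> t"
  shows "represents f \<psi>"
proof -
  have "{t. rat_eval f t \<noteq> \<psi> t} \<subseteq> {t. rat_eval f t \<noteq> \<phi> t} \<union> S" using assms(3) by auto
  then show ?thesis using assms(1,2) unfolding represents_def by (elim finite_subset) simp
qed

text \<open>A nonzero difference a / b takes nonzero values off the roots of a b, that is at
  infinitely many points.\<close>

lemma represents_unique:
  assumes "represents f \<phi>" "represents g \<phi>" shows "f = g"
proof (rule ccontr)
  assume "f \<noteq> g"
  obtain a b where ab: "f - g = Fract a b" and b: "b \<noteq> 0" by (rule fract_cases)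
  have a: "a \<noteq> 0" using \<open>f \<noteq> g\<close> ab by (auto simp: fract_collapse)
  have "finite {t. rat_eval (f - g) t \<noteq> 0}"
    using represents_diff[OF assms] by (simp add: represents_def)
  moreover have "- {t. poly (a * b) t = 0} \<subseteq> {t. rat_eval (f - g) t \<noteq> 0}"
    using rat_eval_Fract[OF ab] by auto
  ultimately have "finite (- {t. poly (a * b) t = 0})" by (rule rev_finite_subset)
  moreover have "finite {t. poly (a * b) t = 0}" using a b by (intro poly_roots_finite) auto
  ultimately have "finite (UNIV :: complex set)" using finite_Un by (metis Compl_partition)
  then show False using infinite_UNIV_char_0 by blast
qed

section \<open>Coordinates on the tensor square\<close>

definition tens_mat :: "nat \<Rightarrow> (nat \<Rightarrow> nat \<Rightarrow> nat \<Rightarrow> nat \<Rightarrow> 'a) \<Rightarrow> 'a mat" where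
  "tens_mat n g = mat (n\<^sup>2) (n\<^sup>2) (\<lambda>(k, l). g (k div n + 1) (k mod n + 1) (l div n + 1) (l mod n + 1))"

definition coords :: "nat \<Rightarrow> 'a vec \<Rightarrow> nat \<Rightarrow> nat \<Rightarrow> 'a" where
  "coords n v c d = v $ ((c - 1) * n + (d - 1))"

lemma tens_mat_carrier [simp]: "tens_mat n g \<in> carrier_mat (n\<^sup>2) (n\<^sup>2)"
  by (simp add: tens_mat_def)

lemma tens_index:
  fixes c d n :: nat
  assumes "c \<in> {1..n}" "d \<in> {1..n}"
  shows "(c - 1) * n + (d - 1) < n\<^sup>2" "((c - 1) * n + (d - 1)) div n + 1 = c"
    "((c - 1) * n + (d - 1)) mod n + 1 = d"
proof -
  obtain c' d' where c: "c = Suc c'" "c' < n" and d: "d = Suc d'" "d' < n"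
    using assms by (cases c; cases d) auto
  have "c' * n + d' < Suc c' * n" using d by simp
  also have "\<dots> \<le> n * n" using c by (intro mult_right_mono) auto
  finally show "(c - 1) * n + (d - 1) < n\<^sup>2" by (simp add: c d power2_eq_square)
  show "((c - 1) * n + (d - 1)) div n + 1 = c" "((c - 1) * n + (d - 1)) mod n + 1 = d"
    using c d by simp_all
qed

lemma tens_index_surj:
  fixes k n :: nat
  assumes "k < n\<^sup>2"
  obtains c d where "c \<in> {1..n}" "d \<in> {1..n}" "k = (c - 1) * n + (d - 1)"
proof
  have n: "n > 0" using assms by (cases n) auto
  show "k div n + 1 \<in> {1..n}"
    using assms n by (simp add: power2_eq_square less_mult_imp_div_less Suc_leI)
  show "k mod n + 1 \<in> {1..n}" using n by (simp add: Suc_leI)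
  show "k = (k div n + 1 - 1) * n + (k mod n + 1 - 1)" by simp
qed

lemma sum_tens_index:
  fixes h :: "nat \<Rightarrow> 'a::comm_monoid_add"
  shows "(\<Sum>l\<in>{0..<n\<^sup>2}. h l) = (\<Sum>a\<in>{1..n}. \<Sum>b\<in>{1..n}. h ((a - 1) * n + (b - 1)))"
proof -
  have "(\<Sum>a\<in>{1..n}. \<Sum>b\<in>{1..n}. h ((a - 1) * n + (b - 1)))
      = (\<Sum>(a, b)\<in>{1..n} \<times> {1..n}. h ((a - 1) * n + (b - 1)))"
    by (rule sum.cartesian_product)
  also have "\<dots> = (\<Sum>l\<in>{0..<n\<^sup>2}. h l)"
  proof (rule sum.reindex_bij_witness[where i = "\<lambda>l. (l div n + 1, l mod n + 1)"
        and j = "\<lambda>(a, b). (a - 1) * n + (b - 1)"])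
    fix ab assume "ab \<in> {1..n} \<times> {1..n}"
    then obtain a b where ab: "ab = (a, b)" "a \<in> {1..n}" "b \<in> {1..n}" by auto
    note t = tens_index[OF ab(2,3)]
    show "((case ab of (a, b) \<Rightarrow> (a - 1) * n + (b - 1)) div n + 1,
        (case ab of (a, b) \<Rightarrow> (a - 1) * n + (b - 1)) mod n + 1) = ab"
      unfolding ab prod.case t(2,3) ..
    show "(case ab of (a, b) \<Rightarrow> (a - 1) * n + (b - 1)) \<in> {0..<n\<^sup>2}"
      using t(1) unfolding ab by simp
  next
    fix l assume "l \<in> {0..<n\<^sup>2}"
    then have l: "l < n\<^sup>2" by simp
    then have n: "n > 0" by (cases n) auto
    show "(case (l div n + 1, l mod n + 1) of (a, b) \<Rightarrow> (a - 1) * n + (b - 1)) = l" by simp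
    show "(l div n + 1, l mod n + 1) \<in> {1..n} \<times> {1..n}"
      using l n by (simp add: power2_eq_square less_mult_imp_div_less Suc_leI)
  qed auto
  finally show ?thesis by simp
qed

lemma tens_mat_index:
  assumes "c \<in> {1..n}" "d \<in> {1..n}" "a \<in> {1..n}" "b \<in> {1..n}"
  shows "tens_mat n g $$ ((c - 1) * n + (d - 1), (a - 1) * n + (b - 1)) = g c d a b"
  by (simp only: tens_mat_def index_mat(1) tens_index[OF assms(1,2)] tens_index[OF assms(3,4)] prod.case)

lemma tens_mat_eqI:
  assumes "M \<in> carrier_mat (n\<^sup>2) (n\<^sup>2)"
    and "\<And>c d a b. c \<in> {1..n} \<Longrightarrow> d \<in> {1..n} \<Longrightarrow> a \<in> {1..n} \<Longrightarrow> b \<in> {1..n} \<Longrightarrow>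
      M $$ ((c - 1) * n + (d - 1), (a - 1) * n + (b - 1)) = g c d a b"
  shows "M = tens_mat n g"
proof (rule eq_matI)
  fix k l assume "k < dim_row (tens_mat n g)" "l < dim_col (tens_mat n g)"
  then have kl: "k < n\<^sup>2" "l < n\<^sup>2" by (simp_all add: tens_mat_def)
  obtain c d where cd: "c \<in> {1..n}" "d \<in> {1..n}" "k = (c - 1) * n + (d - 1)"
    by (rule tens_index_surj[OF kl(1)])
  obtain a b where ab: "a \<in> {1..n}" "b \<in> {1..n}" "l = (a - 1) * n + (b - 1)"
    by (rule tens_index_surj[OF kl(2)])
  show "M $$ (k, l) = tens_mat n g $$ (k, l)"
    unfolding cd(3) ab(3) using assms(2) tens_mat_index cd(1,2) ab(1,2) by metis
qed (use assms(1) in \<open>auto simp: tens_mat_def\<close>)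

lemma coords_mult_mat_vec:
  fixes v :: "'a::comm_semiring_0 vec"
  assumes "M \<in> carrier_mat (n\<^sup>2) (n\<^sup>2)" "v \<in> carrier_vec (n\<^sup>2)" "c \<in> {1..n}" "d \<in> {1..n}"
  shows "coords n (M *\<^sub>v v) c d =
    (\<Sum>a\<in>{1..n}. \<Sum>b\<in>{1..n}. M $$ ((c - 1) * n + (d - 1), (a - 1) * n + (b - 1)) * coords n v a b)"
proof -
  let ?k = "(c - 1) * n + (d - 1)"
  have k: "?k < n\<^sup>2" using tens_index[OF assms(3,4)] by simp
  have "coords n (M *\<^sub>v v) c d = (\<Sum>l\<in>{0..<n\<^sup>2}. M $$ (?k, l) * v $ l)"
    using k assms(1,2) by (auto simp: coords_def scalar_prod_def intro!: sum.cong)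
  then show ?thesis by (simp only: sum_tens_index coords_def)
qed

lemma coords_tens_mat:
  fixes v :: "'a::comm_semiring_0 vec"
  assumes "v \<in> carrier_vec (n\<^sup>2)" "c \<in> {1..n}" "d \<in> {1..n}"
  shows "coords n (tens_mat n g *\<^sub>v v) c d = (\<Sum>a\<in>{1..n}. \<Sum>b\<in>{1..n}. g c d a b * coords n v a b)"
  unfolding coords_mult_mat_vec[OF tens_mat_carrier assms]
  by (intro sum.cong refl) (use assms(2,3) tens_mat_index in metis)

lemma coords_eqI:
  assumes "v \<in> carrier_vec (n\<^sup>2)" "w \<in> carrier_vec (n\<^sup>2)"
    and "\<And>c d. c \<in> {1..n} \<Longrightarrow> d \<in> {1..n} \<Longrightarrow> coords n v c d = coords n w c d"
  shows "v = w"
proof (rule eq_vecI)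
  fix k assume "k < dim_vec w"
  then have "k < n\<^sup>2" using assms(2) by simp
  then obtain c d where "c \<in> {1..n}" "d \<in> {1..n}" "k = (c - 1) * n + (d - 1)"
    by (rule tens_index_surj)
  then show "v $ k = w $ k" using assms(3) by (simp add: coords_def)
qed (use assms in auto)

lemma coords_linear [simp]:
  fixes v w :: "'a::comm_ring_1 vec"
  assumes "v \<in> carrier_vec (n\<^sup>2)" "w \<in> carrier_vec (n\<^sup>2)" "c \<in> {1..n}" "d \<in> {1..n}"
  shows "coords n (v + w) c d = coords n v c d + coords n w c d"
    "coords n (v - w) c d = coords n v c d - coords n w c d"
    "coords n (k \<cdot>\<^sub>v v) c d = k * coords n v c d"
    "coords n (0\<^sub>v (n\<^sup>2)) c d = 0"
  using assms tens_index[OF assms(3,4)] by (simp_all add: coords_def)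

lemma kron_carrier [simp]:
  "A \<in> carrier_mat n n \<Longrightarrow> B \<in> carrier_mat n n \<Longrightarrow> A \<otimes>\<^sub>k B \<in> carrier_mat (n\<^sup>2) (n\<^sup>2)"
  by (simp add: kron_def power2_eq_square)

lemma kron_index:
  assumes "A \<in> carrier_mat n n" "B \<in> carrier_mat n n"
    "c \<in> {1..n}" "d \<in> {1..n}" "a \<in> {1..n}" "b \<in> {1..n}"
  shows "(A \<otimes>\<^sub>k B) $$ ((c - 1) * n + (d - 1), (a - 1) * n + (b - 1))
    = A $$ (c - 1, a - 1) * B $$ (d - 1, b - 1)"
proof -
  have "((c - 1) * n + (d - 1)) div n = c - 1" "((c - 1) * n + (d - 1)) mod n = d - 1"
    "((a - 1) * n + (b - 1)) div n = a - 1" "((a - 1) * n + (b - 1)) mod n = b - 1"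
    using tens_index(2,3)[OF assms(3,4)] tens_index(2,3)[OF assms(5,6)] by (metis add_diff_cancel_right')+
  moreover have "dim_row A = n" "dim_col A = n" "dim_row B = n" "dim_col B = n" using assms(1,2) by auto
  ultimately show ?thesis
    using tens_index(1)[OF assms(3,4)] tens_index(1)[OF assms(5,6)]
    by (simp only: kron_def power2_eq_square index_mat(1) prod.case)
qed

section \<open>The coefficients of the R-matrix\<close>

text \<open>With \<open>B = (1 - z) / (q - q\<^sup>-\<^sup>1 z)\<close> and \<open>X = - (q - q\<^sup>-\<^sup>1) B z / (q\<^sup>2\<^sup>r + z)\<close> the matrix in the
  theorem has the entries below, which are affine in \<open>(B, X)\<close>. Only the intertwining relations for
  \<open>F\<^sub>0\<close> use how \<open>B\<close> and \<open>X\<close> depend on \<open>z\<close>.\<close>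

definition R_A :: "complex \<Rightarrow> complex \<Rightarrow> nat \<Rightarrow> nat \<Rightarrow> complex" where
  "R_A q B c d = (if c < d then 1 - q * B else if d < c then 1 - inverse q * B else 1)"

text \<open>As eps_c eps_(bar c) = -1, the X-part is eps_c eps_k X in all three cases: the rank one
  operator V. In the same normalization the coefficient of B is 0, q - 1/q or, on the antidiagonal,
  1 - 1/q.\<close>

definition R_C :: "nat \<Rightarrow> complex \<Rightarrow> complex \<Rightarrow> complex \<Rightarrow> nat \<Rightarrow> nat \<Rightarrow> complex" where
  "R_C r q B X c k = (if c + k < 2 * r + 1 then eps r q c * eps r q k * X
     else if 2 * r + 1 < c + k then eps r q c * eps r q k * (X + (q - inverse q) * B)
     else - X - (1 - inverse q) * B)"

lemma R_C_sym: "R_C r q B X c k = R_C r q B X k c"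
  by (simp add: R_C_def add.commute mult.commute)

lemma eps_nz [simp]: "q \<noteq> 0 \<Longrightarrow> eps r q k \<noteq> 0"
  by (simp add: eps_def)

lemma eps_bar:
  assumes "k \<in> {1..2*r}" "q \<noteq> 0"
  shows "eps r q k * eps r q (bar r k) = - 1"
proof -
  have *: "(- q) ^ m * (- inverse q) ^ m = 1" for m
    using assms(2) by (simp flip: power_mult_distrib)
  show ?thesis
  proof (cases "k \<le> r")
    case True
    then have "\<not> bar r k \<le> r" "bar r (bar r k) = k" using assms(1) by (auto simp: bar_def)
    then show ?thesis using True *[of "r + 1 - k"] by (simp add: eps_def)
  next
    case False
    then have "bar r k \<le> r" using assms(1) by (auto simp: bar_def)
    then show ?thesis using False *[of "r + 1 - bar r k"] by (simp add: eps_def mult.commute)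
  qed
qed

lemma eps_Suc:
  assumes "i \<ge> 1" "i < r" "q \<noteq> 0"
  shows "eps r q i = - q * eps r q (i + 1)"
proof -
  have "r + 1 - i = Suc (r + 1 - (i + 1))" using assms by simp
  then show ?thesis using assms by (simp only: eps_def power_Suc) simp
qed

text \<open>With e = eps_i, the relations eps_i = - q eps_(i+1) and eps_k eps_(bar k) = -1 express
  the four values of \<open>eps\<close> involved through e and its inverse. What remains are
  polynomial identities in q, p, e, e', B, X modulo p q = 1 and e e' = 1, with B and X free.\<close>

lemma crossing_arrow:
  assumes i: "i \<ge> 1" "i < r" and q: "q \<noteq> 0"
  shows "crossing r (R_A q B) B (R_C r q B X) q 1 (i + 1) (bar r i)"
    and "crossing r (R_A q B) B (R_C r q B X) q 1 (bar r i) (i + 1)"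
proof -
  define x where "x = i + 1"
  define y where "y = bar r i"
  define u where "u = bar r x"
  have bars: "bar r x = u" "bar r y = i" using i by (auto simp: u_def x_def y_def bar_def)
  have ord: "i < x" "x < u" "u < y" and S: "x + u = 2 * r + 1" "i + y = 2 * r + 1" and nx: "x = i + 1" "y = u + 1"
    using i by (auto simp: u_def x_def y_def bar_def)
  define p where "p = inverse q"
  have pq: "p * q = 1" using q by (simp add: p_def)
  define e where "e = eps r q i"
  define e' where "e' = inverse e"
  have e0: "e \<noteq> 0" using q by (simp add: e_def)
  then have ee: "e * e' = 1" by (simp add: e'_def)
  have ev: "eps r q i = e" "eps r q x = - p * e" "eps r q y = - e'" "eps r q u = q * e'"
  proof -
    show "eps r q i = e" by (simp add: e_def)
    show x': "eps r q x = - p * e" using eps_Suc[OF i q] q by (simp add: e_def x_def p_def)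
    have "e * eps r q y = -1" using eps_bar[of i r q] i q by (simp add: e_def y_def)
    then show "eps r q y = - e'" using ee by Groebner_Basis.algebra
    have "- p * e * eps r q u = -1" using eps_bar[of x r q] i q x' by (simp add: u_def) (simp add: x_def)
    then show "eps r q u = q * e'" using ee pq by Groebner_Basis.algebra
  qed
  have sums: "x + x < 2*r+1" "2*r+1 < x + y" "x + i < 2*r+1" "2*r+1 < y + y" "2*r+1 < y + u" "2*r+1 < u + u" "u + i < 2*r+1" "i + i < 2*r+1"
     "2*r+1 < y + x" "i + x < 2*r+1" "2*r+1 < u + y" "i + u < 2*r+1"
    using ord S nx by linarith+
  have C: "R_C r q B X x x = p * e * p * e * X" "R_C r q B X x i = - p * e * e * X" "R_C r q B X i x = - p * e * e * X"
    "R_C r q B X i i = e * e * X" "R_C r q B X i u = e * q * e' * X" "R_C r q B X u i = e * q * e' * X"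
    "R_C r q B X x y = p * e * e' * (X + (q - p) * B)" "R_C r q B X y x = p * e * e' * (X + (q - p) * B)"
    "R_C r q B X y u = - q * e' * e' * (X + (q - p) * B)" "R_C r q B X u y = - q * e' * e' * (X + (q - p) * B)"
    "R_C r q B X u u = q * e' * q * e' * (X + (q - p) * B)" "R_C r q B X y y = e' * e' * (X + (q - p) * B)"
    "R_C r q B X x u = - X - (1 - p) * B" "R_C r q B X u x = - X - (1 - p) * B"
    "R_C r q B X i y = - X - (1 - p) * B" "R_C r q B X y i = - X - (1 - p) * B"
    using sums S unfolding R_C_def ev p_def[symmetric] by (simp_all add: add.commute[of y i] add.commute[of u x])
  have A: "R_A q B x x = 1" "R_A q B y y = 1" "R_A q B u u = 1" "R_A q B i i = 1"
    "R_A q B i x = 1 - q * B" "R_A q B i u = 1 - q * B" "R_A q B i y = 1 - q * B"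
    "R_A q B x u = 1 - q * B" "R_A q B x y = 1 - q * B" "R_A q B u y = 1 - q * B"
    "R_A q B x i = 1 - p * B" "R_A q B u i = 1 - p * B" "R_A q B y i = 1 - p * B"
    "R_A q B u x = 1 - p * B" "R_A q B y x = 1 - p * B" "R_A q B y u = 1 - p * B"
    using ord by (simp_all add: R_A_def p_def)
  \<comment> \<open>Since x = i + 1 and y = u + 1, neighbours compare alike with every other index
    d, and so do their sums with 2r + 1. Hence the entries of \<open>R_A\<close> agree, and those of
    \<open>R_C\<close> differ by the ratio - q of neighbouring values of \<open>eps\<close>.\<close>
  have out: "R_A q B x d = R_A q B i d" "R_A q B d x = R_A q B d i" "R_A q B y d = R_A q B u d" "R_A q B d y = R_A q B d u"
      "R_C r q B X i d = - q * R_C r q B X x d" "R_C r q B X u d = - q * R_C r q B X y d"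
    if d: "d \<notin> {x, y, u, i}" for d
  proof -
    have n: "d \<noteq> x" "d \<noteq> y" "d \<noteq> u" "d \<noteq> i" using d by auto
    have c: "d < x \<longleftrightarrow> d < i" "x < d \<longleftrightarrow> i < d" "d < y \<longleftrightarrow> d < u" "y < d \<longleftrightarrow> u < d"
      unfolding nx using n unfolding nx by linarith+
    then show "R_A q B x d = R_A q B i d" "R_A q B d x = R_A q B d i" "R_A q B y d = R_A q B u d" "R_A q B d y = R_A q B d u"
      by (simp_all add: R_A_def)
    have m: "x + d < 2*r+1 \<longleftrightarrow> d < u" "2*r+1 < x + d \<longleftrightarrow> u < d" "u + d < 2*r+1 \<longleftrightarrow> d < x" "2*r+1 < u + d \<longleftrightarrow> x < d"
      "i + d < 2*r+1 \<longleftrightarrow> d < y" "2*r+1 < i + d \<longleftrightarrow> y < d" "y + d < 2*r+1 \<longleftrightarrow> d < i" "2*r+1 < y + d \<longleftrightarrow> i < d"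
      using S by linarith+
    have lg: "d < u \<or> u < d" "d < i \<or> i < d" using n by linarith+
    have "q * p = 1" using pq by (simp add: mult.commute)
    then have k: "q * (p * t) = t" for t by (simp flip: mult.assoc)
    show "R_C r q B X i d = - q * R_C r q B X x d" "R_C r q B X u d = - q * R_C r q B X y d"
      unfolding R_C_def m c ev using lg by (auto simp: k mult.assoc)
  qed
  have 1: "crossing r (R_A q B) B (R_C r q B X) q 1 x y"
    unfolding crossing_def bars A C mult_1
    apply (intro conjI ballI refl)
    subgoal using out by auto
    subgoal using out by auto
    subgoal using out by auto
    subgoal for d using out[of d] by (simp add: R_C_sym[of r q B X d])
    using pq ee by ((simp; fail) | (simp add: algebra_simps; fail) | Groebner_Basis.algebra)+
  have 2: "crossing r (R_A q B) B (R_C r q B X) q 1 y x"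
    unfolding crossing_def bars A C mult_1
    apply (intro conjI ballI refl)
    subgoal using out by auto
    subgoal using out by auto
    subgoal using out by auto
    subgoal for d using out[of d] by (simp add: R_C_sym[of r q B X d])
    using pq ee by ((simp; fail) | (simp add: algebra_simps; fail) | Groebner_Basis.algebra)+
  show "crossing r (R_A q B) B (R_C r q B X) q 1 (i + 1) (bar r i)"
    "crossing r (R_A q B) B (R_C r q B X) q 1 (bar r i) (i + 1)"
    using 1 2 by (simp_all only: x_def y_def)
qed

text \<open>The indices 1, 2 lie below, and 2r - 1, 2r above, all others. So F_0 exchanges the two
  off-diagonal values of \<open>R_A\<close> and the two outer cases of \<open>R_C\<close>, and the
  hypotheses on z are exactly the resulting conditions.\<close>

lemma crossing_affine:
  assumes r: "r \<ge> 2" and q: "q \<noteq> 0"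
    and z: "z * (1 - inverse q * B) = 1 - q * B" "z * (X + (q - inverse q) * B) = - (q ^ (2 * r)) * X"
  shows "crossing r (R_A q B) B (R_C r q B X) q z 1 2"
    and "crossing r (R_A q B) B (R_C r q B X) q z 2 1"
proof -
  define x y u v :: nat where "x = 1" and "y = 2" and "u = 2 * r" and "v = 2 * r - 1"
  have bars: "bar r x = u" "bar r y = v" using r by (auto simp: u_def v_def x_def y_def bar_def)
  have ord: "x < y" "y < v" "v < u" "x < v" "x < u" "y < u" and S: "x + u = 2 * r + 1" "y + v = 2 * r + 1"
    using r by (auto simp: u_def v_def x_def y_def)
  define p where "p = inverse q"
  have pq: "p * q = 1" using q by (simp add: p_def)
  define e where "e = eps r q x"
  define e' where "e' = inverse e"
  have e0: "e \<noteq> 0" using q by (simp add: e_def)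
  then have ee: "e * e' = 1" by (simp add: e'_def)
  \<comment> \<open>This turns q^(2r) in the second condition on z into e e, so that it becomes a
    polynomial relation in the variables used below.\<close>
  have e2: "e * e = q ^ (2 * r)"
    using r by (simp add: e_def x_def eps_def mult_2 power_add flip: power_mult_distrib)
  note z = z[folded p_def e2]
  have ev: "eps r q x = e" "eps r q y = - p * e" "eps r q u = - e'" "eps r q v = q * e'"
  proof -
    show "eps r q x = e" by (simp add: e_def)
    show y': "eps r q y = - p * e"
      using eps_Suc[of 1 r q] r q by (simp add: e_def x_def y_def p_def numeral_2_eq_2)
    have "e * eps r q u = -1" using eps_bar[of x r q] r q bars by (simp add: e_def x_def)
    then show "eps r q u = - e'" using ee by Groebner_Basis.algebra
    have "- p * e * eps r q v = -1" using eps_bar[of y r q] r q y' bars by (simp add: y_def)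
    then show "eps r q v = q * e'" using ee pq by Groebner_Basis.algebra
  qed
  have sums: "x + x < 2*r+1" "x + y < 2*r+1" "x + v < 2*r+1" "2*r+1 < y + u" "y + y < 2*r+1"
      "2*r+1 < v + v" "2*r+1 < v + u" "2*r+1 < u + u"
     "y + x < 2*r+1" "v + x < 2*r+1" "2*r+1 < u + y" "2*r+1 < u + v"
    using ord S by linarith+
  have C: "R_C r q B X x x = e * e * X" "R_C r q B X x y = - p * e * e * X" "R_C r q B X y x = - p * e * e * X"
    "R_C r q B X y y = p * e * p * e * X"
    "R_C r q B X x v = e * q * e' * X" "R_C r q B X v x = e * q * e' * X"
    "R_C r q B X y u = p * e * e' * (X + (q - p) * B)" "R_C r q B X u y = p * e * e' * (X + (q - p) * B)"
    "R_C r q B X u v = - q * e' * e' * (X + (q - p) * B)" "R_C r q B X v u = - q * e' * e' * (X + (q - p) * B)"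
    "R_C r q B X v v = q * e' * q * e' * (X + (q - p) * B)" "R_C r q B X u u = e' * e' * (X + (q - p) * B)"
    "R_C r q B X x u = - X - (1 - p) * B" "R_C r q B X u x = - X - (1 - p) * B"
    "R_C r q B X v y = - X - (1 - p) * B" "R_C r q B X y v = - X - (1 - p) * B"
    using sums S unfolding R_C_def ev p_def[symmetric] by (simp_all add: add.commute[of v y] add.commute[of u x])
  have A: "R_A q B x x = 1" "R_A q B y y = 1" "R_A q B u u = 1" "R_A q B v v = 1"
    "R_A q B x y = 1 - q * B" "R_A q B x v = 1 - q * B" "R_A q B x u = 1 - q * B"
    "R_A q B y v = 1 - q * B" "R_A q B y u = 1 - q * B" "R_A q B v u = 1 - q * B"
    "R_A q B y x = 1 - p * B" "R_A q B v x = 1 - p * B" "R_A q B u x = 1 - p * B"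
    "R_A q B v y = 1 - p * B" "R_A q B u y = 1 - p * B" "R_A q B u v = 1 - p * B"
    using ord by (simp_all add: R_A_def p_def)
  have out: "R_A q B x d = z * R_A q B v d" "z * R_A q B d x = R_A q B d v"
      "R_A q B y d = z * R_A q B u d" "z * R_A q B d y = R_A q B d u"
      "z * R_C r q B X v d = - q * R_C r q B X x d" "z * R_C r q B X u d = - q * R_C r q B X y d"
    if d: "d \<in> {1..2*r}" "d \<notin> {x, y, u, v}" for d
  proof -
    have n: "y < d" "d < v" "x < d" "d < u" using d by (auto simp: x_def y_def u_def v_def)
    show "R_A q B x d = z * R_A q B v d" "z * R_A q B d x = R_A q B d v"
      "R_A q B y d = z * R_A q B u d" "z * R_A q B d y = R_A q B d u"
      using n z(1) by (simp_all add: R_A_def p_def)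
    have m: "x + d < 2*r+1" "2*r+1 < v + d" "y + d < 2*r+1" "2*r+1 < u + d"
      using S n by linarith+
    have "R_C r q B X v d = q * e' * eps r q d * (X + (q - p) * B)" "R_C r q B X x d = e * eps r q d * X"
      "R_C r q B X u d = - e' * eps r q d * (X + (q - p) * B)" "R_C r q B X y d = - p * e * eps r q d * X"
      using m unfolding R_C_def ev p_def[symmetric] by simp_all
    then show "z * R_C r q B X v d = - q * R_C r q B X x d" "z * R_C r q B X u d = - q * R_C r q B X y d"
      using z(2) ee pq by Groebner_Basis.algebra+
  qed
  have "crossing r (R_A q B) B (R_C r q B X) q z x y"
    unfolding crossing_def bars A C
    apply (intro conjI ballI refl)
    subgoal using out by auto
    subgoal using out by auto
    subgoal using out by auto
    subgoal for d using out[of d] by (simp add: R_C_sym[of r q B X d])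
    using pq ee z by ((simp; fail) | (simp add: algebra_simps; fail) | Groebner_Basis.algebra)+
  moreover have "crossing r (R_A q B) B (R_C r q B X) q z y x"
    unfolding crossing_def bars A C
    apply (intro conjI ballI refl)
    subgoal using out by auto
    subgoal using out by auto
    subgoal using out by auto
    subgoal for d using out[of d] by (simp add: R_C_sym[of r q B X d])
    using pq ee z by ((simp; fail) | (simp add: algebra_simps; fail) | Groebner_Basis.algebra)+
  ultimately show "crossing r (R_A q B) B (R_C r q B X) q z 1 2"
    "crossing r (R_A q B) B (R_C r q B X) q z 2 1"
    by (simp_all only: x_def y_def)
qed

text \<open>The squares of q in \<open>crossing_end\<close> come from q_r = q^2 and are matched by
  the jump eps_r / eps_(r+1) = - q^2 in the middle of the sequence \<open>eps\<close>.\<close>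

lemma crossing_end_arrow:
  assumes r: "r \<ge> 1" and q: "q \<noteq> 0"
  shows "crossing_end r (R_A q B) B (R_C r q B X) q (r + 1)"
proof -
  define x where "x = r + 1"
  have bars: "bar r x = r" by (simp add: x_def bar_def)
  define p where "p = inverse q"
  have pq: "p * q = 1" using q by (simp add: p_def)
  have ev: "eps r q r = - q" "eps r q x = p" using r by (auto simp: eps_def x_def bar_def p_def)
  have C: "R_C r q B X x x = p * p * (X + (q - p) * B)" "R_C r q B X r r = q * q * X"
    "R_C r q B X x r = - X - (1 - p) * B" "R_C r q B X r x = - X - (1 - p) * B"
    unfolding R_C_def ev p_def[symmetric] by (simp_all add: x_def)
  have A: "R_A q B x x = 1" "R_A q B r r = 1" "R_A q B x r = 1 - p * B" "R_A q B r x = 1 - q * B"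
    by (simp_all add: R_A_def x_def p_def)
  have out: "R_A q B x d = R_A q B r d" "R_A q B d x = R_A q B d r"
      "R_C r q B X r d = - q\<^sup>2 * R_C r q B X x d"
    if d: "d \<noteq> x" "d \<noteq> r" for d
  proof -
    have c: "d < x \<longleftrightarrow> d < r" "x < d \<longleftrightarrow> r < d" using d by (auto simp: x_def)
    then show "R_A q B x d = R_A q B r d" "R_A q B d x = R_A q B d r"
      by (simp_all add: R_A_def)
    have m: "r + d < 2*r+1 \<longleftrightarrow> d < r" "2*r+1 < r + d \<longleftrightarrow> r < d" "x + d < 2*r+1 \<longleftrightarrow> d < r" "2*r+1 < x + d \<longleftrightarrow> r < d"
      using d by (auto simp: x_def)
    have lg: "d < r \<or> r < d" using d by linarith
    have "q * p = 1" using pq by (simp add: mult.commute)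
    then have k: "q * (p * t) = t" for t by (simp flip: mult.assoc)
    show "R_C r q B X r d = - q\<^sup>2 * R_C r q B X x d"
      unfolding R_C_def m ev using lg by (auto simp: k mult.assoc power2_eq_square)
  qed
  have "crossing_end r (R_A q B) B (R_C r q B X) q x"
    unfolding crossing_end_def bars A C power2_eq_square
    apply (intro conjI ballI refl)
    subgoal using out by auto
    subgoal using out by auto
    subgoal using out by (auto simp: power2_eq_square)
    subgoal for d using out[of d] by (simp add: R_C_sym[of r q B X d] power2_eq_square)
    using pq by ((simp; fail) | (simp add: algebra_simps; fail) | Groebner_Basis.algebra)+
  then show ?thesis by (simp only: x_def)
qed

section \<open>The intertwining property\<close>

text \<open>Entry in row (c, d) and column (a, b) of the matrix behind \<open>R_op\<close>. The ring
  is left general because both complex numbers and elements of C(z) occur as coefficients.\<close>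

definition R_coef :: "nat \<Rightarrow> (nat \<Rightarrow> nat \<Rightarrow> 'a) \<Rightarrow> 'a \<Rightarrow> (nat \<Rightarrow> nat \<Rightarrow> 'a) \<Rightarrow>
    nat \<Rightarrow> nat \<Rightarrow> nat \<Rightarrow> nat \<Rightarrow> 'a::comm_ring_1" where
  "R_coef r A B C c d a b = (if a = c \<and> b = d then A c d else 0)
     + (if a = d \<and> b = c \<and> c \<noteq> d then B else 0)
     + (if d = bar r c \<and> b = bar r a then C c a else 0)"

lemma sum_sum_single:
  fixes f :: "nat \<Rightarrow> nat \<Rightarrow> 'a::comm_ring_1"
  assumes "c \<in> I" "d \<in> I" "finite I"
  shows "(\<Sum>a\<in>I. \<Sum>b\<in>I. (if a = c \<and> b = d then t else 0) * f a b) = t * f c d"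
proof -
  have "(\<Sum>b\<in>I. (if a = c \<and> b = d then t else 0) * f a b) = (if a = c then t * f c d else 0)" for a
    using assms by (cases "a = c") (simp_all add: if_distrib[of "\<lambda>x. x * _"] cong: if_cong)
  then show ?thesis using assms by simp
qed

lemma coords_R_coef:
  assumes v: "v \<in> carrier_vec ((2*r)\<^sup>2)" and c: "c \<in> {1..2*r}" and d: "d \<in> {1..2*r}"
  shows "coords (2*r) (tens_mat (2*r) (R_coef r A B C) *\<^sub>v v) c d = R_op r A B C (coords (2*r) v) c d"
proof -
  let ?I = "{1..2*r}" and ?f = "coords (2*r) v"
  have 2: "(\<Sum>a\<in>?I. \<Sum>b\<in>?I. (if a = d \<and> b = c \<and> c \<noteq> d then B else 0) * ?f a b) = (if c \<noteq> d then B * ?f d c else 0)"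
    using sum_sum_single[OF d c, of B ?f] by (cases "c = d") auto
  have "(\<Sum>b\<in>?I. (if d = bar r c \<and> b = bar r a then C c a else 0) * ?f a b)
      = (if d = bar r c then C c a * ?f a (bar r a) else 0)" if "a \<in> ?I" for a
    using bar_in[OF that]
    by (cases "d = bar r c") (simp_all add: if_distrib[of "\<lambda>x. x * _"] del: One_nat_def cong: if_cong)
  then have 3: "(\<Sum>a\<in>?I. \<Sum>b\<in>?I. (if d = bar r c \<and> b = bar r a then C c a else 0) * ?f a b)
      = (if d = bar r c then \<Sum>a\<in>?I. C c a * ?f a (bar r a) else 0)"
    by simp
  show ?thesis
    unfolding coords_tens_mat[OF v c d] R_coef_def distrib_right sum.distrib R_op_def
      sum_sum_single[OF c d finite_atLeastAtMost] 2 3 ..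
qed

lemma diag_op_carrier [simp]: "diag_op n f \<in> carrier_mat n n"
  by (simp add: diag_op_def)

lemma diag_op_index: "c \<in> {1..n} \<Longrightarrow> a \<in> {1..n} \<Longrightarrow> diag_op n f $$ (c - 1, a - 1) = (if a = c then f (c - 1) else 0)"
  by (auto simp: diag_op_def)

lemma coords_coproduct:
  fixes F G :: "complex mat"
  assumes carr: "F \<in> carrier_mat n n" "G \<in> carrier_mat n n"
    and F: "\<And>c a. c \<in> {1..n} \<Longrightarrow> a \<in> {1..n} \<Longrightarrow> F $$ (c - 1, a - 1) = (if c \<in> S \<and> a = p c then \<alpha> else 0)"
    and G: "\<And>c a. c \<in> {1..n} \<Longrightarrow> a \<in> {1..n} \<Longrightarrow> G $$ (c - 1, a - 1) = (if c \<in> S \<and> a = p c then \<beta> else 0)"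
    and S: "\<And>c. c \<in> S \<Longrightarrow> p c \<in> {1..n}"
    and v: "v \<in> carrier_vec (n\<^sup>2)" and c: "c \<in> {1..n}" and d: "d \<in> {1..n}"
  shows "coords n ((F \<otimes>\<^sub>k diag_op n (\<lambda>k. \<kappa> (k + 1)) + diag_op n (\<lambda>k. inverse (\<kappa> (k + 1))) \<otimes>\<^sub>k G) *\<^sub>v v) c d
     = L_op S p \<kappa> \<alpha> \<beta> (coords n v) c d"
proof -
  let ?D = "diag_op n (\<lambda>k. \<kappa> (k + 1))" and ?D' = "diag_op n (\<lambda>k. inverse (\<kappa> (k + 1)))"
  let ?M = "F \<otimes>\<^sub>k ?D + ?D' \<otimes>\<^sub>k G" and ?f = "coords n v" and ?I = "{1..n}"
  have M: "?M \<in> carrier_mat (n\<^sup>2) (n\<^sup>2)" by (intro add_carrier_mat kron_carrier carr diag_op_carrier)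
  have entry: "?M $$ ((c - 1) * n + (d - 1), (a - 1) * n + (b - 1))
      = (if c \<in> S then (if a = p c \<and> b = d then \<alpha> * \<kappa> d else 0) else 0)
      + (if d \<in> S then (if a = c \<and> b = p d then \<beta> * inverse (\<kappa> c) else 0) else 0)"
    if ab: "a \<in> ?I" "b \<in> ?I" for a b
  proof -
    have "?M $$ ((c - 1) * n + (d - 1), (a - 1) * n + (b - 1)) = F $$ (c - 1, a - 1) * ?D $$ (d - 1, b - 1)
       + ?D' $$ (c - 1, a - 1) * G $$ (d - 1, b - 1)"
      unfolding kron_index[OF carr(1) diag_op_carrier c d ab, symmetric] kron_index[OF diag_op_carrier carr(2) c d ab, symmetric]
      by (rule index_add_mat(1)) (simp_all only: carrier_matD[OF kron_carrier[OF diag_op_carrier carr(2)]]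
          tens_index(1)[OF c d] tens_index(1)[OF ab])
    then show ?thesis
      unfolding diag_op_index[OF c ab(1)] diag_op_index[OF d ab(2)] F[OF c ab(1)] G[OF d ab(2)] using c d by auto
  qed
  have "coords n (?M *\<^sub>v v) c d = (\<Sum>a\<in>?I. \<Sum>b\<in>?I. (if c \<in> S then (if a = p c \<and> b = d then \<alpha> * \<kappa> d else 0) else 0) * ?f a b)
      + (\<Sum>a\<in>?I. \<Sum>b\<in>?I. (if d \<in> S then (if a = c \<and> b = p d then \<beta> * inverse (\<kappa> c) else 0) else 0) * ?f a b)"
    unfolding coords_mult_mat_vec[OF M v c d] sum.distrib[symmetric] distrib_right[symmetric]
    by (intro sum.cong refl) (simp only: entry)
  also have "\<dots> = L_op S p \<kappa> \<alpha> \<beta> ?f c d"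
    using sum_sum_single[OF S d finite_atLeastAtMost, of c "\<alpha> * \<kappa> d" ?f]
      sum_sum_single[OF c S finite_atLeastAtMost, of d "\<beta> * inverse (\<kappa> c)" ?f]
    unfolding L_op_def by (cases "c \<in> S"; cases "d \<in> S") simp_all
  finally show ?thesis .
qed

section \<open>The generators on the tensor product in coordinates\<close>

definition half_weight :: "nat \<Rightarrow> complex \<Rightarrow> nat \<Rightarrow> nat \<Rightarrow> complex" where
  "half_weight r qh i c = qi r qh i powi L1wt r i c"

lemma mdim_L1 [simp]: "mdim (L1 r a) = 2 * r"
  by (simp add: L1_def)

lemma mdim_utensor [simp]: "mdim (utensor r qh M N) = mdim M * mdim N"
  by (simp add: utensor_def)

lemma mKhalf_L1: "mKhalf r qh (L1 r a) i = diag_op (2*r) (\<lambda>k. half_weight r qh i (k + 1))"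
  by (simp add: mKhalf_def L1_def half_weight_def)

lemma mKhalfinv_L1: "mKhalfinv r qh (L1 r a) i = diag_op (2*r) (\<lambda>k. inverse (half_weight r qh i (k + 1)))"
  by (simp add: mKhalfinv_def L1_def half_weight_def power_int_minus)

lemma L1F_carrier [simp]: "L1F r i \<in> carrier_mat (2*r) (2*r)" "L1E0 r a \<in> carrier_mat (2*r) (2*r)"
  by (auto simp: L1F_def L1E0_def mat_unit_def)

lemma L1_carrier [simp]: "mE (L1 r a) i \<in> carrier_mat (2*r) (2*r)" "mF (L1 r a) i \<in> carrier_mat (2*r) (2*r)"
  by (auto simp: L1_def)

lemma mE_mF_carrier [simp]:
  "mE (utensor r qh (L1 r a) (L1 r b)) i \<in> carrier_mat ((2*r)\<^sup>2) ((2*r)\<^sup>2)"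
  "mF (utensor r qh (L1 r a) (L1 r b)) i \<in> carrier_mat ((2*r)\<^sup>2) ((2*r)\<^sup>2)"
  by (simp only: utensor_def umod.select_convs mKhalf_L1 mKhalfinv_L1,
      intro add_carrier_mat kron_carrier L1_carrier diag_op_carrier)+

lemma mat_unit_index:
  "c \<in> {1..n} \<Longrightarrow> a \<in> {1..n} \<Longrightarrow> mat_unit n i j $$ (c - 1, a - 1) = (if c = i \<and> a = j then 1 else 0)"
  by (auto simp: mat_unit_def)

text \<open>Because bar i = bar (i + 1) + 1, both arrows of F_i raise the index by one. The
  predecessor map therefore describes every F_i, including i = r, where the two targets
  coincide.\<close>

lemma L1F_index:
  assumes "1 \<le> i" "i \<le> r" "c \<in> {1..2*r}" "a \<in> {1..2*r}"
  shows "L1F r i $$ (c - 1, a - 1) = (if c \<in> {i + 1, bar r i} \<and> a = c - 1 then 1 else 0)"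
proof (cases "i = r")
  case True
  then have "L1F r i = mat_unit (2*r) (r + 1) r" "bar r i = r + 1" by (simp_all add: L1F_def bar_def)
  then show ?thesis using assms True by (auto simp: mat_unit_index simp del: One_nat_def)
next
  case False
  then have "L1F r i $$ (c - 1, a - 1) = mat_unit (2*r) (i + 1) i $$ (c - 1, a - 1)
      + mat_unit (2*r) (bar r i) (bar r (i + 1)) $$ (c - 1, a - 1)"
    unfolding L1F_def if_not_P[OF False] using assms by (intro index_add_mat(1)) (auto simp: mat_unit_def)
  moreover have "bar r (i + 1) = bar r i - 1" "i + 1 \<noteq> bar r i" "bar r i \<noteq> 0" using assms False by (auto simp: bar_def)
  ultimately show ?thesis using assms unfolding mat_unit_index[OF assms(3,4)] by auto
qed

lemma coords_mF:
  assumes "1 \<le> i" "i \<le> r" "v \<in> carrier_vec ((2*r)\<^sup>2)" "c \<in> {1..2*r}" "d \<in> {1..2*r}"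
  shows "coords (2*r) (mF (utensor r qh (L1 r a) (L1 r b)) i *\<^sub>v v) c d
    = L_op {i + 1, bar r i} (\<lambda>k. k - 1) (half_weight r qh i) 1 1 (coords (2*r) v) c d"
proof -
  have eq: "mF (utensor r qh (L1 r a) (L1 r b)) i = L1F r i \<otimes>\<^sub>k diag_op (2*r) (\<lambda>k. half_weight r qh i (k + 1))
      + diag_op (2*r) (\<lambda>k. inverse (half_weight r qh i (k + 1))) \<otimes>\<^sub>k L1F r i"
    using assms(1) by (simp add: utensor_def mKhalf_L1 mKhalfinv_L1) (simp add: L1_def)
  have S: "k - 1 \<in> {1..2*r}" if "k \<in> {i + 1, bar r i}" for k
    using that assms(1,2) by (auto simp: bar_def)
  show ?thesis unfolding eq
    by (rule coords_coproduct[OF L1F_carrier(1) L1F_carrier(1) L1F_index[OF assms(1,2)] L1F_index[OF assms(1,2)] S assms(3-5)])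
qed

lemma coords_mE:
  assumes "1 \<le> i" "i \<le> r" "v \<in> carrier_vec ((2*r)\<^sup>2)" "c \<in> {1..2*r}" "d \<in> {1..2*r}"
  shows "coords (2*r) (mE (utensor r qh (L1 r a) (L1 r b)) i *\<^sub>v v) c d
    = L_op {i, bar r (i + 1)} Suc (half_weight r qh i) 1 1 (coords (2*r) v) c d"
proof -
  have eq: "mE (utensor r qh (L1 r a) (L1 r b)) i = transpose_mat (L1F r i) \<otimes>\<^sub>k diag_op (2*r) (\<lambda>k. half_weight r qh i (k + 1))
      + diag_op (2*r) (\<lambda>k. inverse (half_weight r qh i (k + 1))) \<otimes>\<^sub>k transpose_mat (L1F r i)"
    using assms(1) by (simp add: utensor_def mKhalf_L1 mKhalfinv_L1) (simp add: L1_def)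
  have S: "Suc k \<in> {1..2*r}" if "k \<in> {i, bar r (i + 1)}" for k
    using that assms(1,2) by (auto simp: bar_def)
  have bS: "bar r i = Suc (bar r (i + 1))" using assms(1,2) by (simp add: bar_def)
  have ix: "transpose_mat (L1F r i) $$ (c - 1, a - 1) = (if c \<in> {i, bar r (i + 1)} \<and> a = Suc c then 1 else 0)"
    if "c \<in> {1..2*r}" "a \<in> {1..2*r}" for c a
  proof -
    have "transpose_mat (L1F r i) $$ (c - 1, a - 1) = L1F r i $$ (a - 1, c - 1)"
      using that carrier_matD[OF L1F_carrier(1)[of r i]] by (intro index_transpose_mat(1)) auto
    also have "\<dots> = (if a \<in> {i + 1, bar r i} \<and> c = a - 1 then 1 else 0)" by (rule L1F_index[OF assms(1,2) that(2,1)])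
    also have "c = a - 1 \<longleftrightarrow> a = Suc c" using that by auto
    also have "a \<in> {i + 1, bar r i} \<and> a = Suc c \<longleftrightarrow> c \<in> {i, bar r (i + 1)} \<and> a = Suc c"
      using bS by auto
    finally show ?thesis .
  qed
  show ?thesis unfolding eq
    by (rule coords_coproduct[OF _ _ ix ix S assms(3-5)]) simp_all
qed

text \<open>The transpose of E_0(a) has arrows 2r - 1 to 1 and 2r to 2 with coefficient a; the
  factor 1/a^2 turns it into 1/a.\<close>

lemma coords_mF0:
  assumes r: "r \<ge> 2" and ab: "a \<noteq> 0" "b \<noteq> 0" and v: "v \<in> carrier_vec ((2*r)\<^sup>2)" "c \<in> {1..2*r}" "d \<in> {1..2*r}"
  shows "coords (2*r) (mF (utensor r qh (L1 r a) (L1 r b)) 0 *\<^sub>v v) c d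
    = L_op {1, 2} (\<lambda>k. k + 2 * r - 2) (half_weight r qh 0) (1 / a) (1 / b) (coords (2*r) v) c d"
proof -
  let ?F = "\<lambda>a. transpose_mat (inverse (a\<^sup>2) \<cdot>\<^sub>m L1E0 r a)"
  have eq: "mF (utensor r qh (L1 r a) (L1 r b)) 0 = ?F a \<otimes>\<^sub>k diag_op (2*r) (\<lambda>k. half_weight r qh 0 (k + 1))
      + diag_op (2*r) (\<lambda>k. inverse (half_weight r qh 0 (k + 1))) \<otimes>\<^sub>k ?F b"
    by (simp add: utensor_def mKhalf_L1 mKhalfinv_L1) (simp add: L1_def)
  have S: "k + 2 * r - 2 \<in> {1..2*r}" if "k \<in> {1, 2}" for k
    using that r by auto
  have ix: "?F a $$ (c - 1, k - 1) = (if c \<in> {1, 2} \<and> k = c + 2 * r - 2 then 1 / a else 0)"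
    if k: "c \<in> {1..2*r}" "k \<in> {1..2*r}" and "a \<noteq> 0" for c k a
  proof -
    have lt: "c - 1 < 2 * r" "k - 1 < 2 * r" using k by auto
    have "?F a $$ (c - 1, k - 1) = inverse (a\<^sup>2) * (a * (mat_unit (2*r) (2*r-1) 1 $$ (k - 1, c - 1) + mat_unit (2*r) (2*r) 2 $$ (k - 1, c - 1)))"
      using lt by (simp add: L1E0_def mat_unit_def)
    also have "\<dots> = (if c \<in> {1, 2} \<and> k = c + 2 * r - 2 then 1 / a else 0)"
      unfolding mat_unit_index[OF k(2,1)] using r that(3) by (auto simp: power2_eq_square field_simps)
    finally show ?thesis .
  qed
  show ?thesis unfolding eq
    by (rule coords_coproduct[OF _ _ ix ix S v]) (use ab in simp_all)
qed

lemma qi_half: "qi r qh i = (if i = r then qh\<^sup>2 else qh)"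
  by (simp add: qi_def dsym_def)

lemma half_weight_arrow:
  assumes "1 \<le> i" "i < r"
  shows "c \<in> {i + 1, bar r i} \<Longrightarrow> half_weight r qh i c = inverse qh"
    and "c \<in> {bar r (i + 1), bar r (bar r i)} \<Longrightarrow> half_weight r qh i c = qh"
    and "c \<notin> {i + 1, bar r i, bar r (i + 1), bar r (bar r i)} \<Longrightarrow> half_weight r qh i c = 1"
proof -
  have b: "bar r (bar r i) = i" "bar r i > r" "bar r (i + 1) > r" "bar r i \<noteq> bar r (i + 1)"
    "bar r (bar r (i + 1)) = i + 1"
    using assms by (auto simp: bar_def)
  show "c \<in> {i + 1, bar r i} \<Longrightarrow> half_weight r qh i c = inverse qh"
    using assms b by (auto simp: half_weight_def qi_half L1wt_def power_int_minus)
  show "c \<in> {bar r (i + 1), bar r (bar r i)} \<Longrightarrow> half_weight r qh i c = qh"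
    using assms b by (auto simp: half_weight_def qi_half L1wt_def)
  assume c: "c \<notin> {i + 1, bar r i, bar r (i + 1), bar r (bar r i)}"
  have "bar r c \<noteq> j" if "c \<noteq> bar r j" "1 \<le> j" for j
    using that by (auto simp: bar_def)
  with c assms b have "bar r c \<noteq> i" "bar r c \<noteq> i + 1" by auto
  with c show "half_weight r qh i c = 1"
    using assms b by (auto simp: half_weight_def L1wt_def)
qed

lemma half_weight_end:
  assumes "1 \<le> r"
  shows "half_weight r qh r (r + 1) = inverse (qh\<^sup>2)" "half_weight r qh r (bar r (r + 1)) = qh\<^sup>2"
    and "c \<notin> {r + 1, bar r (r + 1)} \<Longrightarrow> half_weight r qh r c = 1"
proof -
  have b: "bar r (r + 1) = r" "bar r r = r + 1" by (simp_all add: bar_def)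
  show "half_weight r qh r (r + 1) = inverse (qh\<^sup>2)" "half_weight r qh r (bar r (r + 1)) = qh\<^sup>2"
    using assms b by (auto simp: half_weight_def qi_half L1wt_def power_int_minus)
  assume c: "c \<notin> {r + 1, bar r (r + 1)}"
  then have "bar r c \<noteq> r" "bar r c \<noteq> r + 1" if "c > r"
    using that b assms by (auto simp: bar_def)
  with c show "half_weight r qh r c = 1"
    using assms b by (auto simp: half_weight_def L1wt_def)
qed

lemma half_weight_affine:
  assumes "2 \<le> r"
  shows "c \<in> {1, 2} \<Longrightarrow> half_weight r qh 0 c = inverse qh"
    and "c \<in> {bar r 1, bar r 2} \<Longrightarrow> half_weight r qh 0 c = qh"
    and "c \<notin> {1, 2, bar r 1, bar r 2} \<Longrightarrow> half_weight r qh 0 c = 1"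
  using assms by (auto simp: half_weight_def qi_half L1wt_def power_int_minus bar_def)

lemma R_op_cong:
  assumes "\<And>c d. c \<in> {1..2*r} \<Longrightarrow> d \<in> {1..2*r} \<Longrightarrow> f c d = g c d" "c \<in> {1..2*r}" "d \<in> {1..2*r}"
  shows "R_op r A B C f c d = R_op r A B C g c d"
proof -
  have "(\<Sum>k\<in>{1..2*r}. C c k * f k (bar r k)) = (\<Sum>k\<in>{1..2*r}. C c k * g k (bar r k))"
    by (intro sum.cong refl) (use assms(1) bar_in in metis)
  then show ?thesis using assms by (simp add: R_op_def)
qed

lemma R_op_scale: "R_op r A B C (\<lambda>c d. t * f c d) c d = t * R_op r A B C f c d"
  by (auto simp: R_op_def sum_distrib_left algebra_simps intro!: sum.cong)

lemma L_op_scale: "L_op S p \<kappa> (t * \<alpha>) (t * \<beta>) f c d = t * L_op S p \<kappa> \<alpha> \<beta> f c d"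
  by (auto simp: L_op_def algebra_simps)

lemma L_op_cong:
  assumes "\<And>c d. c \<in> I \<Longrightarrow> d \<in> I \<Longrightarrow> f c d = g c d" "\<And>c. c \<in> S \<Longrightarrow> p c \<in> I" "c \<in> I" "d \<in> I"
  shows "L_op S p \<kappa> \<alpha> \<beta> f c d = L_op S p \<kappa> \<alpha> \<beta> g c d"
  using assms by (simp add: L_op_def)

section \<open>The R-matrix at a fixed spectral parameter commutes with all generators\<close>

definition R_mat :: "nat \<Rightarrow> complex \<Rightarrow> complex \<Rightarrow> complex \<Rightarrow> complex mat" where
  "R_mat r q B X = tens_mat (2*r) (R_coef r (R_A q B) B (R_C r q B X))"

lemma R_mat_carrier [simp]: "R_mat r q B X \<in> carrier_mat ((2*r)\<^sup>2) ((2*r)\<^sup>2)"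
  unfolding R_mat_def by (rule tens_mat_carrier)

lemma eq_mat_vecI:
  fixes A B :: "'a::comm_semiring_1 mat"
  assumes "\<And>v. v \<in> carrier_vec nc \<Longrightarrow> A *\<^sub>v v = B *\<^sub>v v" "A \<in> carrier_mat nr nc" "B \<in> carrier_mat nr nc"
  shows "A = B"
proof (rule eq_matI)
  fix i j assume "i < dim_row B" "j < dim_col B"
  then have ij: "i < nr" "j < nc" using assms(3) by auto
  have "M $$ (i, j) = (M *\<^sub>v unit_vec nc j) $ i" if "M \<in> carrier_mat nr nc" for M :: "'a mat"
    using that ij by simp
  then show "A $$ (i, j) = B $$ (i, j)" using assms by simp
qed (use assms in auto)

lemma R_mat_mF:
  assumes r: "r \<ge> 2" and q: "q \<noteq> 0" and qh: "qh\<^sup>2 = q" and i: "i \<in> {0..r}"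
    and ab: "a \<noteq> 0" "b \<noteq> 0" "z = a / b"
    and z: "z * (1 - inverse q * B) = 1 - q * B" "z * (X + (q - inverse q) * B) = - (q ^ (2 * r)) * X"
  shows "R_mat r q B X * mF (utensor r qh (L1 r a) (L1 r b)) i = mF (utensor r qh (L1 r b) (L1 r a)) i * R_mat r q B X"
proof (rule eq_mat_vecI)
  fix v :: "complex vec" assume v: "v \<in> carrier_vec ((2*r)\<^sup>2)"
  let ?F = "mF (utensor r qh (L1 r a) (L1 r b)) i" and ?F' = "mF (utensor r qh (L1 r b) (L1 r a)) i"
    and ?T = "R_mat r q B X" and ?f = "coords (2*r) v"
  let ?R = "R_op r (R_A q B) B (R_C r q B X)"
  have qh0: "qh \<noteq> 0" using q qh by auto
  have Fv: "?F *\<^sub>v v \<in> carrier_vec ((2*r)\<^sup>2)" by (rule mult_mat_vec_carrier[OF mE_mF_carrier(2) v])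
  have Tv: "?T *\<^sub>v v \<in> carrier_vec ((2*r)\<^sup>2)" by (rule mult_mat_vec_carrier[OF R_mat_carrier v])
  have "?T *\<^sub>v (?F *\<^sub>v v) = ?F' *\<^sub>v (?T *\<^sub>v v)"
  proof (rule coords_eqI)
    show "?T *\<^sub>v (?F *\<^sub>v v) \<in> carrier_vec ((2*r)\<^sup>2)" by (rule mult_mat_vec_carrier[OF R_mat_carrier Fv])
    show "?F' *\<^sub>v (?T *\<^sub>v v) \<in> carrier_vec ((2*r)\<^sup>2)" by (rule mult_mat_vec_carrier[OF mE_mF_carrier(2) Tv])
    fix c d assume c: "c \<in> {1..2*r}" and d: "d \<in> {1..2*r}"
    have T: "coords (2*r) (?T *\<^sub>v w) c d = ?R (coords (2*r) w) c d" if "w \<in> carrier_vec ((2*r)\<^sup>2)" "c \<in> {1..2*r}" "d \<in> {1..2*r}" for w c d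
      unfolding R_mat_def by (rule coords_R_coef[OF that])
    show "coords (2*r) (?T *\<^sub>v (?F *\<^sub>v v)) c d = coords (2*r) (?F' *\<^sub>v (?T *\<^sub>v v)) c d"
    proof (cases "i = 0")
      case i0: True
      let ?S = "{1, 2} :: nat set" and ?p = "\<lambda>k. k + 2 * r - 2" and ?k = "half_weight r qh 0"
      have pS: "?p k \<in> {1..2*r}" if "k \<in> ?S" for k using that r by auto
      \<comment> \<open>Pulling out 1/a leaves the parameters (1, z) on the source and (z, 1) on the
        target, the shape required by \<open>R_op_L_op_pair\<close> with \<zeta> = z.\<close>
      have s1: "L_op ?S ?p ?k (1 / a) (1 / b) f c d = 1 / a * L_op ?S ?p ?k 1 z f c d" for f c d
        using L_op_scale[of ?S ?p ?k "1 / a" 1 z f c d] ab by simp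
      have s2: "L_op ?S ?p ?k (1 / b) (1 / a) f c d = 1 / a * L_op ?S ?p ?k z 1 f c d" for f c d
        using L_op_scale[of ?S ?p ?k "1 / a" z 1 f c d] ab by simp
      have "coords (2*r) (?T *\<^sub>v (?F *\<^sub>v v)) c d = ?R (\<lambda>c d. 1 / a * L_op ?S ?p ?k 1 z ?f c d) c d"
        unfolding i0 T[OF Fv[unfolded i0] c d]
        by (rule R_op_cong[OF _ c d]) (simp only: coords_mF0[OF r ab(1,2) v] s1)
      also have "\<dots> = 1 / a * ?R (L_op ?S ?p ?k 1 z ?f) c d" by (rule R_op_scale)
      also have "?R (L_op ?S ?p ?k 1 z ?f) c d = L_op ?S ?p ?k z 1 (?R ?f) c d"
        by (rule R_op_L_op_pair[OF _ _ _ _ qh0 qh crossing_affine[OF r q z] _ _ half_weight_affine[OF r] c d])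
          (use r in \<open>auto simp: bar_def\<close>)
      also have "1 / a * \<dots> = L_op ?S ?p ?k (1 / b) (1 / a) (?R ?f) c d" by (simp only: s2)
      also have "\<dots> = L_op ?S ?p ?k (1 / b) (1 / a) (coords (2*r) (?T *\<^sub>v v)) c d"
        by (rule L_op_cong[OF _ pS c d]) (simp_all only: T[OF v])
      also have "\<dots> = coords (2*r) (?F' *\<^sub>v (?T *\<^sub>v v)) c d"
        unfolding i0 by (rule coords_mF0[OF r ab(2,1) Tv c d, symmetric])
      finally show ?thesis .
    next
      case False
      then have i1: "1 \<le> i" "i \<le> r" using i by auto
      let ?S = "{i + 1, bar r i}" and ?p = "\<lambda>k. k - 1 :: nat" and ?k = "half_weight r qh i"
      have pS: "?p k \<in> {1..2*r}" if "k \<in> ?S" for k using that i1 by (auto simp: bar_def)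
      have "coords (2*r) (?T *\<^sub>v (?F *\<^sub>v v)) c d = ?R (L_op ?S ?p ?k 1 1 ?f) c d"
        unfolding T[OF Fv c d] by (rule R_op_cong[OF _ c d]) (rule coords_mF[OF i1 v])
      also have "\<dots> = L_op ?S ?p ?k 1 1 (?R ?f) c d"
      proof (cases "i = r")
        case True
        have S: "{r + 1, bar r r} = {r + 1}" by (simp add: bar_def)
        have r1: "1 \<le> r" using r by simp
        show ?thesis unfolding True S
          by (rule R_op_L_op_end[OF _ q crossing_end_arrow[OF r1 q] _ half_weight_end[OF r1, where qh = qh, unfolded qh] c d])
            (use r in \<open>auto simp: bar_def\<close>)
      next
        case False
        then have ir: "i < r" using i1 by simp
        show ?thesis
          by (rule R_op_L_op_pair[OF _ _ _ _ qh0 qh crossing_arrow[OF i1(1) ir q] _ _ half_weight_arrow[OF i1(1) ir] c d])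
            (use i1 ir in \<open>auto simp: bar_def\<close>)
      qed
      also have "\<dots> = L_op ?S ?p ?k 1 1 (coords (2*r) (?T *\<^sub>v v)) c d"
        by (rule L_op_cong[OF _ pS c d]) (simp_all only: T[OF v])
      also have "\<dots> = coords (2*r) (?F' *\<^sub>v (?T *\<^sub>v v)) c d"
        by (rule coords_mF[OF i1 Tv c d, symmetric])
      finally show ?thesis .
    qed
  qed
  then show "(?T * ?F) *\<^sub>v v = (?F' * ?T) *\<^sub>v v"
    by (simp only: assoc_mult_mat_vec[OF R_mat_carrier mE_mF_carrier(2) v] assoc_mult_mat_vec[OF mE_mF_carrier(2) R_mat_carrier v])
qed (rule mult_carrier_mat mE_mF_carrier R_mat_carrier)+

lemma R_mat_transpose: "transpose_mat (R_mat r q B X) = R_mat r q B X"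
  unfolding R_mat_def
proof (rule tens_mat_eqI)
  fix c d a b assume cdab: "c \<in> {1..2*r}" "d \<in> {1..2*r}" "a \<in> {1..2*r}" "b \<in> {1..2*r}"
  let ?g = "R_coef r (R_A q B) B (R_C r q B X)"
  have "transpose_mat (tens_mat (2*r) ?g) $$ ((c - 1) * (2*r) + (d - 1), (a - 1) * (2*r) + (b - 1)) = ?g a b c d"
    using tens_index(1)[OF cdab(1,2)] tens_index(1)[OF cdab(3,4)] tens_mat_index[OF cdab(3,4,1,2), of ?g]
    by (subst index_transpose_mat(1)) (simp_all only: carrier_matD[OF tens_mat_carrier])
  also have "?g a b c d = ?g c d a b"
  proof -
    have "(if c = a \<and> d = b then R_A q B a b else 0) = (if a = c \<and> b = d then R_A q B c d else 0)" by auto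
    moreover have "(if c = b \<and> d = a \<and> a \<noteq> b then B else 0) = (if a = d \<and> b = c \<and> c \<noteq> d then B else 0)" by auto
    moreover have "(if b = bar r a \<and> d = bar r c then R_C r q B X a c else 0)
        = (if d = bar r c \<and> b = bar r a then R_C r q B X c a else 0)"
      by (simp only: R_C_sym[of r q B X a c] conj_commute)
    ultimately show ?thesis unfolding R_coef_def by simp
  qed
  finally show "transpose_mat (tens_mat (2*r) ?g) $$ ((c - 1) * (2*r) + (d - 1), (a - 1) * (2*r) + (b - 1)) = ?g c d a b" .
qed (simp only: transpose_carrier_mat tens_mat_carrier)

lemma transpose_kron:
  assumes "A \<in> carrier_mat n n" "B \<in> carrier_mat n n"
  shows "transpose_mat (A \<otimes>\<^sub>k B) = transpose_mat A \<otimes>\<^sub>k transpose_mat B"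
proof (rule eq_matI)
  fix k l assume "k < dim_row (transpose_mat A \<otimes>\<^sub>k transpose_mat B)" "l < dim_col (transpose_mat A \<otimes>\<^sub>k transpose_mat B)"
  then have kl: "k < n * n" "l < n * n" using assms by (simp_all add: kron_def)
  then have "0 < n" by (cases n) auto
  then have "k div n < n" "k mod n < n" "l div n < n" "l mod n < n"
    using kl by (simp_all add: less_mult_imp_div_less)
  then show "transpose_mat (A \<otimes>\<^sub>k B) $$ (k, l) = (transpose_mat A \<otimes>\<^sub>k transpose_mat B) $$ (k, l)"
    using kl assms by (simp add: kron_def)
qed (use assms in \<open>simp_all add: kron_def\<close>)

lemma transpose_diag_op [simp]: "transpose_mat (diag_op n f) = diag_op n f"
  by (rule eq_matI) (auto simp: diag_op_def)

text \<open>E_0(a) is the transpose of F_0(1/a), and the diagonal factors K_i^(1/2) in the coproduct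
  are symmetric.\<close>

lemma mE_eq_transpose_mF:
  assumes "a \<noteq> 0" "b \<noteq> 0"
  shows "mE (utensor r qh (L1 r a) (L1 r b)) i = transpose_mat (mF (utensor r qh (L1 r (1 / a)) (L1 r (1 / b))) i)"
proof -
  have one: "transpose_mat (mF (L1 r (1 / a)) i) = mE (L1 r a) i" if "a \<noteq> 0" for a
    using that by (intro eq_matI) (auto simp: L1_def L1E0_def mat_unit_def field_simps power2_eq_square)
  show ?thesis
    unfolding utensor_def umod.select_convs mKhalf_L1 mKhalfinv_L1
      transpose_add[OF kron_carrier[OF L1_carrier(2) diag_op_carrier] kron_carrier[OF diag_op_carrier L1_carrier(2)]]
      transpose_kron[OF L1_carrier(2) diag_op_carrier] transpose_kron[OF diag_op_carrier L1_carrier(2)]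
      transpose_diag_op one[OF assms(1)] one[OF assms(2)] ..
qed

lemma R_mat_mE:
  assumes r: "r \<ge> 2" and q: "q \<noteq> 0" and qh: "qh\<^sup>2 = q" and i: "i \<in> {0..r}"
    and ab: "a \<noteq> 0" "b \<noteq> 0" "z = a / b"
    and z: "z * (1 - inverse q * B) = 1 - q * B" "z * (X + (q - inverse q) * B) = - (q ^ (2 * r)) * X"
  shows "R_mat r q B X * mE (utensor r qh (L1 r a) (L1 r b)) i = mE (utensor r qh (L1 r b) (L1 r a)) i * R_mat r q B X"
proof -
  let ?T = "R_mat r q B X"
  \<comment> \<open>The parameters are inverted and also swapped, so their quotient is again a / b =
    z and the same B and X apply.\<close>
  have "?T * mF (utensor r qh (L1 r (1 / b)) (L1 r (1 / a))) i = mF (utensor r qh (L1 r (1 / a)) (L1 r (1 / b))) i * ?T"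
    by (rule R_mat_mF[OF r q qh i _ _ _ z]) (use ab in auto)
  then have "transpose_mat (?T * mF (utensor r qh (L1 r (1 / b)) (L1 r (1 / a))) i)
      = transpose_mat (mF (utensor r qh (L1 r (1 / a)) (L1 r (1 / b))) i * ?T)" by simp
  then show ?thesis
    unfolding transpose_mult[OF R_mat_carrier mE_mF_carrier(2)] transpose_mult[OF mE_mF_carrier(2) R_mat_carrier]
      R_mat_transpose mE_eq_transpose_mF[OF ab(1,2)] mE_eq_transpose_mF[OF ab(2,1)] by simp
qed

lemma mult_diag_op_index:
  fixes M :: "complex mat"
  assumes "M \<in> carrier_mat n n" "k < n" "l < n"
  shows "(M * diag_op n f) $$ (k, l) = M $$ (k, l) * f l" "(diag_op n f * M) $$ (k, l) = f k * M $$ (k, l)"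
  using assms by (simp_all add: diag_op_def scalar_prod_def if_distrib[of "\<lambda>x. _ * x"] if_distrib[of "\<lambda>x. x * _"] cong: if_cong)

lemma L1wt_bar:
  assumes "k \<in> {1..2*r}" "i \<le> r" "r \<ge> 2"
  shows "L1wt r i (bar r k) = - L1wt r i k"
proof -
  have "bar r k \<le> r \<longleftrightarrow> \<not> k \<le> r" using assms by (auto simp: bar_def)
  moreover have "bar r (bar r k) = k" using assms(1) by simp
  moreover have "bar r k = 1 \<longleftrightarrow> k = 2 * r" "bar r k = 2 \<longleftrightarrow> k = 2 * r - 1" "bar r k = 2 * r \<longleftrightarrow> k = 1" "bar r k = 2 * r - 1 \<longleftrightarrow> k = 2"
    using assms by (auto simp: bar_def)
  ultimately show ?thesis using assms(2,3)
    by (cases "i = 0"; cases "k \<le> r") (simp_all add: L1wt_def)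
qed

lemma mwt_utensor:
  assumes "c \<in> {1..2*r}" "d \<in> {1..2*r}"
  shows "mwt (utensor r qh (L1 r a) (L1 r b)) i ((c - 1) * (2*r) + (d - 1)) = L1wt r i c + L1wt r i d"
proof -
  have "mwt (utensor r qh (L1 r a) (L1 r b)) i k = L1wt r i (k div (2*r) + 1) + L1wt r i (k mod (2*r) + 1)" for k
    by (simp add: utensor_def L1_def)
  then show ?thesis by (simp only: tens_index(2,3)[OF assms])
qed

text \<open>A nonzero entry fixes a pair of indices, swaps it, or leads from one bar pair to
  another. The weight survives in each case, since v_k and v_(bar k) have opposite weights. The
  function \<open>g\<close> covers K_i and its inverse at once.\<close>

lemma R_mat_diag_op:
  assumes i: "i \<le> r" and r: "r \<ge> 2"
  shows "R_mat r q B X * diag_op ((2*r)\<^sup>2) (\<lambda>k. g (mwt (utensor r qh (L1 r a) (L1 r b)) i k))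
    = diag_op ((2*r)\<^sup>2) (\<lambda>k. g (mwt (utensor r qh (L1 r a') (L1 r b')) i k)) * R_mat r q B X"
proof (rule eq_matI, goal_cases)
  case (1 k l)
  then have kl: "k < (2*r)\<^sup>2" "l < (2*r)\<^sup>2" by (simp_all add: diag_op_def R_mat_def tens_mat_def)
  obtain c d where cd: "c \<in> {1..2*r}" "d \<in> {1..2*r}" "k = (c - 1) * (2*r) + (d - 1)"
    by (rule tens_index_surj[OF kl(1)])
  obtain e f where ef: "e \<in> {1..2*r}" "f \<in> {1..2*r}" "l = (e - 1) * (2*r) + (f - 1)"
    by (rule tens_index_surj[OF kl(2)])
  consider "e = c \<and> f = d \<or> e = d \<and> f = c \<or> d = bar r c \<and> f = bar r e"
    | "R_coef r (R_A q B) B (R_C r q B X) c d e f = 0"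
  proof -
    have "R_coef r (R_A q B) B (R_C r q B X) c d e f = 0"
      if "\<not> (e = c \<and> f = d)" "\<not> (e = d \<and> f = c)" "\<not> (d = bar r c \<and> f = bar r e)"
      using that unfolding R_coef_def by (simp only: simp_thms if_False conj_assoc[symmetric] add_0)
    then show ?thesis using that by blast
  qed
  then have "R_coef r (R_A q B) B (R_C r q B X) c d e f = 0 \<or> L1wt r i c + L1wt r i d = L1wt r i e + L1wt r i f"
    by cases (use L1wt_bar[OF cd(1) i r] L1wt_bar[OF ef(1) i r] in \<open>auto simp del: bar_bar\<close>)
  then have "R_mat r q B X $$ (k, l) * g (mwt (utensor r qh (L1 r a) (L1 r b)) i l)
      = g (mwt (utensor r qh (L1 r a') (L1 r b')) i k) * R_mat r q B X $$ (k, l)"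
    unfolding cd(3) ef(3) mwt_utensor[OF cd(1,2)] mwt_utensor[OF ef(1,2)] R_mat_def
      tens_mat_index[OF cd(1,2) ef(1,2)] by auto
  then show ?case unfolding mult_diag_op_index[OF R_mat_carrier kl] .
qed (simp_all add: diag_op_def R_mat_def tens_mat_def)

lemma R_mat_hom:
  assumes r: "r \<ge> 2" and q: "q \<noteq> 0" and qh: "qh\<^sup>2 = q"
    and ab: "a \<noteq> 0" "b \<noteq> 0" "z = a / b"
    and z: "z * (1 - inverse q * B) = 1 - q * B" "z * (X + (q - inverse q) * B) = - (q ^ (2 * r)) * X"
    and M: "umodule r q (utensor r qh (L1 r a) (L1 r b))" "umodule r q (utensor r qh (L1 r b) (L1 r a))"
  shows "umodule_hom r q (utensor r qh (L1 r a) (L1 r b)) (utensor r qh (L1 r b) (L1 r a)) (R_mat r q B X)"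
proof -
  have dim: "mdim (utensor r qh (L1 r a) (L1 r b)) = (2*r)\<^sup>2" for a b
    by (simp only: mdim_utensor mdim_L1 power2_eq_square)
  show ?thesis
    unfolding umodule_hom_def mK_def mKinv_def dim
  proof (intro conjI ballI)
    fix i assume i: "i \<in> {0..r}"
    then have ir: "i \<le> r" by simp
    let ?T = "R_mat r q B X" and ?M = "utensor r qh (L1 r a) (L1 r b)" and ?N = "utensor r qh (L1 r b) (L1 r a)"
    show "?T * mE ?M i = mE ?N i * ?T" by (rule R_mat_mE[OF r q qh i ab z])
    show "?T * mF ?M i = mF ?N i * ?T" by (rule R_mat_mF[OF r q qh i ab z])
    show "?T * diag_op ((2*r)\<^sup>2) (\<lambda>k. qi r q i powi mwt ?M i k) = diag_op ((2*r)\<^sup>2) (\<lambda>k. qi r q i powi mwt ?N i k) * ?T"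
      by (rule R_mat_diag_op[OF ir r])
    show "?T * diag_op ((2*r)\<^sup>2) (\<lambda>k. qi r q i powi - mwt ?M i k) = diag_op ((2*r)\<^sup>2) (\<lambda>k. qi r q i powi - mwt ?N i k) * ?T"
      by (rule R_mat_diag_op[OF ir r, where g = "\<lambda>w. qi r q i powi - w"])
  qed (rule M R_mat_carrier)+
qed

lemma R_mat_highest:
  assumes r: "r \<ge> 1"
  shows "R_mat r q B X *\<^sub>v unit_vec ((2*r)\<^sup>2) 0 = unit_vec ((2*r)\<^sup>2) 0"
proof (rule coords_eqI)
  fix c d assume c: "c \<in> {1..2*r}" and d: "d \<in> {1..2*r}"
  let ?e = "unit_vec ((2*r)\<^sup>2) 0 :: complex vec"
  have e: "coords (2*r) ?e a b = (if a = 1 \<and> b = 1 then 1 else 0)" if "a \<in> {1..2*r}" "b \<in> {1..2*r}" for a b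
  proof -
    have "(a - 1) * (2*r) + (b - 1) = 0 \<longleftrightarrow> a = 1 \<and> b = 1"
      using that r by (cases a; cases b) auto
    moreover have "0 < (2*r)\<^sup>2" using r by simp
    ultimately show ?thesis by (simp only: coords_def index_unit_vec(1)[OF _ tens_index(1)[OF that]])
  qed
  have bar: "bar r k \<noteq> 1" if "k = 1" for k using that r by (simp add: bar_def)
  have "coords (2*r) (R_mat r q B X *\<^sub>v ?e) c d = R_op r (R_A q B) B (R_C r q B X) (coords (2*r) ?e) c d"
    unfolding R_mat_def by (rule coords_R_coef[OF unit_vec_carrier c d])
  also have "\<dots> = R_op r (R_A q B) B (R_C r q B X) (\<lambda>a b. if a = 1 \<and> b = 1 then 1 else 0) c d"
    by (rule R_op_cong[OF e c d])
  also have "\<dots> = (if c = 1 \<and> d = 1 then 1 else 0)"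
    using bar by (auto simp: R_op_def R_A_def intro!: sum.neutral)
  also have "\<dots> = coords (2*r) ?e c d" using e[OF c d] by simp
  finally show "coords (2*r) (R_mat r q B X *\<^sub>v ?e) c d = coords (2*r) ?e c d" .
qed (rule mult_mat_vec_carrier[OF R_mat_carrier] unit_vec_carrier)+

section \<open>The formula in terms of matrix units\<close>

lemma mat_unit2_index:
  assumes "c \<in> {1..2*r}" "d \<in> {1..2*r}" "a \<in> {1..2*r}" "b \<in> {1..2*r}"
  shows "mat_unit2 r i j k l $$ ((c - 1) * (2*r) + (d - 1), (a - 1) * (2*r) + (b - 1))
    = (if c = i \<and> a = j \<and> d = k \<and> b = l then 1 else 0)"
proof -
  have carr: "mat_unit n i j \<in> carrier_mat n n" for n i j by (simp add: mat_unit_def)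
  show ?thesis
    unfolding mat_unit2_def kron_index[OF carr carr assms] mat_unit_index[OF assms(1,3)] mat_unit_index[OF assms(2,4)]
    by simp
qed

lemma mat_unit2_carrier [simp]: "mat_unit2 r i j k l \<in> carrier_mat ((2*r)\<^sup>2) ((2*r)\<^sup>2)"
  unfolding mat_unit2_def by (rule kron_carrier) (simp_all add: mat_unit_def)

lemma sum_mat_carrier [simp]: "sum_mat n f I \<in> carrier_mat n n"
  by (simp add: sum_mat_def)

lemma sum_mat_index: "k < n \<Longrightarrow> l < n \<Longrightarrow> sum_mat n f I $$ (k, l) = (\<Sum>i\<in>I. f i $$ (k, l))"
  by (simp add: sum_mat_def)

text \<open>A fixed matrix entry receives a contribution from at most one pair (x, y) of summation
  indices; \<open>G\<close> collects the conditions that do not involve the summation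
  variables.\<close>

lemma sum_idx_pairs:
  fixes h :: "nat \<Rightarrow> nat \<Rightarrow> 'a::comm_monoid_add"
  assumes "x \<in> {1..2*r}" "y \<in> {1..2*r}"
    and "\<And>i j. g i j = (if i = x \<and> j = y \<and> G then h i j else 0)"
  shows "(\<Sum>p\<in>idx_pairs r P. g (fst p) (snd p)) = (if P x y \<and> G then h x y else 0)"
proof -
  have fin: "finite (idx_pairs r P)"
    by (rule finite_subset[of _ "{1..2*r} \<times> {1..2*r}"]) (auto simp: idx_pairs_def)
  have "(\<Sum>p\<in>idx_pairs r P. g (fst p) (snd p)) = (\<Sum>p\<in>idx_pairs r P. if p = (x, y) then if G then h x y else 0 else 0)"
    by (intro sum.cong refl) (auto simp: assms(3))
  also have "\<dots> = (if (x, y) \<in> idx_pairs r P then if G then h x y else 0 else 0)"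
    using fin by simp
  finally show ?thesis using assms(1,2) by (simp add: idx_pairs_def)
qed

definition rat_A :: "complex \<Rightarrow> nat \<Rightarrow> nat \<Rightarrow> ratfun" where
  "rat_A q c d = (let z = rat_var; Q = rat_const q; D = Q - inverse Q * z in
     if c = d then 1 else if c < d then z * (Q - inverse Q) / D else (Q - inverse Q) / D)"

definition rat_C :: "nat \<Rightarrow> complex \<Rightarrow> complex \<Rightarrow> nat \<Rightarrow> nat \<Rightarrow> ratfun" where
  "rat_C r q qh c a = (let z = rat_var; Q = rat_const q; S = rat_const qh in
     - ((Q - inverse Q) * (1 - z) / ((Q - inverse Q * z) * (Q ^ r + inverse Q ^ r * z))) *
     (if c + a < 2 * r + 1 then z * rat_const (eps r q c * eps r q a / q ^ r)
      else if 2 * r + 1 < c + a then - rat_const (eps r q c * eps r q a / inverse q ^ r)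
      else (S ^ (2 * r - 1) - inverse S ^ (2 * r - 1) * z) / (S + inverse S)))"

lemma R_sl_index:
  assumes cd: "c \<in> {1..2*r}" "d \<in> {1..2*r}" and ab: "a \<in> {1..2*r}" "b \<in> {1..2*r}"
  shows "R_sl r q $$ ((c - 1) * (2*r) + (d - 1), (a - 1) * (2*r) + (b - 1))
    = (if a = c \<and> b = d then rat_A q c d else 0)
     + (if a = d \<and> b = c \<and> c \<noteq> d then (1 - rat_var) / (rat_const q - inverse (rat_const q) * rat_var) else 0)"
proof -
  note lt = tens_index(1)[OF cd] tens_index(1)[OF ab]
  let ?k = "(c - 1) * (2*r) + (d - 1)" and ?l = "(a - 1) * (2*r) + (b - 1)"
  have 1: "(\<Sum>i\<in>{1..2*r}. mat_unit2 r i i i i $$ (?k, ?l)) = (if a = c \<and> b = d \<and> c = d then 1 else 0)"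
  proof -
    have "(\<Sum>i\<in>{1..2*r}. mat_unit2 r i i i i $$ (?k, ?l)) = (\<Sum>i\<in>{1..2*r}. if i = c then if a = c \<and> b = d \<and> c = d then 1 else 0 else 0)"
      unfolding mat_unit2_index[OF assms] by (intro sum.cong refl) auto
    then show ?thesis using cd by simp
  qed
  have 2: "(\<Sum>p\<in>idx_pairs r P. (case p of (i, j) \<Rightarrow> mat_unit2 r i i j j) $$ (?k, ?l)) = (if P c d \<and> (a = c \<and> b = d) then 1 else 0)" for P
  proof -
    have e: "mat_unit2 r i i j j $$ (?k, ?l) = (if i = c \<and> j = d \<and> (a = c \<and> b = d) then 1 else 0)" for i j
      unfolding mat_unit2_index[OF assms] by auto
    show ?thesis using sum_idx_pairs[OF cd e, of P] by (simp only: split_beta)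
  qed
  have 3: "(\<Sum>p\<in>idx_pairs r P. (case p of (i, j) \<Rightarrow> mat_unit2 r i j j i) $$ (?k, ?l)) = (if P c d \<and> (a = d \<and> b = c) then 1 else 0)" for P
  proof -
    have e: "mat_unit2 r i j j i $$ (?k, ?l) = (if i = c \<and> j = d \<and> (a = d \<and> b = c) then 1 else 0)" for i j
      unfolding mat_unit2_index[OF assms] by auto
    show ?thesis using sum_idx_pairs[OF cd e, of P] by (simp only: split_beta)
  qed
  let ?D = "rat_const q - inverse (rat_const q) * rat_var"
  have "R_sl r q $$ (?k, ?l) = (if a = c \<and> b = d \<and> c = d then 1 else 0)
      + rat_var * (rat_const q - inverse (rat_const q)) / ?D * (if c < d \<and> (a = c \<and> b = d) then 1 else 0)
      + (rat_const q - inverse (rat_const q)) / ?D * (if c > d \<and> (a = c \<and> b = d) then 1 else 0)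
      + (1 - rat_var) / ?D * (if c \<noteq> d \<and> (a = d \<and> b = c) then 1 else 0)"
    unfolding R_sl_def Let_def
    by (simp only: 1 2 3 index_add_mat(1) index_smult_mat sum_mat_index[OF lt] index_add_mat(2,3) carrier_matD[OF sum_mat_carrier] lt)
  then show ?thesis by (auto simp: rat_A_def Let_def)
qed

lemma Q_mat_index:
  fixes q qh :: complex
  assumes cd: "c \<in> {1..2*r}" "d \<in> {1..2*r}" and ab: "a \<in> {1..2*r}" "b \<in> {1..2*r}"
  shows "- ((rat_const q - inverse (rat_const q)) * (1 - rat_var) /
        ((rat_const q - inverse (rat_const q) * rat_var) * (rat_const q ^ r + inverse (rat_const q) ^ r * rat_var)))
      * Q_mat r q qh $$ ((c - 1) * (2*r) + (d - 1), (a - 1) * (2*r) + (b - 1))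
    = (if d = bar r c \<and> b = bar r a then rat_C r q qh c a else 0)"
proof -
  note lt = tens_index(1)[OF cd] tens_index(1)[OF ab]
  let ?k = "(c - 1) * (2*r) + (d - 1)" and ?l = "(a - 1) * (2*r) + (b - 1)" and ?G = "d = bar r c \<and> b = bar r a"
  have carr: "dim_row (mat_unit2 r i j k l) = (2*r)\<^sup>2" "dim_col (mat_unit2 r i j k l) = (2*r)\<^sup>2" for i j k l
    using mat_unit2_carrier[of r i j k l] by (simp_all only: carrier_matD)
  have 1: "(\<Sum>p\<in>idx_pairs r P. (case p of (i, j) \<Rightarrow> rat_const (h i j) \<cdot>\<^sub>m mat_unit2 r i j (bar r i) (bar r j)) $$ (?k, ?l))
      = (if P c a \<and> ?G then rat_const (h c a) else 0)" for P and h :: "nat \<Rightarrow> nat \<Rightarrow> complex"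
  proof -
    have e: "(rat_const (h i j) \<cdot>\<^sub>m mat_unit2 r i j (bar r i) (bar r j)) $$ (?k, ?l)
        = (if i = c \<and> j = a \<and> ?G then rat_const (h i j) else 0)" for i j
      by (subst index_smult_mat(1)) (auto simp only: carr lt mat_unit2_index[OF assms(1-4)] mult_1_right mult_zero_right split: if_split)
    show ?thesis using sum_idx_pairs[OF cd(1) ab(1) e, of P] by (simp only: split_beta)
  qed
  have 2: "(\<Sum>p\<in>idx_pairs r P. (case p of (i, j) \<Rightarrow> mat_unit2 r i j (bar r i) (bar r j)) $$ (?k, ?l))
      = (if P c a \<and> ?G then 1 else 0)" for P
  proof -
    have e: "mat_unit2 r i j (bar r i) (bar r j) $$ (?k, ?l) = (if i = c \<and> j = a \<and> ?G then 1 else 0)" for i j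
      unfolding mat_unit2_index[OF assms(1-4)] by auto
    show ?thesis using sum_idx_pairs[OF cd(1) ab(1) e, of P] by (simp only: split_beta)
  qed
  let ?S = "rat_const qh"
  have "Q_mat r q qh $$ (?k, ?l) = rat_var * (if c + a < 2 * r + 1 \<and> ?G then rat_const (eps r q c * eps r q a / q ^ r) else 0)
      - (if c + a > 2 * r + 1 \<and> ?G then rat_const (eps r q c * eps r q a / inverse q ^ r) else 0)
      + (?S ^ (2 * r - 1) - inverse ?S ^ (2 * r - 1) * rat_var) / (?S + inverse ?S) * (if c + a = 2 * r + 1 \<and> ?G then 1 else 0)"
    unfolding Q_mat_def Let_def
    by (simp only: 1 2 index_add_mat(1) index_minus_mat index_smult_mat sum_mat_index[OF lt] index_add_mat(2,3) carrier_matD[OF sum_mat_carrier] lt)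
  then show ?thesis by (auto simp: rat_C_def Let_def)
qed

section \<open>The scalars B and X as functions of the spectral parameter\<close>

definition R_B :: "complex \<Rightarrow> complex \<Rightarrow> complex" where
  "R_B q t = (1 - t) / (q - inverse q * t)"

definition R_X :: "nat \<Rightarrow> complex \<Rightarrow> complex \<Rightarrow> complex" where
  "R_X r q t = - ((q - inverse q) * R_B q t * t / (q ^ (2 * r) + t))"

lemma R_B_denominator:
  fixes q t :: complex
  assumes "q \<noteq> 0" "t \<noteq> q\<^sup>2"
  shows "q - inverse q * t \<noteq> 0"
proof -
  have "q * (q - inverse q * t) = q\<^sup>2 - t"
    using assms(1) by (simp add: right_diff_distrib power2_eq_square)
  then show ?thesis using assms(2) by auto
qed

lemma one_minus_R_B:
  assumes "q \<noteq> 0" "t \<noteq> q\<^sup>2"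
  shows "1 - q * R_B q t = t * (q - inverse q) / (q - inverse q * t)"
    and "1 - inverse q * R_B q t = (q - inverse q) / (q - inverse q * t)"
proof -
  have *: "1 - k * (n / D) = (D - k * n) / D" if "D \<noteq> 0" for k n D :: complex
    using that by (simp add: diff_divide_distrib)
  show "1 - q * R_B q t = t * (q - inverse q) / (q - inverse q * t)"
    "1 - inverse q * R_B q t = (q - inverse q) / (q - inverse q * t)"
    unfolding R_B_def *[OF R_B_denominator[OF assms]] by (simp_all add: algebra_simps)
qed

text \<open>These are the two conditions that F_0 imposes through \<open>crossing_affine\<close>;
  the excluded values of t are the zeros of the two denominators.\<close>

lemma R_B_R_X:
  assumes "q \<noteq> 0" "t \<noteq> q\<^sup>2" "t \<noteq> - (q ^ (2 * r))"
  shows "t * (1 - inverse q * R_B q t) = 1 - q * R_B q t"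
    and "t * (R_X r q t + (q - inverse q) * R_B q t) = - (q ^ (2 * r)) * R_X r q t"
proof -
  show "t * (1 - inverse q * R_B q t) = 1 - q * R_B q t" unfolding one_minus_R_B[OF assms(1,2)] by simp
  define N where "N = q ^ (2 * r) + t"
  have N: "N \<noteq> 0" using assms(3) by (metis N_def add.commute eq_neg_iff_add_eq_0)
  define \<beta> where "\<beta> = (q - inverse q) * R_B q t"
  have "- (\<beta> * t / N) + \<beta> = \<beta> * (N - t) / N"
    using N by (simp add: right_diff_distrib diff_divide_distrib)
  moreover have "N - t = q ^ (2 * r)" unfolding N_def by (rule add_diff_cancel_right')
  ultimately show "t * (R_X r q t + (q - inverse q) * R_B q t) = - (q ^ (2 * r)) * R_X r q t"
    unfolding R_X_def \<beta>_def[symmetric] N_def[symmetric] by (simp add: mult_ac)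
qed

lemma represents_rat_A:
  assumes q: "q \<noteq> 0"
  shows "represents (rat_A q c d) (\<lambda>t. R_A q (R_B q t) c d)"
proof (rule represents_cong)
  show "represents (rat_A q c d) (\<lambda>t. if c = d then 1 else
      if c < d then t * (q - inverse q) / (q - inverse q * t) else (q - inverse q) / (q - inverse q * t))"
    unfolding rat_A_def Let_def by (cases "c = d"; cases "c < d") (simp_all, (rule represents_1 represents_divide
      represents_mult represents_diff represents_inverse represents_const represents_var)+)
  show "finite {q\<^sup>2}" by simp
  fix t assume "t \<notin> {q\<^sup>2}"
  then have "t \<noteq> q\<^sup>2" by simp
  then show "(if c = d then 1 else
      if c < d then t * (q - inverse q) / (q - inverse q * t) else (q - inverse q) / (q - inverse q * t)) = R_A q (R_B q t) c d"
    unfolding R_A_def one_minus_R_B[OF q \<open>t \<noteq> q\<^sup>2\<close>] by auto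
qed

lemma represents_rat_B:
  "represents ((1 - rat_var) / (rat_const q - inverse (rat_const q) * rat_var)) (R_B q)"
  unfolding R_B_def[abs_def] by (intro represents_divide represents_diff represents_1 represents_mult represents_inverse
      represents_const represents_var)

lemma represents_rat_C:
  assumes q: "q \<noteq> 0" "q \<noteq> - 1" and qh: "qh\<^sup>2 = q" and r: "r \<ge> 1"
  shows "represents (rat_C r q qh c a) (\<lambda>t. R_C r q (R_B q t) (R_X r q t) c a)"
proof (rule represents_cong)
  let ?pre = "\<lambda>t. - ((q - inverse q) * (1 - t) / ((q - inverse q * t) * (q ^ r + inverse q ^ r * t)))"
  let ?\<phi> = "\<lambda>t. ?pre t * (if c + a < 2 * r + 1 then t * (eps r q c * eps r q a / q ^ r)
      else if 2 * r + 1 < c + a then - (eps r q c * eps r q a / inverse q ^ r)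
      else (qh ^ (2 * r - 1) - inverse qh ^ (2 * r - 1) * t) / (qh + inverse qh))"
  have if_rep: "represents (if P then f else g) (\<lambda>t. if P then \<phi> t else \<psi> t)"
    if "represents f \<phi>" "represents g \<psi>" for P f g \<phi> \<psi>
    using that by (cases P) simp_all
  show "represents (rat_C r q qh c a) ?\<phi>"
    unfolding rat_C_def Let_def by (intro represents_mult if_rep represents_divide represents_minus represents_diff
        represents_add represents_power represents_inverse represents_1 represents_const represents_var)
  show "finite {q\<^sup>2, - (q ^ (2 * r))}" by simp
  fix t assume "t \<notin> {q\<^sup>2, - (q ^ (2 * r))}"
  then have t: "t \<noteq> q\<^sup>2" "t \<noteq> - (q ^ (2 * r))" by auto
  show "?\<phi> t = R_C r q (R_B q t) (R_X r q t) c a"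
  proof -
    have W: "q ^ (2 * r) + t \<noteq> 0" using t(2) by (metis add.commute eq_neg_iff_add_eq_0)
    define \<beta> where "\<beta> = (q - inverse q) * R_B q t"
    define w where "w = q ^ r"
    have w: "w \<noteq> 0" "inverse q ^ r = inverse w" "q ^ (2 * r) = w * w"
      using q by (simp_all add: w_def power_inverse mult_2 power_add)
    have "w + inverse w * t = (w * w + t) / w" using w(1) by (simp add: add_divide_distrib inverse_eq_divide)
    then have pre: "?pre t = - \<beta> * w / (w * w + t)"
      unfolding w(2) w_def[symmetric] by (simp add: \<beta>_def R_B_def)
    have X: "R_X r q t = - (\<beta> * t / (w * w + t))" by (simp only: R_X_def \<beta>_def w(3))
    have W: "w * w + t \<noteq> 0" using W w(3) by simp
    have qh0: "qh \<noteq> 0" using q qh by auto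
    \<comment> \<open>The half-integer powers are removed by writing q^(r - 1/2) as w / qh with w =
      q^r.\<close>
    have "qh ^ (2 * r) = qh ^ (2 * r - 1) * qh" using r by (simp flip: power_Suc2)
    then have hp: "qh ^ (2 * r - 1) = w / qh"
      using qh0 by (simp add: w_def power_mult qh)
    have hi: "inverse qh ^ (2 * r - 1) = qh / w" by (simp only: power_inverse hp inverse_divide)
    consider "c + a < 2 * r + 1" | "2 * r + 1 < c + a" | "c + a = 2 * r + 1" by linarith
    then show ?thesis
    proof cases
      case 1
      then have "R_C r q (R_B q t) (R_X r q t) c a = eps r q c * eps r q a * R_X r q t" by (simp only: R_C_def if_True)
      also have "\<dots> = ?pre t * (t * (eps r q c * eps r q a / w))" unfolding pre X using w(1) by simp
      finally show ?thesis using 1 by (simp only: w_def if_True)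
    next
      case 2
      then have n: "\<not> c + a < 2 * r + 1" by simp
      have "\<beta> * (w * w) / (w * w + t) = \<beta> * ((w * w + t) - t) / (w * w + t)" by simp
      also have "\<dots> = R_X r q t + \<beta>"
        unfolding X using W by (simp only: right_diff_distrib diff_divide_distrib nonzero_mult_div_cancel_right) simp
      finally have "R_X r q t + \<beta> = \<beta> * (w * w) / (w * w + t)" by simp
      then have "R_C r q (R_B q t) (R_X r q t) c a = eps r q c * eps r q a * (\<beta> * (w * w) / (w * w + t))"
        using 2 n by (simp only: R_C_def if_True if_False \<beta>_def)
      also have "\<dots> = ?pre t * - (eps r q c * eps r q a / inverse w)" unfolding pre unfolding divide_inverse inverse_inverse_eq by (simp add: mult_ac)
      finally show ?thesis using 2 n by (simp only: w(2) if_True if_False)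
    next
      case 3
      then have n: "\<not> c + a < 2 * r + 1" "\<not> 2 * r + 1 < c + a" by simp_all
      \<comment> \<open>The denominator qh + 1/qh equals (q + 1) / qh.\<close>
      have q1: "q + 1 \<noteq> 0" using q(2) by (metis add.commute eq_neg_iff_add_eq_0)
      have "(w / qh - qh / w * t) / (qh + inverse qh) = (w * w - q * t) / (w * (q + 1))"
      proof -
        have "w / qh - qh / w * t = (w * w - q * t) / (w * qh)"
          using diff_frac_eq[OF qh0 w(1), of w "qh * t"] unfolding qh[symmetric] by (simp add: power2_eq_square mult_ac)
        moreover have "qh + inverse qh = (q + 1) / qh"
          using qh0 unfolding qh[symmetric] by (simp add: add_divide_distrib power2_eq_square inverse_eq_divide)
        ultimately have "(w / qh - qh / w * t) / (qh + inverse qh) = (w * w - q * t) / (w * qh) / ((q + 1) / qh)"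
          by (simp only:)
        then show ?thesis using qh0 by simp
      qed
      then have "?\<phi> t = - \<beta> * w / (w * w + t) * ((w * w - q * t) / (w * (q + 1)))"
        unfolding pre hp hi using n by (simp only: if_False)
      also have "\<dots> = - \<beta> * (w * w - q * t) / ((w * w + t) * (q + 1))" using w(1) by simp
      \<comment> \<open>Partial fractions in t: the first term is - X, and the second is (1 - 1/q) B
        because (q - 1/q) / (q + 1) = 1 - 1/q. This is where the antidiagonal case of
        \<open>R_C\<close> comes from.\<close>
      also have "\<dots> = \<beta> * t / (w * w + t) - \<beta> / (q + 1)"
        unfolding diff_frac_eq[OF W q1] by (rule arg_cong2[of _ _ _ _ "(/)"]) (simp_all add: algebra_simps)
      also have "\<beta> / (q + 1) = (1 - inverse q) * R_B q t"
      proof -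
        have "\<beta> = (q + 1) * ((1 - inverse q) * R_B q t)" using q(1) by (simp add: \<beta>_def algebra_simps)
        then show ?thesis using q1 by simp
      qed
      also have "\<beta> * t / (w * w + t) = - R_X r q t" by (simp add: X)
      finally show ?thesis using n by (simp only: R_C_def if_False)
    qed
  qed
qed

section \<open>Identification of the normalized R-matrix\<close>

lemma mat_eval_R:
  assumes r: "r \<ge> 2" and q: "q \<noteq> 0" and qh: "qh\<^sup>2 = q" and R: "normalized_R_matrix r q qh R"
  obtains S where "finite S"
    and "\<And>t. t \<notin> S \<Longrightarrow> mat_eval R t = R_mat r q (R_B q t) (R_X r q t)"
    and "\<And>t. t \<notin> S \<Longrightarrow> umodule_hom r q (utensor r qh (L1 r t) (L1 r 1)) (utensor r qh (L1 r 1) (L1 r t)) (mat_eval R t)"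
proof -
  let ?hom = "\<lambda>a b. umodule_hom r q (utensor r qh (L1 r a) (L1 r b)) (utensor r qh (L1 r b) (L1 r a))"
    and ?e = "unit_vec ((2 * r)\<^sup>2) 0 :: complex vec"
  obtain S where S: "finite S" and hom: "\<And>a b. a \<noteq> 0 \<Longrightarrow> b \<noteq> 0 \<Longrightarrow> a / b \<notin> S \<Longrightarrow> ?hom a b (mat_eval R (a / b))"
    and uniq: "\<And>a b T. a \<noteq> 0 \<Longrightarrow> b \<noteq> 0 \<Longrightarrow> a / b \<notin> S \<Longrightarrow> ?hom a b T \<Longrightarrow> T *\<^sub>v ?e = ?e \<Longrightarrow> T = mat_eval R (a / b)"
    using R unfolding normalized_R_matrix_def Let_def by blast
  have h: "?hom t 1 (mat_eval R t)" if "t \<notin> S" "t \<noteq> 0" for t using hom[of t 1] that by simp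
  show ?thesis
  \<comment> \<open>Zero is removed because spectral parameters are nonzero; the other two points
    are excluded by \<open>R_B_R_X\<close>.\<close>
  proof (rule that[of "S \<union> {0, q\<^sup>2, - (q ^ (2 * r))}"])
    show "finite (S \<union> {0, q\<^sup>2, - (q ^ (2 * r))})" using S by simp
    fix t assume t: "t \<notin> S \<union> {0, q\<^sup>2, - (q ^ (2 * r))}"
    then show "?hom t 1 (mat_eval R t)" using h by simp
    \<comment> \<open>The defining relations on both tensor products are contained in the
      homomorphism property just obtained.\<close>
    then have M: "umodule r q (utensor r qh (L1 r t) (L1 r 1))" "umodule r q (utensor r qh (L1 r 1) (L1 r t))"
      by (simp_all add: umodule_hom_def)
    have t': "t \<noteq> 0" "t \<noteq> q\<^sup>2" "t \<noteq> - (q ^ (2 * r))" "t \<notin> S" using t by auto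
    have "?hom t 1 (R_mat r q (R_B q t) (R_X r q t))"
      by (rule R_mat_hom[OF r q qh t'(1) one_neq_zero _ R_B_R_X[OF q t'(2,3)] M]) simp
    moreover have "R_mat r q (R_B q t) (R_X r q t) *\<^sub>v ?e = ?e"
      using r by (intro R_mat_highest) simp
    ultimately show "mat_eval R t = R_mat r q (R_B q t) (R_X r q t)"
      using uniq[of t 1] t' by simp
  qed
qed

lemma represents_ratfun_mat:
  assumes R: "R \<in> carrier_mat m n" and S: "finite S" and kl: "k < m" "l < n"
    and eq: "\<And>t. t \<notin> S \<Longrightarrow> mat_eval R t $$ (k, l) = \<phi> t"
  shows "represents (R $$ (k, l)) \<phi>"
proof -
  have "mat_eval R t $$ (k, l) = rat_eval (R $$ (k, l)) t" for t
    using R kl by (simp add: mat_eval_def)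
  then have "{t. rat_eval (R $$ (k, l)) t \<noteq> \<phi> t} \<subseteq> S" using eq by fastforce
  then show ?thesis unfolding represents_def using S by (rule finite_subset)
qed

text \<open>Each entry of R and the corresponding entry of the formula represent the same function
  of t, so \<open>represents_unique\<close> makes them equal in C(z).\<close>

lemma R_eq_matrix_units:
  assumes r: "r \<ge> 2" and q: "q \<noteq> 0" "q \<noteq> - 1" and qh: "qh\<^sup>2 = q" and R: "normalized_R_matrix r q qh R"
  defines "Q \<equiv> rat_const q" and "z \<equiv> rat_var"
  shows "R = R_sl r q - ((Q - inverse Q) * (1 - z) / ((Q - inverse Q * z) * (Q ^ r + inverse Q ^ r * z))) \<cdot>\<^sub>m Q_mat r q qh"
    (is "R = R_sl r q - ?k \<cdot>\<^sub>m Q_mat r q qh")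
proof -
  obtain S where S: "finite S" "\<And>t. t \<notin> S \<Longrightarrow> mat_eval R t = R_mat r q (R_B q t) (R_X r q t)"
    using mat_eval_R[OF r q(1) qh R] by metis
  have RC: "R \<in> carrier_mat ((2*r)\<^sup>2) ((2*r)\<^sup>2)" using R by (simp add: normalized_R_matrix_def)
  let ?A = "rat_A q" and ?B = "(1 - rat_var) / (rat_const q - inverse (rat_const q) * rat_var)" and ?C = "rat_C r q qh"
  let ?g = "R_coef r ?A ?B ?C"
  have QC: "Q_mat r q qh \<in> carrier_mat ((2*r)\<^sup>2) ((2*r)\<^sup>2)"
    unfolding Q_mat_def Let_def by (intro add_carrier_mat minus_carrier_mat smult_carrier_mat sum_mat_carrier)
  have "R = tens_mat (2*r) ?g"
  proof (rule tens_mat_eqI[OF RC])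
    fix c d a b assume cd: "c \<in> {1..2*r}" "d \<in> {1..2*r}" and ab: "a \<in> {1..2*r}" "b \<in> {1..2*r}"
    let ?i = "((c - 1) * (2*r) + (d - 1), (a - 1) * (2*r) + (b - 1))"
    let ?\<phi> = "\<lambda>t. R_coef r (R_A q (R_B q t)) (R_B q t) (R_C r q (R_B q t) (R_X r q t)) c d a b"
    have "represents (R $$ ?i) ?\<phi>"
      by (rule represents_ratfun_mat[OF RC S(1) tens_index(1)[OF cd] tens_index(1)[OF ab]])
        (simp only: S(2) R_mat_def tens_mat_index[OF cd ab] not_False_eq_True)
    moreover have "represents (?g c d a b) ?\<phi>"
    proof -
      have if_rep: "represents (if P then f else 0) (\<lambda>t. if P then \<phi> t else 0)" if "represents f \<phi>" for P f \<phi>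
        using that represents_0 by simp
      have r1: "r \<ge> 1" using r by simp
      show ?thesis unfolding R_coef_def
        by (rule represents_add[OF represents_add[OF if_rep[OF represents_rat_A[OF q(1)]] if_rep[OF represents_rat_B]]
              if_rep[OF represents_rat_C[OF q qh r1]]])
    qed
    ultimately show "R $$ ?i = ?g c d a b" by (rule represents_unique)
  qed
  also have "\<dots> = R_sl r q - ?k \<cdot>\<^sub>m Q_mat r q qh"
  proof (rule tens_mat_eqI[symmetric])
    show "R_sl r q - ?k \<cdot>\<^sub>m Q_mat r q qh \<in> carrier_mat ((2*r)\<^sup>2) ((2*r)\<^sup>2)"
      by (rule minus_carrier_mat[OF smult_carrier_mat[OF QC]])
    fix c d a b assume cd: "c \<in> {1..2*r}" "d \<in> {1..2*r}" and ab: "a \<in> {1..2*r}" "b \<in> {1..2*r}"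
    note lt = tens_index(1)[OF cd] tens_index(1)[OF ab]
    let ?i = "((c - 1) * (2*r) + (d - 1), (a - 1) * (2*r) + (b - 1))"
    have "(R_sl r q - ?k \<cdot>\<^sub>m Q_mat r q qh) $$ ?i = R_sl r q $$ ?i - ?k * Q_mat r q qh $$ ?i"
      by (simp only: index_minus_mat(1) index_smult_mat carrier_matD[OF QC] lt)
    also have "\<dots> = R_sl r q $$ ?i + - ?k * Q_mat r q qh $$ ?i"
      by (simp only: diff_conv_add_uminus minus_mult_left)
    also have "- ?k * Q_mat r q qh $$ ?i = (if d = bar r c \<and> b = bar r a then rat_C r q qh c a else 0)"
      unfolding Q_def z_def by (rule Q_mat_index[OF cd ab])
    also have "R_sl r q $$ ?i + \<dots> = ?g c d a b"
      by (simp only: R_sl_index[OF cd ab] R_coef_def)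
    finally show "(R_sl r q - ?k \<cdot>\<^sub>m Q_mat r q qh) $$ ?i = ?g c d a b" .
  qed
  finally show ?thesis .
qed

section \<open>Highest weight vectors and projectors\<close>

lemma subspace_vec_iff:
  "subspace class_ring W (module_vec TYPE(complex) n) \<longleftrightarrow>
    W \<subseteq> carrier_vec n \<and> (\<forall>v\<in>W. \<forall>w\<in>W. v + w \<in> W) \<and> 0\<^sub>v n \<in> W \<and> (\<forall>c. \<forall>v\<in>W. c \<cdot>\<^sub>v v \<in> W)"
  unfolding subspace_def submodule_def module_vec_simps
  using vec_vs[of n, where 'a = complex] vec_module[of n, where 'a = complex]
  by (auto simp: class_ring_simps)

text \<open>Only E_0 and F_0 see the spectral parameters. Hence a homomorphism between the two
  orders of the factors is an endomorphism of one fixed U_q(C_r)-module.\<close>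

lemma utensor_arrow:
  assumes "i \<ge> 1"
  shows "mE (utensor r qh (L1 r a) (L1 r b)) i = mE (utensor r qh (L1 r 1) (L1 r 1)) i"
    "mF (utensor r qh (L1 r a) (L1 r b)) i = mF (utensor r qh (L1 r 1) (L1 r 1)) i"
    "mK r q (utensor r qh (L1 r a) (L1 r b)) i = mK r q (utensor r qh (L1 r 1) (L1 r 1)) i"
    "mKinv r q (utensor r qh (L1 r a) (L1 r b)) i = mKinv r q (utensor r qh (L1 r 1) (L1 r 1)) i"
proof -
  have 1: "mE (L1 r a) i = mE (L1 r 1) i" "mF (L1 r a) i = mF (L1 r 1) i" "mwt (L1 r a) = mwt (L1 r 1)" for a
    using assms by (simp_all add: L1_def)
  show "mE (utensor r qh (L1 r a) (L1 r b)) i = mE (utensor r qh (L1 r 1) (L1 r 1)) i"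
    "mF (utensor r qh (L1 r a) (L1 r b)) i = mF (utensor r qh (L1 r 1) (L1 r 1)) i"
    unfolding utensor_def umod.select_convs mKhalf_L1 mKhalfinv_L1 1[of a] 1[of b] by simp_all
  show "mK r q (utensor r qh (L1 r a) (L1 r b)) i = mK r q (utensor r qh (L1 r 1) (L1 r 1)) i"
    "mKinv r q (utensor r qh (L1 r a) (L1 r b)) i = mKinv r q (utensor r qh (L1 r 1) (L1 r 1)) i"
    unfolding mK_def mKinv_def utensor_def umod.select_convs 1[of a] 1[of b] mdim_L1 by simp_all
qed

lemma powi_inject:
  fixes p :: complex
  assumes "p \<noteq> 0" "\<And>n::nat. n > 0 \<Longrightarrow> p ^ n \<noteq> 1" "p powi a = p powi b"
  shows "a = b"
proof -
  have *: "a \<le> b" if eq: "p powi a = p powi b" for a b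
  proof (rule ccontr)
    assume "\<not> a \<le> b"
    then have "nat (a - b) > 0" "a - b = int (nat (a - b))" by auto
    moreover have "p powi (a - b) = 1" using eq assms(1) by (simp add: power_int_diff)
    ultimately show False using assms(2) by (metis power_int_of_nat)
  qed
  show ?thesis using *[OF assms(3)] *[OF assms(3)[symmetric]] by simp
qed

text \<open>Coordinate j of the weight of v_c in the orthonormal basis e_1, ..., e_r with omega_i =
  e_1 + ... + e_i. The cut-off beyond r ends the telescoping sum below; it cannot be dropped, as bar
  (r + 1) = r would give a spurious value at j = r + 1.\<close>

definition eps_coord :: "nat \<Rightarrow> nat \<Rightarrow> nat \<Rightarrow> int" where
  "eps_coord r j c = (if j \<le> r then of_bool (c = j) - of_bool (c = bar r j) else 0)"

text \<open>The sum telescopes: the weight of v_c at the i-th simple coroot is the difference of its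
  coordinates i and i + 1, where coordinate r + 1 counts as zero.\<close>

lemma sum_L1wt:
  assumes c: "c \<in> {1..2*r}" and j: "j \<in> {1..r}"
  shows "(\<Sum>i=j..r. L1wt r i c) = eps_coord r j c"
proof -
  have "L1wt r i c = - (eps_coord r (Suc i) c - eps_coord r i c)" if i: "i \<in> {j..r}" for i
  proof -
    have "c \<le> r \<Longrightarrow> c \<noteq> bar r i \<and> (i + 1 \<le> r \<longrightarrow> c \<noteq> bar r (i + 1))" using i j by (auto simp: bar_def)
    moreover have "\<not> c \<le> r \<Longrightarrow> c \<noteq> i \<and> (i + 1 \<le> r \<longrightarrow> c \<noteq> i + 1)" using i by auto
    moreover have "bar r c = i \<longleftrightarrow> c = bar r i" "bar r c = i + 1 \<longleftrightarrow> c = bar r (i + 1)"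
      using c i j by (auto simp: bar_def)
    moreover have "\<not> c \<le> r \<Longrightarrow> bar r c \<le> r" using c by (auto simp: bar_def)
    moreover have "i \<noteq> 0" "i \<le> r" using i j by auto
    ultimately show ?thesis unfolding L1wt_def eps_coord_def by (cases "c \<le> r"; cases "Suc i \<le> r") auto
  qed
  then have "(\<Sum>i=j..r. L1wt r i c) = - (\<Sum>i=j..r. eps_coord r (Suc i) c - eps_coord r i c)"
    unfolding sum_negf[symmetric] by (intro sum.cong) auto
  also have "\<dots> = eps_coord r j c"
    using sum_Suc_diff[of j r "\<lambda>i. eps_coord r i c"] j by (simp add: eps_coord_def)
  finally show ?thesis .
qed

text \<open>As q is not a root of unity, equal eigenvalues of K_i force equal integer exponents;
  this applies to q_r = q^2 as well. Orthonormal coordinates make the possible index pairs easy to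
  list.\<close>

lemma weight_vector_support:
  assumes q: "q \<noteq> 0" "\<And>n::nat. n > 0 \<Longrightarrow> q ^ n \<noteq> 1"
    and w: "w \<in> carrier_vec ((2*r)\<^sup>2)"
    and K: "\<And>i. i \<in> {1..r} \<Longrightarrow> mK r q (utensor r qh (L1 r 1) (L1 r 1)) i *\<^sub>v w = (qi r q i powi lam i) \<cdot>\<^sub>v w"
    and c: "c \<in> {1..2*r}" and d: "d \<in> {1..2*r}" and nz: "coords (2*r) w c d \<noteq> 0"
    and j: "j \<in> {1..r}"
  shows "eps_coord r j c + eps_coord r j d = (\<Sum>i=j..r. lam i)"
proof -
  have "L1wt r i c + L1wt r i d = lam i" if i: "i \<in> {1..r}" for i
  proof -
    let ?M = "utensor r qh (L1 r 1) (L1 r 1)" and ?k = "(c - 1) * (2*r) + (d - 1)"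
    have k: "?k < (2*r)\<^sup>2" by (rule tens_index[OF c d])
    have "(mK r q ?M i *\<^sub>v w) $ ?k = qi r q i powi mwt ?M i ?k * w $ ?k"
    proof -
      have "mdim ?M = (2*r)\<^sup>2" by (simp add: power2_eq_square)
      then have "(mK r q ?M i *\<^sub>v w) $ ?k = (\<Sum>l\<in>{0..<(2*r)\<^sup>2}. (if ?k = l then qi r q i powi mwt ?M i ?k else 0) * w $ l)"
        unfolding mK_def diag_op_def using k w by (auto simp: scalar_prod_def intro!: sum.cong)
      also have "\<dots> = (\<Sum>l\<in>{0..<(2*r)\<^sup>2}. if l = ?k then qi r q i powi mwt ?M i ?k * w $ ?k else 0)"
        by (intro sum.cong refl) auto
      finally show ?thesis using k by simp
    qed
    moreover have "(mK r q ?M i *\<^sub>v w) $ ?k = qi r q i powi lam i * w $ ?k"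
      unfolding K[OF i] using k w by simp
    moreover have "w $ ?k \<noteq> 0" using nz by (simp add: coords_def)
    ultimately have "qi r q i powi (L1wt r i c + L1wt r i d) = qi r q i powi lam i"
      unfolding mwt_utensor[OF c d] by simp
    moreover have "qi r q i \<noteq> 0" using q by (simp add: qi_half)
    moreover have "qi r q i ^ n \<noteq> 1" if "n > 0" for n
      using q(2)[of n] q(2)[of "2 * n"] that by (auto simp: qi_half simp flip: power_mult)
    ultimately show ?thesis using powi_inject by blast
  qed
  then have "(\<Sum>i=j..r. L1wt r i c + L1wt r i d) = (\<Sum>i=j..r. lam i)"
    using j by (intro sum.cong) auto
  then show ?thesis by (simp only: sum.distrib sum_L1wt[OF c j] sum_L1wt[OF d j])
qed

lemma support_2w1:
  assumes "r \<ge> 1" "c \<in> {1..2*r}" "d \<in> {1..2*r}"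
    and "\<And>j. j \<in> {1..r} \<Longrightarrow> eps_coord r j c + eps_coord r j d = (\<Sum>i=j..r. 2 * fund_weight 1 i)"
  shows "c = 1 \<and> d = 1"
proof -
  have "(\<Sum>i=1..r. 2 * fund_weight 1 i) = 2"
    using assms(1) by (simp add: fund_weight_def if_distrib[of "\<lambda>x. 2 * x"] cong: if_cong)
  then have "eps_coord r 1 c + eps_coord r 1 d = 2" using assms(1) assms(4)[of 1] by simp
  then show ?thesis by (auto simp: eps_coord_def of_bool_def split: if_splits)
qed

text \<open>The weights of the v_c are e_j and - e_j, and e_1 + e_2 is a sum of two of them only in
  the obvious way.\<close>

lemma support_w2:
  assumes "r \<ge> 2" "c \<in> {1..2*r}" "d \<in> {1..2*r}"
    and "\<And>j. j \<in> {1..r} \<Longrightarrow> eps_coord r j c + eps_coord r j d = (\<Sum>i=j..r. fund_weight 2 i)"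
  shows "c = 1 \<and> d = 2 \<or> c = 2 \<and> d = 1"
proof -
  have "(\<Sum>i=1..r. fund_weight 2 i) = 1" "(\<Sum>i=2..r. fund_weight 2 i) = 1"
    using assms(1) by (simp_all add: fund_weight_def)
  then have "eps_coord r 1 c + eps_coord r 1 d = 1" "eps_coord r 2 c + eps_coord r 2 d = 1"
    using assms(1) assms(4)[of 1] assms(4)[of 2] by simp_all
  moreover have "bar r 1 \<noteq> bar r 2" "bar r 1 \<noteq> 2" "bar r 2 \<noteq> 1" using assms(1) by (auto simp: bar_def)
  ultimately show ?thesis using assms(1)
    by (cases "c = 1"; cases "d = 1"; cases "c = 2"; cases "d = 2") (auto simp: eps_coord_def of_bool_def split: if_splits)
qed

lemma support_w0:
  assumes "c \<in> {1..2*r}" "d \<in> {1..2*r}"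
    and "\<And>j. j \<in> {1..r} \<Longrightarrow> eps_coord r j c + eps_coord r j d = (\<Sum>i=j..r. fund_weight 0 i)"
  shows "d = bar r c"
proof -
  have e: "eps_coord r j c + eps_coord r j d = 0" if "j \<in> {1..r}" for j
    using assms(3)[OF that] by (simp add: fund_weight_def)
  show ?thesis
  proof (cases "c \<le> r")
    case True
    then have "c \<in> {1..r}" using assms(1) by simp
    then show ?thesis using e[of c] by (auto simp: eps_coord_def of_bool_def split: if_splits)
  next
    case False
    then have "bar r c \<in> {1..r}" using assms(1) by (auto simp: bar_def)
    then show ?thesis using e[of "bar r c"] bar_bar[OF assms(1)] by (auto simp: eps_coord_def of_bool_def split: if_splits)
  qed
qed

section \<open>Highest weight vectors and the scalars by which the R-matrix acts on them\<close>

definition arrow_square :: "nat \<Rightarrow> complex \<Rightarrow> umod" where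
  "arrow_square r qh = utensor r qh (L1 r 1) (L1 r 1)"

definition highest_weight :: "nat \<Rightarrow> complex \<Rightarrow> complex \<Rightarrow> (nat \<Rightarrow> int) \<Rightarrow> complex vec \<Rightarrow> bool" where
  "highest_weight r q qh lam w \<longleftrightarrow> w \<in> carrier_vec ((2*r)\<^sup>2) \<and>
    (\<forall>i\<in>{1..r}. mE (arrow_square r qh) i *\<^sub>v w = 0\<^sub>v ((2*r)\<^sup>2) \<and>
      mK r q (arrow_square r qh) i *\<^sub>v w = (qi r q i powi lam i) \<cdot>\<^sub>v w)"

lemma highest_weight_support:
  assumes q: "q \<noteq> 0" "\<And>n::nat. n > 0 \<Longrightarrow> q ^ n \<noteq> 1" and w: "highest_weight r q qh lam w"
    and c: "c \<in> {1..2*r}" and d: "d \<in> {1..2*r}" and nz: "coords (2*r) w c d \<noteq> 0" and j: "j \<in> {1..r}"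
  shows "eps_coord r j c + eps_coord r j d = (\<Sum>i=j..r. lam i)"
  using weight_vector_support[OF q _ _ c d nz j, of qh lam] w unfolding highest_weight_def arrow_square_def by blast

lemma highest_weight_mE:
  assumes w: "highest_weight r q qh lam w" and i: "1 \<le> i" "i \<le> r" and c: "c \<in> {1..2*r}" and d: "d \<in> {1..2*r}"
  shows "L_op {i, bar r (i + 1)} Suc (half_weight r qh i) 1 1 (coords (2*r) w) c d = 0"
proof -
  have wc: "w \<in> carrier_vec ((2*r)\<^sup>2)" using w by (simp add: highest_weight_def)
  have "mE (utensor r qh (L1 r 1) (L1 r 1)) i *\<^sub>v w = 0\<^sub>v ((2*r)\<^sup>2)"
    using w i by (simp add: highest_weight_def arrow_square_def)
  then have "coords (2*r) (mE (utensor r qh (L1 r 1) (L1 r 1)) i *\<^sub>v w) c d = 0"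
    using coords_linear(4)[OF wc wc c d] by simp
  then show ?thesis unfolding coords_mE[OF i wc c d] .
qed

lemma R_mat_highest_weight_2w1:
  assumes r: "r \<ge> 1" and q: "q \<noteq> 0" "\<And>n::nat. n > 0 \<Longrightarrow> q ^ n \<noteq> 1"
    and w: "highest_weight r q qh (\<lambda>j. 2 * fund_weight 1 j) w"
  shows "R_mat r q B X *\<^sub>v w = w"
proof -
  have wc: "w \<in> carrier_vec ((2*r)\<^sup>2)" using w by (simp add: highest_weight_def)
  let ?e = "unit_vec ((2*r)\<^sup>2) 0 :: complex vec"
  have "w = (w $ 0) \<cdot>\<^sub>v ?e"
  proof (rule coords_eqI[OF wc smult_carrier_vec[THEN iffD2, OF unit_vec_carrier]])
    fix c d assume c: "c \<in> {1..2*r}" and d: "d \<in> {1..2*r}"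
    have "(c - 1) * (2*r) + (d - 1) = 0 \<longleftrightarrow> c = 1 \<and> d = 1"
      using c d r by (cases c; cases d) auto
    moreover have "coords (2*r) w c d = 0" if "\<not> (c = 1 \<and> d = 1)"
      using that support_2w1[OF r c d] highest_weight_support[OF q w c d] by blast
    moreover have "0 < (2*r)\<^sup>2" using r by simp
    ultimately show "coords (2*r) w c d = coords (2*r) ((w $ 0) \<cdot>\<^sub>v ?e) c d"
      using tens_index(1)[OF c d] unfolding coords_linear(3)[OF unit_vec_carrier unit_vec_carrier c d]
      by (cases "c = 1 \<and> d = 1") (auto simp: coords_def)
  qed
  moreover have "R_mat r q B X *\<^sub>v (k \<cdot>\<^sub>v ?e) = k \<cdot>\<^sub>v ?e" for k
    using mult_mat_vec[OF R_mat_carrier unit_vec_carrier, of r q B X k 0] R_mat_highest[OF r] by simp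
  ultimately show ?thesis by metis
qed

lemma coords_R_mat:
  assumes "w \<in> carrier_vec ((2*r)\<^sup>2)" "c \<in> {1..2*r}" "d \<in> {1..2*r}"
  shows "coords (2*r) (R_mat r q B X *\<^sub>v w) c d = R_op r (R_A q B) B (R_C r q B X) (coords (2*r) w) c d"
  unfolding R_mat_def by (rule coords_R_coef[OF assms])

lemma R_mat_highest_weight_w2:
  assumes r: "r \<ge> 2" and q: "q \<noteq> 0" "\<And>n::nat. n > 0 \<Longrightarrow> q ^ n \<noteq> 1" and qh: "qh\<^sup>2 = q"
    and w: "highest_weight r q qh (fund_weight 2) w"
  shows "R_mat r q B X *\<^sub>v w = (1 - q * B - inverse q * B) \<cdot>\<^sub>v w"
proof -
  let ?f = "coords (2*r) w"
  have wc: "w \<in> carrier_vec ((2*r)\<^sup>2)" using w by (simp add: highest_weight_def)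
  have f0: "?f c d = 0" if "c \<in> {1..2*r}" "d \<in> {1..2*r}" "\<not> (c = 1 \<and> d = 2 \<or> c = 2 \<and> d = 1)" for c d
    using that(3) support_w2[OF r that(1,2)] highest_weight_support[OF q w that(1,2)] by blast
  have I: "1 \<in> {1..2*r}" "2 \<in> {1..2*r}" using r by auto
  have qh0: "qh \<noteq> 0" using q qh by auto
  have hw: "half_weight r qh 1 1 = qh"
    using half_weight_arrow(2)[of 1 r "bar r (bar r 1)" qh] r I by auto
  \<comment> \<open>The coefficient of v_1 (x) v_1 in E_1 w fixes the ratio of the two coordinates
    of w.\<close>
  have "L_op {1, bar r (1 + 1)} Suc (half_weight r qh 1) 1 1 ?f 1 1 = 0"
    by (rule highest_weight_mE[OF w _ _ I(1) I(1)]) (use r in auto)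
  then have "qh * ?f 2 1 + inverse qh * ?f 1 2 = 0"
    unfolding L_op_def hw by (simp add: numeral_2_eq_2)
  then have "qh * (qh * ?f 2 1 + inverse qh * ?f 1 2) = 0" by simp
  then have "?f 1 2 = - q * ?f 2 1"
    using qh0 unfolding distrib_left mult.assoc[symmetric] qh[symmetric] power2_eq_square by (simp add: add_eq_0_iff2)
  then have f21: "?f 2 1 = - inverse q * ?f 1 2" using q(1) by simp
  have bar0: "?f k (bar r k) = 0" if "k \<in> {1..2*r}" for k
  proof (rule f0[OF that bar_in[OF that]])
    show "\<not> (k = 1 \<and> bar r k = 2 \<or> k = 2 \<and> bar r k = 1)" using r by (auto simp: bar_def)
  qed
  then have sum0: "(\<Sum>k\<in>{1..2*r}. R_C r q B X c k * ?f k (bar r k)) = 0" for c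
    by (intro sum.neutral) auto
  show ?thesis
  proof (rule coords_eqI[OF mult_mat_vec_carrier[OF R_mat_carrier wc] smult_carrier_vec[THEN iffD2, OF wc]])
    fix c d assume c: "c \<in> {1..2*r}" and d: "d \<in> {1..2*r}"
    have R: "coords (2*r) (R_mat r q B X *\<^sub>v w) c d = R_A q B c d * ?f c d + (if c \<noteq> d then B * ?f d c else 0)"
      unfolding coords_R_mat[OF wc c d] R_op_def sum0 by simp
    consider "c = 1" "d = 2" | "c = 2" "d = 1" | "\<not> (c = 1 \<and> d = 2 \<or> c = 2 \<and> d = 1)" by auto
    then show "coords (2*r) (R_mat r q B X *\<^sub>v w) c d = coords (2*r) ((1 - q * B - inverse q * B) \<cdot>\<^sub>v w) c d"
      unfolding R coords_linear(3)[OF wc wc c d]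
    proof cases
      case 1
      show "R_A q B c d * ?f c d + (if c \<noteq> d then B * ?f d c else 0) = (1 - q * B - inverse q * B) * ?f c d"
        unfolding 1 f21 by (simp add: R_A_def algebra_simps)
    next
      case 2
      have "?f 1 2 = - q * ?f 2 1" by fact
      then show "R_A q B c d * ?f c d + (if c \<noteq> d then B * ?f d c else 0) = (1 - q * B - inverse q * B) * ?f c d"
        unfolding 2 by (simp add: R_A_def algebra_simps)
    next
      case 3
      then have "?f c d = 0" "?f d c = 0" using f0[OF c d] f0[OF d c] by auto
      then show "R_A q B c d * ?f c d + (if c \<noteq> d then B * ?f d c else 0) = (1 - q * B - inverse q * B) * ?f c d"
        by simp
    qed
  qed
qed

text \<open>For i < r the equation E_i w = 0, read at (i, bar (i + 1)) and at (bar (i + 1), i),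
  gives the ratio at k = i and at k = bar (i + 1). E_r, read at (r, r), gives the middle ratio;
  there K_r^(1/2) contributes q instead of the square root of q, hence q^2.\<close>

lemma highest_weight_0_ratio:
  assumes q: "q \<noteq> 0" and qh: "qh\<^sup>2 = q"
    and w: "highest_weight r q qh lam w" and k: "k \<in> {1..2*r}" "k + 1 \<in> {1..2*r}"
  shows "coords (2*r) w k (bar r k) = - (if k = r then q\<^sup>2 else q) * coords (2*r) w (k + 1) (bar r (k + 1))"
proof -
  let ?f = "coords (2*r) w"
  have qh0: "qh \<noteq> 0" using q qh by auto
  have solve: "a = - (s * s) * b" if "s * b + inverse s * a = 0" "s \<noteq> 0" for a b s :: complex
  proof -
    have "s * (s * b + inverse s * a) = 0" using that by simp
    then have "s * s * b + a = 0" using that(2) by (simp add: distrib_left flip: mult.assoc)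
    then show ?thesis by (simp add: add_eq_0_iff2)
  qed
  show ?thesis
  proof (cases "k = r")
    case True
    have r1: "1 \<le> r" using k True by auto
    have rr: "bar r (r + 1) = r" "bar r r = r + 1" by (simp_all add: bar_def)
    have I: "r \<in> {1..2*r}" using r1 by auto
    have "L_op {r, bar r (r + 1)} Suc (half_weight r qh r) 1 1 ?f r r = 0"
      by (rule highest_weight_mE[OF w r1 le_refl I I])
    moreover have "half_weight r qh r r = q" using half_weight_end(2)[OF r1, of qh] rr qh by simp
    ultimately have "q * ?f (r + 1) r + inverse q * ?f r (r + 1) = 0"
      by (simp add: L_op_def)
    from solve[OF this q] show ?thesis using True rr by (simp add: power2_eq_square)
  next
    case False
    define i where "i = (if k < r then k else bar r (k + 1))"
    have i: "1 \<le> i" "i < r" using False k by (auto simp: i_def bar_def)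
    have ii: "i \<in> {1..2*r}" "i + 1 \<in> {1..2*r}" using i by auto
    note bb = bar_bar[OF ii(1)] bar_bar[OF ii(2)]
    have kk: "k = i \<or> k = bar r (i + 1) \<and> k + 1 = bar r i"
      using False k by (auto simp: i_def bar_def)
    have bS: "Suc (bar r (i + 1)) = bar r i" using i by (simp add: bar_def)
    have hw: "half_weight r qh i i = qh" "half_weight r qh i (bar r (i + 1)) = qh"
      using half_weight_arrow(2)[OF i, of i qh] half_weight_arrow(2)[OF i, of "bar r (i + 1)" qh] bb by auto
    have "L_op {i, bar r (i + 1)} Suc (half_weight r qh i) 1 1 ?f i (bar r (i + 1)) = 0"
      by (rule highest_weight_mE[OF w i(1) less_imp_le[OF i(2)] ii(1) bar_in[OF ii(2)]])
    then have 1: "qh * ?f (i + 1) (bar r (i + 1)) + inverse qh * ?f i (bar r i) = 0"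
      by (simp add: L_op_def hw[simplified] bS[simplified])
    have "L_op {i, bar r (i + 1)} Suc (half_weight r qh i) 1 1 ?f (bar r (i + 1)) i = 0"
      by (rule highest_weight_mE[OF w i(1) less_imp_le[OF i(2)] bar_in[OF ii(2)] ii(1)])
    then have 2: "qh * ?f (bar r i) i + inverse qh * ?f (bar r (i + 1)) (i + 1) = 0"
      by (simp add: L_op_def hw[simplified] bS[simplified])
    have qq: "qh * qh = q" using qh by (simp add: power2_eq_square)
    from kk show ?thesis
    proof
      assume "k = i"
      then show ?thesis using solve[OF 1 qh0] False by (simp add: qq)
    next
      assume "k = bar r (i + 1) \<and> k + 1 = bar r i"
      then have "k = bar r (i + 1)" "k + 1 = bar r i" "bar r k = i + 1" "bar r (k + 1) = i" using bb by auto
      then show ?thesis using solve[OF 2 qh0] False qq by simp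
    qed
  qed
qed

lemma eps_ratio:
  assumes q: "q \<noteq> 0" and k: "k \<in> {1..2*r}" "k + 1 \<in> {1..2*r}"
  shows "eps r q k = - (if k = r then q\<^sup>2 else q) * eps r q (k + 1)"
proof -
  consider "k < r" | "k = r" | "k > r" by linarith
  then show ?thesis
  proof cases
    case 1
    then show ?thesis using eps_Suc[of k r q] k q by simp
  next
    case 2
    then show ?thesis using q by (simp add: eps_def bar_def power2_eq_square)
  next
    case 3
    then have "r + 1 - bar r (k + 1) = Suc (r + 1 - bar r k)" using k by (auto simp: bar_def)
    then show ?thesis using 3 q by (simp add: eps_def)
  qed
qed

text \<open>By \<open>highest_weight_0_ratio\<close> and \<open>eps_ratio\<close> the coordinates on
  bar pairs and the numbers \<open>eps\<close> satisfy the same recursion. This is the invariant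
  vector, determined up to a factor.\<close>

lemma highest_weight_0_coords:
  assumes q: "q \<noteq> 0" and qh: "qh\<^sup>2 = q" and w: "highest_weight r q qh lam w" and k: "k \<in> {1..2*r}"
  shows "coords (2*r) w k (bar r k) * eps r q 1 = coords (2*r) w 1 (bar r 1) * eps r q k"
proof -
  have "k \<in> {1..2*r} \<longrightarrow> coords (2*r) w k (bar r k) * eps r q 1 = coords (2*r) w 1 (bar r 1) * eps r q k"
    if "k \<ge> 1" for k
    using that
  proof (induction k rule: dec_induct)
    case base
    then show ?case by simp
  next
    case (step k)
    show ?case
    proof
      assume "Suc k \<in> {1..2*r}"
      then have k: "k \<in> {1..2*r}" "k + 1 \<in> {1..2*r}" using step.hyps by auto
      define \<rho> where "\<rho> = - (if k = r then q\<^sup>2 else q)"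
      have "\<rho> \<noteq> 0" using q by (simp add: \<rho>_def)
      moreover have "\<rho> * (coords (2*r) w (k + 1) (bar r (k + 1)) * eps r q 1) = \<rho> * (coords (2*r) w 1 (bar r 1) * eps r q (k + 1))"
        using step.IH k(1) unfolding highest_weight_0_ratio[OF q qh w k] eps_ratio[OF q k] \<rho>_def[symmetric] by (simp add: mult_ac)
      ultimately show "coords (2*r) w (Suc k) (bar r (Suc k)) * eps r q 1 = coords (2*r) w 1 (bar r 1) * eps r q (Suc k)"
        by simp
    qed
  qed
  then show ?thesis using k by simp
qed

text \<open>Highest weight vectors of weight 0 form at most a line, so a single coordinate decides
  proportionality.\<close>

lemma highest_weight_0_eqI:
  assumes q: "q \<noteq> 0" "\<And>n::nat. n > 0 \<Longrightarrow> q ^ n \<noteq> 1" and qh: "qh\<^sup>2 = q" and r: "r \<ge> 1"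
    and w: "highest_weight r q qh (fund_weight 0) w" and v: "highest_weight r q qh (fund_weight 0) v"
    and eq: "coords (2*r) v 1 (bar r 1) = k * coords (2*r) w 1 (bar r 1)"
  shows "v = k \<cdot>\<^sub>v w"
proof -
  have wc: "w \<in> carrier_vec ((2*r)\<^sup>2)" and vc: "v \<in> carrier_vec ((2*r)\<^sup>2)"
    using w v by (simp_all add: highest_weight_def)
  show ?thesis
  proof (rule coords_eqI[OF vc smult_carrier_vec[THEN iffD2, OF wc]])
    fix c d assume c: "c \<in> {1..2*r}" and d: "d \<in> {1..2*r}"
    show "coords (2*r) v c d = coords (2*r) (k \<cdot>\<^sub>v w) c d"
      unfolding coords_linear(3)[OF wc wc c d]
    proof (cases "d = bar r c")
      case True
      have "coords (2*r) v c d * eps r q 1 = k * coords (2*r) w c d * eps r q 1"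
        unfolding True mult.assoc highest_weight_0_coords[OF q(1) qh v c] highest_weight_0_coords[OF q(1) qh w c] eq ..
      then show "coords (2*r) v c d = k * coords (2*r) w c d" using eps_nz[OF q(1), of r 1] by simp
    next
      case False
      then have "coords (2*r) v c d = 0" "coords (2*r) w c d = 0"
        using support_w0[OF c d] highest_weight_support[OF q w c d] highest_weight_support[OF q v c d] by blast+
      then show "coords (2*r) v c d = k * coords (2*r) w c d" by simp
    qed
  qed
qed

text \<open>The squares are q^(2m) and q^(-2m) for m = 1, ..., r. Together with 1 they add up to the
  q-integer of 2r + 1, by telescoping after multiplication with q - 1/q.\<close>

lemma sum_eps_squares:
  assumes q: "q \<noteq> 0"
  shows "(q - inverse q) * (\<Sum>k\<in>{1..2*r}. (eps r q k)\<^sup>2) = q ^ (2*r+1) - inverse q ^ (2*r+1) - (q - inverse q)"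
proof -
  have split: "{1..2*r} = {1..r} \<union> {r+1..2*r}" "{1..r} \<inter> {r+1..2*r} = {}" by auto
  have 1: "(\<Sum>k\<in>{1..r}. (eps r q k)\<^sup>2) = (\<Sum>m\<in>{1..r}. q ^ (2*m))"
    by (rule sum.reindex_bij_witness[of _ "\<lambda>m. r + 1 - m" "\<lambda>m. r + 1 - m"])
      (auto simp: eps_def power_even_eq simp flip: power_mult)
  have 2: "(\<Sum>k\<in>{r+1..2*r}. (eps r q k)\<^sup>2) = (\<Sum>m\<in>{1..r}. inverse q ^ (2*m))"
    by (rule sum.reindex_bij_witness[of _ "\<lambda>m. r + m" "\<lambda>k. k - r"])
      (auto simp: eps_def bar_def power_even_eq simp flip: power_mult)
  have 3: "(q - inverse q) * (\<Sum>m\<in>{1..n}. q ^ (2*m) + inverse q ^ (2*m))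
      = q ^ (2*n+1) - inverse q ^ (2*n+1) - (q - inverse q)" for n
  proof (induction n)
    case (Suc n)
    have step: "(q - p) * (q * q * u + p * p * v) = q * q * u * q - p * p * v * p - (u * q - v * p)"
      if "p * q = 1" for p u v :: complex
      using that by Groebner_Basis.algebra
    have "(q - inverse q) * (q ^ (2 * Suc n) + inverse q ^ (2 * Suc n))
        = q ^ (2 * Suc n + 1) - inverse q ^ (2 * Suc n + 1) - (q ^ (2*n+1) - inverse q ^ (2*n+1))"
      unfolding mult_Suc_right power_add power_one_right power2_eq_square by (rule step) (use q in simp)
    with Suc.IH show ?case by (simp add: distrib_left)
  qed simp
  show ?thesis
    unfolding split(1) sum.union_disjoint[OF finite_atLeastAtMost finite_atLeastAtMost split(2)] 1 2
    using 3[of r] by (simp only: sum.distrib)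
qed

text \<open>The image is assumed to be a highest weight vector of weight 0 again, so it is a
  multiple of w and the factor can be read from the coefficient of v_1 (x) v_(2r) alone.\<close>

lemma R_mat_highest_weight_0:
  assumes r: "r \<ge> 1" and q: "q \<noteq> 0" "\<And>n::nat. n > 0 \<Longrightarrow> q ^ n \<noteq> 1" and qh: "qh\<^sup>2 = q"
    and w: "highest_weight r q qh (fund_weight 0) w"
    and Tw: "highest_weight r q qh (fund_weight 0) (R_mat r q B X *\<^sub>v w)"
  shows "R_mat r q B X *\<^sub>v w = (1 - q * B + X * (\<Sum>k\<in>{1..2*r}. (eps r q k)\<^sup>2) - B / q ^ (2*r+1)) \<cdot>\<^sub>v w"
proof (rule highest_weight_0_eqI[OF q qh r w Tw])
  let ?f = "coords (2*r) w"
  have wc: "w \<in> carrier_vec ((2*r)\<^sup>2)" using w by (simp add: highest_weight_def)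
  define e where "e = eps r q 1"
  define f where "f = eps r q (2*r)"
  define \<gamma> where "\<gamma> = ?f 1 (bar r 1) / e"
  have I: "1 \<in> {1..2*r}" "bar r 1 \<in> {1..2*r}" "2*r \<in> {1..2*r}" using r by (auto simp: bar_def)
  have b: "bar r 1 = 2 * r" "bar r (2*r) = 1" by (simp_all add: bar_def)
  have e0: "e \<noteq> 0" using q by (simp add: e_def)
  have ef: "e * f = - 1" using eps_bar[OF I(1) q(1)] unfolding b e_def f_def .
  have e2: "e * e = q ^ (2*r)"
    using r by (simp add: e_def eps_def mult_2 power_add flip: power_mult_distrib)
  have g: "?f k (bar r k) = \<gamma> * eps r q k" if "k \<in> {1..2*r}" for k
    using highest_weight_0_coords[OF q(1) qh w that] e0 by (simp add: \<gamma>_def e_def field_simps)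
  define \<Sigma> where "\<Sigma> = (\<Sum>k\<in>{1..2*r}. (eps r q k)\<^sup>2)"
  have C: "(\<Sum>k\<in>{1..2*r}. R_C r q B X 1 k * ?f k (bar r k)) = \<gamma> * (e * X * \<Sigma> - (1 - inverse q) * B * f)"
  proof -
    have "(\<Sum>k\<in>{1..2*r}. R_C r q B X 1 k * ?f k (bar r k))
        = (\<Sum>k\<in>{1..2*r}. \<gamma> * (e * X * (eps r q k)\<^sup>2 - (if k = 2*r then (1 - inverse q) * B * f else 0)))"
    proof (rule sum.cong[OF refl])
      fix k assume k: "k \<in> {1..2*r}"
      show "R_C r q B X 1 k * ?f k (bar r k) = \<gamma> * (e * X * (eps r q k)\<^sup>2 - (if k = 2*r then (1 - inverse q) * B * f else 0))"
      proof (cases "k = 2*r")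
        case True
        have "R_C r q B X 1 (2*r) = - X - (1 - inverse q) * B" by (simp add: R_C_def)
        then have "R_C r q B X 1 k * ?f k (bar r k) = (- X - (1 - inverse q) * B) * (\<gamma> * f)"
          unfolding g[OF k] by (simp add: True f_def)
        \<comment> \<open>k = 2r is the only antidiagonal entry of row 1. Since e f = -1, its term -
          X f equals e X f^2, which fits the other terms of the sum.\<close>
        also have "\<dots> = \<gamma> * (e * X * f\<^sup>2 - (1 - inverse q) * B * f)"
          using ef unfolding power2_eq_square by Groebner_Basis.algebra
        finally show ?thesis using True by (simp add: f_def)
      next
        case False
        then have "R_C r q B X 1 k = e * eps r q k * X" using k by (simp add: R_C_def e_def)
        then show ?thesis unfolding g[OF k] using False by (simp add: power2_eq_square mult_ac)
      qed
    qed
    also have "\<dots> = \<gamma> * (e * X * \<Sigma> - (1 - inverse q) * B * f)"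
      using I(3) by (simp add: \<Sigma>_def sum_distrib_left[symmetric] sum_subtractf)
    finally show ?thesis .
  qed
  have R: "coords (2*r) (R_mat r q B X *\<^sub>v w) 1 (bar r 1)
      = (1 - q * B) * (\<gamma> * e) + B * (\<gamma> * f) + \<gamma> * (e * X * \<Sigma> - (1 - inverse q) * B * f)"
  proof -
    have 1: "R_A q B 1 (bar r 1) = 1 - q * B" using r unfolding b by (simp add: R_A_def)
    have 2: "?f 1 (bar r 1) = \<gamma> * e" "?f (bar r 1) 1 = \<gamma> * f" using g[OF I(1)] g[OF I(3)] unfolding b e_def f_def .
    show ?thesis unfolding coords_R_mat[OF wc I(1,2)] R_op_def C 1 2 by simp
  qed
  define p where "p = inverse (q ^ (2*r))"
  have p: "p * (e * e) = 1" using q by (simp add: p_def e2)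
  \<comment> \<open>From e f = -1 and e^2 = q^(2r): here \<open>p\<close> is q^(-2r), the source of
    the power in the last term of the scalar.\<close>
  have f: "f = - p * e" using ef p by Groebner_Basis.algebra
  have "B / q ^ (2*r+1) = B * p * inverse q" by (simp add: p_def divide_inverse)
  then show "coords (2*r) (R_mat r q B X *\<^sub>v w) 1 (bar r 1)
      = (1 - q * B + X * (\<Sum>k\<in>{1..2*r}. (eps r q k)\<^sup>2) - B / q ^ (2*r+1)) * ?f 1 (bar r 1)"
    unfolding R g[OF I(1)] \<Sigma>_def[symmetric] e_def[symmetric] f by (simp add: algebra_simps)
qed

section \<open>The formula in terms of projectors\<close>

definition arrow_commutes :: "nat \<Rightarrow> complex \<Rightarrow> complex \<Rightarrow> complex mat \<Rightarrow> bool" where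
  "arrow_commutes r q qh T \<longleftrightarrow> T \<in> carrier_mat ((2*r)\<^sup>2) ((2*r)\<^sup>2) \<and>
    (\<forall>i\<in>{1..r}. \<forall>A\<in>{mE (arrow_square r qh) i, mF (arrow_square r qh) i,
        mK r q (arrow_square r qh) i, mKinv r q (arrow_square r qh) i}. T * A = A * T)"

lemma mdim_arrow_square: "mdim (arrow_square r qh) = (2*r)\<^sup>2"
  by (simp only: arrow_square_def mdim_utensor mdim_L1 power2_eq_square)

lemma arrow_square_carrier:
  assumes "A \<in> {mE (arrow_square r qh) i, mF (arrow_square r qh) i, mK r q (arrow_square r qh) i, mKinv r q (arrow_square r qh) i}"
  shows "A \<in> carrier_mat ((2*r)\<^sup>2) ((2*r)\<^sup>2)"
  using assms mE_mF_carrier[of r qh 1 1 i] diag_op_carrier[of "(2*r)\<^sup>2"]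
  unfolding mK_def mKinv_def mdim_arrow_square unfolding arrow_square_def by blast

lemma arrow_commutes_vec:
  assumes T: "arrow_commutes r q qh T" and i: "i \<in> {1..r}" and v: "v \<in> carrier_vec ((2*r)\<^sup>2)"
    and A: "A \<in> {mE (arrow_square r qh) i, mF (arrow_square r qh) i, mK r q (arrow_square r qh) i, mKinv r q (arrow_square r qh) i}"
  shows "T *\<^sub>v (A *\<^sub>v v) = A *\<^sub>v (T *\<^sub>v v)"
proof -
  have TC: "T \<in> carrier_mat ((2*r)\<^sup>2) ((2*r)\<^sup>2)" using T by (simp only: arrow_commutes_def)
  note AC = arrow_square_carrier[OF A]
  have "T * A = A * T" using T i A unfolding arrow_commutes_def by blast
  then show ?thesis
    unfolding assoc_mult_mat_vec[OF TC AC v, symmetric] assoc_mult_mat_vec[OF AC TC v, symmetric] by simp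
qed

lemma arrow_commutes_highest_weight:
  assumes T: "arrow_commutes r q qh T" and w: "highest_weight r q qh lam w"
  shows "highest_weight r q qh lam (T *\<^sub>v w)"
proof -
  have TC: "T \<in> carrier_mat ((2*r)\<^sup>2) ((2*r)\<^sup>2)" using T by (simp only: arrow_commutes_def)
  have wc: "w \<in> carrier_vec ((2*r)\<^sup>2)" using w by (simp only: highest_weight_def)
  have T0: "T *\<^sub>v 0\<^sub>v ((2*r)\<^sup>2) = 0\<^sub>v ((2*r)\<^sup>2)" using TC by (intro eq_vecI) auto
  show ?thesis
    unfolding highest_weight_def
  proof (intro conjI ballI)
    show "T *\<^sub>v w \<in> carrier_vec ((2*r)\<^sup>2)" by (rule mult_mat_vec_carrier[OF TC wc])
    fix i assume i: "i \<in> {1..r}"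
    have "mE (arrow_square r qh) i *\<^sub>v (T *\<^sub>v w) = T *\<^sub>v (mE (arrow_square r qh) i *\<^sub>v w)"
      using arrow_commutes_vec[OF T i wc] by simp
    also have "mE (arrow_square r qh) i *\<^sub>v w = 0\<^sub>v ((2*r)\<^sup>2)" using w i by (simp only: highest_weight_def)
    finally show "mE (arrow_square r qh) i *\<^sub>v (T *\<^sub>v w) = 0\<^sub>v ((2*r)\<^sup>2)" using T0 by simp
    have "mK r q (arrow_square r qh) i *\<^sub>v (T *\<^sub>v w) = T *\<^sub>v (mK r q (arrow_square r qh) i *\<^sub>v w)"
      using arrow_commutes_vec[OF T i wc] by simp
    also have "mK r q (arrow_square r qh) i *\<^sub>v w = (qi r q i powi lam i) \<cdot>\<^sub>v w" using w i by (simp only: highest_weight_def)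
    also have "T *\<^sub>v \<dots> = (qi r q i powi lam i) \<cdot>\<^sub>v (T *\<^sub>v w)" by (rule mult_mat_vec[OF TC wc])
    finally show "mK r q (arrow_square r qh) i *\<^sub>v (T *\<^sub>v w) = (qi r q i powi lam i) \<cdot>\<^sub>v (T *\<^sub>v w)" .
  qed
qed

text \<open>Schur's lemma: the eigenspace of \<open>T\<close> inside \<open>W\<close> is a submodule containing a highest weight vector.\<close>

lemma arrow_commutes_is_L:
  assumes T: "arrow_commutes r q qh T" and W: "is_L r q (arrow_square r qh) lam W"
    and hw: "\<And>w. highest_weight r q qh lam w \<Longrightarrow> T *\<^sub>v w = k \<cdot>\<^sub>v w"
    and v: "v \<in> W"
  shows "v \<in> carrier_vec ((2*r)\<^sup>2)" "T *\<^sub>v v = k \<cdot>\<^sub>v v"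
proof -
  let ?M = "arrow_square r qh" and ?n = "(2*r)\<^sup>2"
  have TC: "T \<in> carrier_mat ?n ?n" using T by (simp only: arrow_commutes_def)
  have sub: "C_submodule r q ?M W" using W by (simp only: is_L_def)
  have Wsub: "W \<subseteq> carrier_vec ?n" and add: "\<And>a b. a \<in> W \<Longrightarrow> b \<in> W \<Longrightarrow> a + b \<in> W" and zero: "0\<^sub>v ?n \<in> W"
    and smult: "\<And>c a. a \<in> W \<Longrightarrow> c \<cdot>\<^sub>v a \<in> W"
    using sub unfolding C_submodule_def mdim_arrow_square subspace_vec_iff by blast+
  show vc: "v \<in> carrier_vec ?n" using v Wsub by blast
  define U where "U = {x \<in> W. T *\<^sub>v x = k \<cdot>\<^sub>v x}"
  have U: "x \<in> carrier_vec ?n" "x \<in> W" "T *\<^sub>v x = k \<cdot>\<^sub>v x" if "x \<in> U" for x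
    using that Wsub by (auto simp: U_def)
  have "C_submodule r q ?M U"
    unfolding C_submodule_def mdim_arrow_square subspace_vec_iff
  proof (intro conjI ballI allI)
    show "U \<subseteq> carrier_vec ?n" using U(1) by blast
    have "T *\<^sub>v 0\<^sub>v ?n = k \<cdot>\<^sub>v 0\<^sub>v ?n" using TC by (intro eq_vecI) auto
    then show "0\<^sub>v ?n \<in> U" using zero by (simp add: U_def)
  next
    fix x y assume x: "x \<in> U" and y: "y \<in> U"
    have "T *\<^sub>v (x + y) = k \<cdot>\<^sub>v (x + y)"
      unfolding mult_add_distrib_mat_vec[OF TC U(1)[OF x] U(1)[OF y]] U(3)[OF x] U(3)[OF y]
      by (rule smult_add_distrib_vec[OF U(1)[OF x] U(1)[OF y], symmetric])
    then show "x + y \<in> U" using add[OF U(2)[OF x] U(2)[OF y]] by (simp add: U_def)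
  next
    fix c x assume x: "x \<in> U"
    have "T *\<^sub>v (c \<cdot>\<^sub>v x) = k \<cdot>\<^sub>v (c \<cdot>\<^sub>v x)"
      unfolding mult_mat_vec[OF TC U(1)[OF x]] U(3)[OF x] by (simp add: smult_smult_assoc mult.commute)
    then show "c \<cdot>\<^sub>v x \<in> U" using smult[OF U(2)[OF x]] by (simp add: U_def)
  next
    fix i x assume i: "i \<in> {1..r}" and x: "x \<in> U"
    have "A *\<^sub>v x \<in> U"
      if A: "A \<in> {mE ?M i, mF ?M i, mK r q ?M i, mKinv r q ?M i}" for A
    proof -
      have "A *\<^sub>v x \<in> W" using sub A i U(2)[OF x] unfolding C_submodule_def by blast
      moreover have "T *\<^sub>v (A *\<^sub>v x) = k \<cdot>\<^sub>v (A *\<^sub>v x)"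
        unfolding arrow_commutes_vec[OF T i U(1)[OF x] A] U(3)[OF x]
        by (rule mult_mat_vec[OF arrow_square_carrier[OF A] U(1)[OF x]])
      ultimately show ?thesis by (simp add: U_def)
    qed
    then show "mE ?M i *\<^sub>v x \<in> U" "mF ?M i *\<^sub>v x \<in> U" "mK r q ?M i *\<^sub>v x \<in> U" "mKinv r q ?M i *\<^sub>v x \<in> U"
      by blast+
  qed
  moreover have "U \<subseteq> W" by (auto simp: U_def)
  ultimately have "U = {0\<^sub>v ?n} \<or> U = W"
    using W unfolding is_L_def mdim_arrow_square by blast
  moreover obtain w where w: "w \<in> W" "w \<noteq> 0\<^sub>v ?n" "\<And>i. i \<in> {1..r} \<Longrightarrow> mE ?M i *\<^sub>v w = 0\<^sub>v ?n \<and>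
      mK r q ?M i *\<^sub>v w = (qi r q i powi lam i) \<cdot>\<^sub>v w"
    using W unfolding is_L_def mdim_arrow_square by blast
  have "highest_weight r q qh lam w"
    unfolding highest_weight_def using w Wsub by blast
  then have "w \<in> U" using hw w(1) by (simp add: U_def)
  ultimately have "U = W" using w(2) by blast
  then show "T *\<^sub>v v = k \<cdot>\<^sub>v v" using v by (auto simp: U_def)
qed

lemma arrow_commutes_hom:
  assumes "umodule_hom r q (utensor r qh (L1 r a) (L1 r b)) (utensor r qh (L1 r b) (L1 r a)) T"
  shows "arrow_commutes r q qh T"
proof -
  have d: "mdim (utensor r qh (L1 r a) (L1 r b)) = (2*r)\<^sup>2" for a b
    by (simp only: mdim_utensor mdim_L1 power2_eq_square)
  show ?thesis
    unfolding arrow_commutes_def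
  proof (intro conjI ballI)
    show "T \<in> carrier_mat ((2*r)\<^sup>2) ((2*r)\<^sup>2)" using assms unfolding umodule_hom_def d by blast
    fix i A assume i: "i \<in> {1..r}"
      and A: "A \<in> {mE (arrow_square r qh) i, mF (arrow_square r qh) i, mK r q (arrow_square r qh) i, mKinv r q (arrow_square r qh) i}"
    have i1: "i \<ge> 1" "i \<in> {0..r}" using i by auto
    let ?M = "utensor r qh (L1 r a) (L1 r b)" and ?N = "utensor r qh (L1 r b) (L1 r a)"
    have h: "T * mE ?M i = mE ?N i * T \<and> T * mF ?M i = mF ?N i * T \<and>
        T * mK r q ?M i = mK r q ?N i * T \<and> T * mKinv r q ?M i = mKinv r q ?N i * T"
      using assms i1(2) unfolding umodule_hom_def by blast
    have "T * mE (arrow_square r qh) i = mE (arrow_square r qh) i * T" "T * mF (arrow_square r qh) i = mF (arrow_square r qh) i * T"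
      "T * mK r q (arrow_square r qh) i = mK r q (arrow_square r qh) i * T" "T * mKinv r q (arrow_square r qh) i = mKinv r q (arrow_square r qh) i * T"
      using h unfolding arrow_square_def utensor_arrow[OF i1(1), where a = a and b = b] utensor_arrow[OF i1(1), where a = b and b = a]
      by blast+
    then show "T * A = A * T" using A by blast
  qed
qed

lemma eigenvalue_w2:
  assumes "q \<noteq> 0" "t \<noteq> q\<^sup>2"
  shows "1 - q * R_B q t - inverse q * R_B q t = - (inverse q ^ 2 * ((1 - q ^ 2 * t) / (1 - inverse q ^ 2 * t)))"
proof -
  note D = R_B_denominator[OF assms]
  define p where "p = inverse q"
  have pq: "p * q = 1" using assms(1) by (simp add: p_def)
  have D2: "1 - p ^ 2 * t \<noteq> 0"
  proof
    assume "1 - p ^ 2 * t = 0"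
    then have "q - p * t = 0" using pq unfolding power2_eq_square by Groebner_Basis.algebra
    then show False using D by (simp add: p_def)
  qed
  have DD: "q - p * t = q * (1 - p ^ 2 * t)"
    using pq unfolding power2_eq_square by Groebner_Basis.algebra
  have "1 - q * R_B q t - p * R_B q t = (q - p * t - q * (1 - t) - p * (1 - t)) / (q - p * t)"
  proof -
    have "1 - q * (n / D) - p * (n / D) = (D - q * n - p * n) / D" if "D \<noteq> 0" for n D :: complex
      using that by (simp add: diff_divide_distrib)
    from this[OF D] show ?thesis unfolding R_B_def p_def[symmetric] .
  qed
  also have "q - p * t - q * (1 - t) - p * (1 - t) = q * (- (p ^ 2 * (1 - q ^ 2 * t)))"
    using pq unfolding power2_eq_square by Groebner_Basis.algebra
  finally show ?thesis unfolding DD p_def[symmetric] using assms(1) D2 by simp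
qed

lemma eigenvalue_w0:
  assumes q: "q \<noteq> 0" and t: "t \<noteq> q\<^sup>2" "t \<noteq> - (q ^ (2*r))"
  shows "1 - q * R_B q t + R_X r q t * (\<Sum>k\<in>{1..2*r}. (eps r q k)\<^sup>2) - R_B q t / q ^ (2*r+1)
    = - (inverse q ^ (2 * r + 2) * (((1 - q ^ 2 * t) * (1 + q ^ (2 * r) * t)) / ((1 - inverse q ^ 2 * t) * (1 + inverse q ^ (2 * r) * t))))"
proof -
  define p where "p = inverse q"
  define w where "w = q ^ (2*r)"
  define w' where "w' = p ^ (2*r)"
  have pq: "p * q = 1" using q by (simp add: p_def)
  have ww: "w * w' = 1" using q by (simp add: w_def w'_def p_def flip: power_mult_distrib)
  define \<Sigma> where "\<Sigma> = (\<Sum>k\<in>{1..2*r}. (eps r q k)\<^sup>2)"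
  have S: "(q - p) * \<Sigma> = q * w - p * w' - (q - p)"
    using sum_eps_squares[OF q, of r] by (simp add: \<Sigma>_def p_def w_def w'_def)
  define D where "D = q - p * t"
  define N where "N = w + t"
  have D: "D \<noteq> 0" using R_B_denominator[OF q t(1)] by (simp add: D_def p_def)
  have N: "N \<noteq> 0" using t(2) by (metis N_def w_def add.commute eq_neg_iff_add_eq_0)
  have B: "R_B q t * D = 1 - t" using D by (simp add: R_B_def D_def p_def)
  have X: "R_X r q t * N = - ((q - p) * R_B q t * t)" using N by (simp add: R_X_def p_def flip: N_def w_def)
  have last: "R_B q t / q ^ (2*r+1) = R_B q t * p * w'"
  proof -
    have "R_B q t = R_B q t * p * w' * (w * q)" using pq ww by Groebner_Basis.algebra
    moreover have "w * q \<noteq> 0" using q by (simp add: w_def)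
    moreover have "q ^ (2*r+1) = w * q" by (simp add: w_def)
    ultimately show ?thesis by (simp only: nonzero_divide_eq_eq not_False_eq_True)
  qed
  let ?L = "1 - q * R_B q t + R_X r q t * \<Sigma> - R_B q t * p * w'"
  have "?L * (D * N) = - p * (1 - q ^ 2 * t) * (1 + w * t)"
  proof -
    have "?L * (D * N) = D * N - q * (R_B q t * D) * N + (R_X r q t * N) * \<Sigma> * D - (R_B q t * D) * p * w' * N"
      by (simp add: algebra_simps)
    also have "(R_X r q t * N) * \<Sigma> * D = - ((R_B q t * D) * t * ((q - p) * \<Sigma>))"
      unfolding X by (simp add: mult_ac)
    finally have "?L * (D * N) = D * N - q * (1 - t) * N + - ((1 - t) * t * (q * w - p * w' - (q - p))) - (1 - t) * p * w' * N"
      unfolding B S .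
    \<comment> \<open>The last two summands are explicit multiples of w w' - 1 and 1 - p q, chosen
      so that the equation holds as a polynomial identity; both vanish afterwards.\<close>
    also have "\<dots> = - p * (1 - q * q * t) * (1 + w * t) + (w * w' - 1) * (t * p - p) + (1 - p * q) * (t * q + t * t * q * w)"
      unfolding D_def N_def by (simp add: algebra_simps)
    finally show ?thesis by (simp add: pq ww power2_eq_square)
  qed
  moreover have "D * N \<noteq> 0" using D N by simp
  ultimately have L: "?L = - p * (1 - q ^ 2 * t) * (1 + w * t) / (D * N)"
    by (simp only: nonzero_eq_divide_eq not_False_eq_True)
  have DD: "D = q * (1 - p ^ 2 * t)"
    using pq unfolding D_def power2_eq_square by Groebner_Basis.algebra
  have NN: "N = w * (1 + w' * t)"
    using ww unfolding N_def by Groebner_Basis.algebra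
  have w0: "w \<noteq> 0" using q by (simp add: w_def)
  have pp: "p ^ (2 * r + 2) = w' * p * p" by (simp add: w'_def power_add power2_eq_square)
  have "?L = - (w' * p * p * (((1 - q ^ 2 * t) * (1 + w * t)) / ((1 - p ^ 2 * t) * (1 + w' * t))))"
  proof -
    have "- p / (q * w) = - (w' * p * p)"
    proof -
      have "q * w \<noteq> 0" using q w0 by simp
      moreover have "- p = - (w' * p * p) * (q * w)" using pq ww by Groebner_Basis.algebra
      ultimately show ?thesis by (simp only: nonzero_divide_eq_eq not_False_eq_True)
    qed
    moreover have "?L = (- p / (q * w)) * (((1 - q ^ 2 * t) * (1 + w * t)) / ((1 - p ^ 2 * t) * (1 + w' * t)))"
      unfolding L DD NN by (simp only: times_divide_times_eq mult_ac)
    ultimately show ?thesis by simp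
  qed
  then show ?thesis unfolding last \<Sigma>_def[symmetric] p_def[symmetric] pp w_def[symmetric] w'_def[symmetric] .
qed

lemma R_mat_projectors:
  assumes r: "r \<ge> 2" and q: "q \<noteq> 0" "\<And>n::nat. n > 0 \<Longrightarrow> q ^ n \<noteq> 1" and qh: "qh\<^sup>2 = q"
    and P: "projectors r q qh P2w1 Pw2 Pw0"
    and T: "arrow_commutes r q qh (R_mat r q B X)" and kl: "k < (2*r)\<^sup>2" "l < (2*r)\<^sup>2"
  shows "R_mat r q B X $$ (k, l) = P2w1 $$ (k, l) + (1 - q * B - inverse q * B) * Pw2 $$ (k, l)
    + (1 - q * B + X * (\<Sum>k\<in>{1..2*r}. (eps r q k)\<^sup>2) - B / q ^ (2*r+1)) * Pw0 $$ (k, l)"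
proof -
  let ?n = "(2*r)\<^sup>2" and ?T = "R_mat r q B X" and ?M = "arrow_square r qh"
  let ?a = "1 - q * B - inverse q * B" and ?b = "1 - q * B + X * (\<Sum>k\<in>{1..2*r}. (eps r q k)\<^sup>2) - B / q ^ (2*r+1)"
  have r1: "r \<ge> 1" using r by simp
  obtain W2w1 Ww2 Ww0 where
    C: "P2w1 \<in> carrier_mat ?n ?n" "Pw2 \<in> carrier_mat ?n ?n" "Pw0 \<in> carrier_mat ?n ?n"
    and L: "is_L r q ?M (\<lambda>j. 2 * fund_weight 1 j) W2w1" "is_L r q ?M (fund_weight 2) Ww2" "is_L r q ?M (fund_weight 0) Ww0"
    and dec: "\<forall>v\<in>carrier_vec ?n. \<exists>!(x, y, w). x \<in> W2w1 \<and> y \<in> Ww2 \<and> w \<in> Ww0 \<and> v = x + y + w"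
    and proj: "\<forall>x\<in>W2w1. \<forall>y\<in>Ww2. \<forall>w\<in>Ww0.
          P2w1 *\<^sub>v (x + y + w) = x \<and> Pw2 *\<^sub>v (x + y + w) = y \<and> Pw0 *\<^sub>v (x + y + w) = w"
    using P unfolding projectors_def Let_def arrow_square_def[symmetric] mdim_arrow_square by blast
  \<comment> \<open>Column l of each matrix is its value on this vector, whose three components are
    eigenvectors of the R-matrix.\<close>
  let ?v = "unit_vec ?n l :: complex vec"
  obtain x y w where xyw: "x \<in> W2w1" "y \<in> Ww2" "w \<in> Ww0" and v: "?v = x + y + w"
    using dec unit_vec_carrier[of ?n l] by blast
  have x: "x \<in> carrier_vec ?n" "?T *\<^sub>v x = 1 \<cdot>\<^sub>v x"
    using arrow_commutes_is_L[OF T L(1) _ xyw(1), of 1] R_mat_highest_weight_2w1[OF r1 q] by simp_all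
  have y: "y \<in> carrier_vec ?n" "?T *\<^sub>v y = ?a \<cdot>\<^sub>v y"
    using arrow_commutes_is_L[OF T L(2) _ xyw(2)] R_mat_highest_weight_w2[OF r q qh] by blast+
  have w: "w \<in> carrier_vec ?n" "?T *\<^sub>v w = ?b \<cdot>\<^sub>v w"
    using arrow_commutes_is_L[OF T L(3) _ xyw(3)]
      R_mat_highest_weight_0[OF r1 q qh _ arrow_commutes_highest_weight[OF T]] by blast+
  have entry: "A $$ (k, l) = (A *\<^sub>v ?v) $ k" if "A \<in> carrier_mat ?n ?n" for A :: "complex mat"
    using that kl by simp
  have "?T *\<^sub>v ?v = 1 \<cdot>\<^sub>v x + ?a \<cdot>\<^sub>v y + ?b \<cdot>\<^sub>v w"
    unfolding v mult_add_distrib_mat_vec[OF R_mat_carrier add_carrier_vec[OF x(1) y(1)] w(1)]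
      mult_add_distrib_mat_vec[OF R_mat_carrier x(1) y(1)] x(2) y(2) w(2) ..
  moreover have "P2w1 *\<^sub>v ?v = x" "Pw2 *\<^sub>v ?v = y" "Pw0 *\<^sub>v ?v = w"
    unfolding v using proj xyw by blast+
  ultimately show ?thesis
    unfolding entry[OF R_mat_carrier] entry[OF C(1)] entry[OF C(2)] entry[OF C(3)]
    using kl x(1) y(1) w(1) by (simp del: power_mult_distrib)
qed

lemma R_eq_projectors:
  fixes q qh :: complex
  assumes r: "r \<ge> 2" and q: "q \<noteq> 0" "\<And>n::nat. n > 0 \<Longrightarrow> q ^ n \<noteq> 1" and qh: "qh\<^sup>2 = q"
    and R: "normalized_R_matrix r q qh R" and P: "projectors r q qh P2w1 Pw2 Pw0"
  defines "Q \<equiv> rat_const q" and "z \<equiv> rat_var"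
  shows "R = mat_const P2w1
             - (inverse Q ^ 2 * ((1 - Q ^ 2 * z) / (1 - inverse Q ^ 2 * z))) \<cdot>\<^sub>m mat_const Pw2
             - (inverse Q ^ (2 * r + 2) *
                 (((1 - Q ^ 2 * z) * (1 + Q ^ (2 * r) * z)) /
                  ((1 - inverse Q ^ 2 * z) * (1 + inverse Q ^ (2 * r) * z)))) \<cdot>\<^sub>m mat_const Pw0"
    (is "R = mat_const P2w1 - ?f \<cdot>\<^sub>m mat_const Pw2 - ?g \<cdot>\<^sub>m mat_const Pw0")
proof -
  let ?n = "(2*r)\<^sup>2"
  have RC: "R \<in> carrier_mat ?n ?n" using R unfolding normalized_R_matrix_def by blast
  have C: "P2w1 \<in> carrier_mat ?n ?n" "Pw2 \<in> carrier_mat ?n ?n" "Pw0 \<in> carrier_mat ?n ?n"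
    using P unfolding projectors_def Let_def arrow_square_def[symmetric] mdim_arrow_square by blast+
  have dims: "dim_row P2w1 = ?n" "dim_col P2w1 = ?n" "dim_row Pw2 = ?n" "dim_col Pw2 = ?n" "dim_row Pw0 = ?n" "dim_col Pw0 = ?n"
    using C by (simp_all only: carrier_matD)
  obtain S where S: "finite S" "\<And>t. t \<notin> S \<Longrightarrow> mat_eval R t = R_mat r q (R_B q t) (R_X r q t)"
    and hom: "\<And>t. t \<notin> S \<Longrightarrow> umodule_hom r q (utensor r qh (L1 r t) (L1 r 1)) (utensor r qh (L1 r 1) (L1 r t)) (mat_eval R t)"
    using mat_eval_R[OF r q(1) qh R] by metis
  let ?S = "S \<union> {q\<^sup>2, - (q ^ (2*r))}"
  let ?\<phi> = "\<lambda>t. inverse q ^ 2 * ((1 - q ^ 2 * t) / (1 - inverse q ^ 2 * t))"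
  let ?\<psi> = "\<lambda>t. inverse q ^ (2 * r + 2) * (((1 - q ^ 2 * t) * (1 + q ^ (2 * r) * t)) / ((1 - inverse q ^ 2 * t) * (1 + inverse q ^ (2 * r) * t)))"
  have eval: "mat_eval R t $$ (k, l) = P2w1 $$ (k, l) - ?\<phi> t * Pw2 $$ (k, l) - ?\<psi> t * Pw0 $$ (k, l)"
    if t: "t \<notin> ?S" and kl: "k < ?n" "l < ?n" for t k l
  proof -
    have t': "t \<notin> S" "t \<noteq> q\<^sup>2" "t \<noteq> - (q ^ (2*r))" using t by auto
    have "arrow_commutes r q qh (R_mat r q (R_B q t) (R_X r q t))"
      using arrow_commutes_hom[OF hom[OF t'(1)]] unfolding S(2)[OF t'(1)] .
    from R_mat_projectors[OF r q qh P this kl] show ?thesis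
      unfolding S(2)[OF t'(1)] eigenvalue_w2[OF q(1) t'(2)] eigenvalue_w0[OF q(1) t'(2,3)] by simp
  qed
  have \<phi>: "represents ?f ?\<phi>" unfolding Q_def z_def
    by (rule represents_mult represents_power represents_inverse represents_divide represents_diff represents_add
        represents_1 represents_const represents_var)+
  have \<psi>: "represents ?g ?\<psi>" unfolding Q_def z_def
    by (rule represents_mult represents_power represents_inverse represents_divide represents_diff represents_add
        represents_1 represents_const represents_var)+
  show ?thesis
  proof (rule eq_matI)
    fix k l assume "k < dim_row (mat_const P2w1 - ?f \<cdot>\<^sub>m mat_const Pw2 - ?g \<cdot>\<^sub>m mat_const Pw0)"
      "l < dim_col (mat_const P2w1 - ?f \<cdot>\<^sub>m mat_const Pw2 - ?g \<cdot>\<^sub>m mat_const Pw0)"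
    then have kl: "k < ?n" "l < ?n" unfolding mat_const_def using dims by simp_all
    have "represents (R $$ (k, l)) (\<lambda>t. P2w1 $$ (k, l) - ?\<phi> t * Pw2 $$ (k, l) - ?\<psi> t * Pw0 $$ (k, l))"
      by (rule represents_ratfun_mat[OF RC _ kl, of ?S]) (use S(1) eval kl in auto)
    moreover have "represents (rat_const (P2w1 $$ (k, l)) - ?f * rat_const (Pw2 $$ (k, l)) - ?g * rat_const (Pw0 $$ (k, l)))
        (\<lambda>t. P2w1 $$ (k, l) - ?\<phi> t * Pw2 $$ (k, l) - ?\<psi> t * Pw0 $$ (k, l))"
      by (intro represents_diff represents_const represents_mult[OF \<phi>] represents_mult[OF \<psi>])
    ultimately have "R $$ (k, l) = rat_const (P2w1 $$ (k, l)) - ?f * rat_const (Pw2 $$ (k, l)) - ?g * rat_const (Pw0 $$ (k, l))"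
      by (rule represents_unique)
    also have "\<dots> = (mat_const P2w1 - ?f \<cdot>\<^sub>m mat_const Pw2 - ?g \<cdot>\<^sub>m mat_const Pw0) $$ (k, l)"
      unfolding mat_const_def by (simp only: index_minus_mat index_smult_mat index_map_mat dims kl)
    finally show "R $$ (k, l) = (mat_const P2w1 - ?f \<cdot>\<^sub>m mat_const Pw2 - ?g \<cdot>\<^sub>m mat_const Pw0) $$ (k, l)" .
  qed (use RC dims in \<open>simp_all only: mat_const_def index_minus_mat index_smult_mat index_map_mat carrier_matD\<close>)
qed

theorem theorem3p2:
  fixes r :: nat and q qh :: complex
    and R :: "ratfun mat" and P2w1 Pw2 Pw0 :: "complex mat"
    and z Q :: ratfun
  defines "z \<equiv> rat_var" and "Q \<equiv> rat_const q"
  assumes r: "r \<ge> 3"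
    and q: "q \<noteq> 0" "\<And>n::nat. n > 0 \<Longrightarrow> q ^ n \<noteq> 1"
    and qh: "qh\<^sup>2 = q"
    and R: "normalized_R_matrix r q qh R"
    and P: "projectors r q qh P2w1 Pw2 Pw0"
  shows "R = mat_const P2w1
             - (inverse Q ^ 2 * ((1 - Q ^ 2 * z) / (1 - inverse Q ^ 2 * z))) \<cdot>\<^sub>m mat_const Pw2
             - (inverse Q ^ (2 * r + 2) *
                 (((1 - Q ^ 2 * z) * (1 + Q ^ (2 * r) * z)) /
                  ((1 - inverse Q ^ 2 * z) * (1 + inverse Q ^ (2 * r) * z)))) \<cdot>\<^sub>m mat_const Pw0
       \<and>
         R = R_sl r q
             - ((Q - inverse Q) * (1 - z) /
                 ((Q - inverse Q * z) * (Q ^ r + inverse Q ^ r * z))) \<cdot>\<^sub>m Q_mat r q qh"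
proof
  have r2: "r \<ge> 2" using r by simp
  \<comment> \<open>Equivalent to qh + 1/qh being nonzero, the denominator in the antidiagonal part
    of Q(z).\<close>
  have "q \<noteq> - 1" using q(2)[of 2] by auto
  then show "R = R_sl r q
             - ((Q - inverse Q) * (1 - z) /
                 ((Q - inverse Q * z) * (Q ^ r + inverse Q ^ r * z))) \<cdot>\<^sub>m Q_mat r q qh"
    unfolding z_def Q_def by (rule R_eq_matrix_units[OF r2 q(1) _ qh R])
  show "R = mat_const P2w1
             - (inverse Q ^ 2 * ((1 - Q ^ 2 * z) / (1 - inverse Q ^ 2 * z))) \<cdot>\<^sub>m mat_const Pw2
             - (inverse Q ^ (2 * r + 2) *
                 (((1 - Q ^ 2 * z) * (1 + Q ^ (2 * r) * z)) /
                  ((1 - inverse Q ^ 2 * z) * (1 + inverse Q ^ (2 * r) * z)))) \<cdot>\<^sub>m mat_const Pw0"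
    unfolding z_def Q_def by (rule R_eq_projectors[OF r2 q qh R P])
qed

end
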